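(* Let $n\ge1$. There are precisely two $G$-orbits in $X_n$, namely $$G\cdot x_0=\bigsqcup_{\lambda\in\Lambda_n^+,\ |\lambda|\ \text{even}} K\cdot x_\lambda,\qquad G\cdot x_1=\bigsqcup_{\lambda\in\Lambda_n^+,\ |\lambda|\ \text{odd}} K\cdot x_\lambda,$$ where $|\lambda|=\sum_{i=1}^n\lambda_i$, $x_0=1_{2n+1}$ and $x_1=\mathrm{Diag}(\pi,1,\ldots,1,\pi^{-1})$.
   Context: Let $k$ be a finite extension of $\mathbb{Q}_p$ with $p$ odd, $k'$ the unramified quadratic extension of $k$, $a\mapsto a^*$ the nontrivial automorphism of $k'/k$; for a matrix $a$ over $k'$, $a^*$ is its conjugate transpose. Let $\mathcal{O}_{k'}$ be the ring of integers of $k'$ and $\pi$ a prime element of $k$. Let $j_m\in GL_m(k)$ be the matrix with anti-diagonal entries $1$ and other entries $0$. Put $G=\{g\in GL_{2n+1}(k'): g^*j_{2n+1}g=j_{2n+1}\}$, $K=G\cap M_{2n+1}(\mathcal{O}_{k'})$, $X_n=\{x\in G: x^*=x,\ \det(t\cdot 1_{2n+1}-xj_{2n+1})=(t^2-1)^n(t-1)\}$, with action $g\cdot x=gxg^*$. Let $\Lambda_n^+=\{\lambda\in\mathbb{Z}^n:\lambda_1\ge\cdots\ge\lambda_n\ge0\}$ and $x_\lambda=\mathrm{Diag}(\pi^{\lambda_1},\ldots,\pi^{\lambda_n},1,\pi^{-\lambda_n},\ldots,\pi^{-\lambda_1})$. *)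

theory Defs
  imports
    "HOL-Algebra.Algebraic_Closure_Type"
    "HOL-Algebra.Embedded_Algebras"
    "HOL-Computational_Algebra.Primes"
    "HOL-Library.Disjoint_Sets"
    "Jordan_Normal_Form.Char_Poly"
begin

text \<open>
  All fields are subfields of one ambient field, the type \<^typ>\<open>'a\<close>, which plays the
  role of $k'$; thus $Q \subseteq k \subseteq k' =$ \<^term>\<open>UNIV\<close>, with $Q$ a copy of the $p$-adic numbers.
\<close>

abbreviation ambient :: "'a::field ring" where
  "ambient \<equiv> ring_of_type_algebra"

definition padic_abs :: "nat \<Rightarrow> rat \<Rightarrow> real" where
  "padic_abs p q = (case quotient_of q of (a, b) \<Rightarrow>
     if a = 0 then 0
     else real p powi (int (multiplicity (int p) b) - int (multiplicity (int p) a)))"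

definition absolute_value_on :: "'a::field set \<Rightarrow> ('a \<Rightarrow> real) \<Rightarrow> bool" where
  "absolute_value_on F N \<longleftrightarrow>
     (\<forall>x\<in>F. 0 \<le> N x \<and> (N x = 0 \<longleftrightarrow> x = 0)) \<and>
     (\<forall>x\<in>F. \<forall>y\<in>F. N (x * y) = N x * N y \<and> N (x + y) \<le> N x + N y)"

text \<open>
  \<open>Q\<close> with \<open>N\<close> is the field of $p$-adic numbers with its absolute value, i.e. a completion of
  the rationals with respect to the $p$-adic absolute value. This determines the pair up to unique
  isomorphism.
\<close>

definition padic_numbers :: "nat \<Rightarrow> 'a::field_char_0 set \<Rightarrow> ('a \<Rightarrow> real) \<Rightarrow> bool" where
  "padic_numbers p Q N \<longleftrightarrow>
     subfield Q ambient \<and>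
     absolute_value_on Q N \<and>
     (\<forall>q. N (of_rat q) = padic_abs p q) \<and>
     (\<forall>x\<in>Q. \<forall>e>0. \<exists>q. N (x - of_rat q) < e) \<and>
     (\<forall>s :: nat \<Rightarrow> 'a. range s \<subseteq> Q \<longrightarrow>
        (\<forall>e>0. \<exists>M. \<forall>i\<ge>M. \<forall>j\<ge>M. N (s i - s j) < e) \<longrightarrow>
        (\<exists>l\<in>Q. (\<lambda>i. N (s i - l)) \<longlonglongrightarrow> 0))"

definition finite_extension :: "'a::field set \<Rightarrow> 'a set \<Rightarrow> bool" where
  "finite_extension F E \<longleftrightarrow>
     subfield F ambient \<and> subfield E ambient \<and> F \<subseteq> E \<and> ring.finite_dimension ambient F E"

definition quadratic_extension :: "'a::field set \<Rightarrow> 'a set \<Rightarrow> bool" where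
  "quadratic_extension F E \<longleftrightarrow>
     subfield F ambient \<and> subfield E ambient \<and> F \<subseteq> E \<and> ring.dimension ambient 2 F E"

definition padic_integers :: "'a::field set \<Rightarrow> ('a \<Rightarrow> real) \<Rightarrow> 'a set" where
  "padic_integers Q N = {x \<in> Q. N x \<le> 1}"

text \<open>The ring of integers of \<open>F\<close> is the integral closure of the $p$-adic integers in \<open>F\<close>.\<close>

definition ring_of_integers :: "'a::field set \<Rightarrow> ('a \<Rightarrow> real) \<Rightarrow> 'a set \<Rightarrow> 'a set" where
  "ring_of_integers Q N F =
     {x \<in> F. \<exists>f. lead_coeff f = 1 \<and> (\<forall>i. coeff f i \<in> padic_integers Q N) \<and> poly f x = 0}"

text \<open>The ring of integers is local, so its maximal ideal consists of its non-units.\<close>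

definition maximal_ideal_of :: "'a::field set \<Rightarrow> ('a \<Rightarrow> real) \<Rightarrow> 'a set \<Rightarrow> 'a set" where
  "maximal_ideal_of Q N F =
     {x \<in> ring_of_integers Q N F. \<not> (\<exists>y \<in> ring_of_integers Q N F. x * y = 1)}"

definition prime_element :: "'a::field set \<Rightarrow> ('a \<Rightarrow> real) \<Rightarrow> 'a set \<Rightarrow> 'a \<Rightarrow> bool" where
  "prime_element Q N F \<pi> \<longleftrightarrow>
     \<pi> \<in> F \<and> maximal_ideal_of Q N F = {\<pi> * y | y. y \<in> ring_of_integers Q N F}"

text \<open>
  Ramification index $1$: the maximal ideal of \<open>F\<close> generates that of \<open>E\<close>. Separability of the
  residue field extension is automatic, since the residue fields are finite.
\<close>

definition unramified :: "'a::field set \<Rightarrow> ('a \<Rightarrow> real) \<Rightarrow> 'a set \<Rightarrow> 'a set \<Rightarrow> bool" where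
  "unramified Q N F E \<longleftrightarrow> (\<exists>\<pi>. prime_element Q N F \<pi> \<and> prime_element Q N E \<pi>)"

definition automorphism_over :: "'a::field set \<Rightarrow> ('a \<Rightarrow> 'a) \<Rightarrow> bool" where
  "automorphism_over F \<sigma> \<longleftrightarrow> \<sigma> \<in> ring_iso ambient ambient \<and> (\<forall>x\<in>F. \<sigma> x = x)"

definition conj_transpose :: "('a \<Rightarrow> 'a) \<Rightarrow> 'a mat \<Rightarrow> 'a mat" where
  "conj_transpose \<sigma> A = transpose_mat (map_mat \<sigma> A)"

definition antidiag :: "nat \<Rightarrow> 'a::{zero,one} mat" where
  "antidiag m = mat m m (\<lambda>(i, j). if i + j + 1 = m then 1 else 0)"

definition unitary_group :: "('a::field \<Rightarrow> 'a) \<Rightarrow> nat \<Rightarrow> 'a mat set" where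
  "unitary_group \<sigma> n =
     {g \<in> carrier_mat (2 * n + 1) (2 * n + 1).
        invertible_mat g \<and>
        conj_transpose \<sigma> g * antidiag (2 * n + 1) * g = antidiag (2 * n + 1)}"

text \<open>\<open>R\<close> is to be the ring of integers of $k'$.\<close>

definition integral_unitary_group :: "('a::field \<Rightarrow> 'a) \<Rightarrow> 'a set \<Rightarrow> nat \<Rightarrow> 'a mat set" where
  "integral_unitary_group \<sigma> R n = {g \<in> unitary_group \<sigma> n. elements_mat g \<subseteq> R}"

definition hermitian_space :: "('a::field \<Rightarrow> 'a) \<Rightarrow> nat \<Rightarrow> 'a mat set" where
  "hermitian_space \<sigma> n =
     {x \<in> unitary_group \<sigma> n.
        conj_transpose \<sigma> x = x \<and>
        char_poly (x * antidiag (2 * n + 1)) = ([:0, 1:] ^ 2 - 1) ^ n * ([:0, 1:] - 1)}"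

definition herm_orbit :: "('a::field \<Rightarrow> 'a) \<Rightarrow> 'a mat set \<Rightarrow> 'a mat \<Rightarrow> 'a mat set" where
  "herm_orbit \<sigma> H x = {g * x * conj_transpose \<sigma> g | g. g \<in> H}"

definition dominant :: "nat \<Rightarrow> int list set" where
  "dominant n = {lam. length lam = n \<and> sorted_wrt (\<ge>) lam \<and> (\<forall>a \<in> set lam. 0 \<le> a)}"

text \<open>
  Indices are 0-based: \<open>lam ! 0\<close> is $\lambda_1$, and row \<open>i > n\<close> carries the exponent
  $-\lambda_{2n+1-i}$.
\<close>

definition x_diag :: "'a::field \<Rightarrow> nat \<Rightarrow> int list \<Rightarrow> 'a mat" where
  "x_diag \<pi> n lam = mat_diag (2 * n + 1) (\<lambda>i.
     if i < n then \<pi> powi (lam ! i)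
     else if i = n then 1
     else \<pi> powi (- (lam ! (2 * n - i))))"

definition x_one :: "'a::field \<Rightarrow> nat \<Rightarrow> 'a mat" where
  "x_one \<pi> n = mat_diag (2 * n + 1) (\<lambda>i.
     if i = 0 then \<pi> else if i = 2 * n then inverse \<pi> else 1)"

end

theory Submission
  imports Defs "HOL-Library.Function_Algebras"
begin

text \<open>
  For \<open>x\<close> in $X_n$ the matrix \<open>x j\<close> is an involution, self-adjoint for the Hermitian form \<open>j\<close>, so
  \<open>K\<close>-orbits in $X_n$ are isometry classes of such involutions \<open>Y\<close> of the unimodular lattice
  $\mathcal{O}^{2n+1}$. If \<open>Y\<close> preserves the lattice, an eigenvector of unit norm splits off; otherwise
  take the least \<open>m\<close> with $\pi^m Y$ integral and split off a hyperbolic plane on which \<open>Y\<close> exchanges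
  the isotropic vectors up to $\pi^{\pm m}$. As units of \<open>k\<close> are norms, eigenvectors of opposite sign
  pair up to hyperbolic planes with $m = 0$, and the characteristic polynomial leaves exactly
  one vector over. The exponents are the elementary divisors of \<open>x\<close>, hence determined by the
  \<open>K\<close>-orbit. Under \<open>G\<close> the diagonal Hermitian form $\langle\pi^{\lambda_1},\ldots,\pi^{\lambda_n}\rangle$ may be
  replaced by an equivalent one, so only the parity of $|\lambda|$ matters; it is the valuation of the
  discriminant of the eigenspace of \<open>Y\<close> for $-1$ up to norms, and therefore an invariant.

  The arithmetic input is that $\mathcal{O}$ is a complete discrete valuation ring with
  finite residue field. Integrality over the $p$-adic integers together with the given
  prime element yields the valuation, and a family of integers that is maximal independent modulo \<open>p\<close>
  yields the finiteness and the completeness.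
\<close>

section \<open>Integral elements over a subring\<close>

text \<open>The extension carries no valuation by hypothesis: its integers are an integral closure,
  and \<open>\<pi>\<close> is given as a prime of the smaller field \<open>k\<close> only. Being
  unramified makes it a prime of the extension as well; so the extension has a prime fixed by
  \<open>\<sigma>\<close>, norms have even valuation, and the parity of the exponents can survive.
  Oddness of \<open>p\<close> enters through \<open>inverse 2\<close> alone: in polarization, in
  splitting a vector into eigenvectors, and in square roots of units congruent to 1. The obstacle
  for the lattice is that the projections of a vector to the eigenspaces of \<open>Y\<close> need
  not be integral, so the lattice is no sum of eigenlattices. The denominator of \<open>Y\<close>
  measures this failure, and it reappears as an exponent in the diagonal matrix. Splitting off
  vectors and planes one after the other may leave eigenvectors of both signs unpaired; hence a
  basis is chosen to be extremal in two respects, its length and the number of unpaired vectors.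
  After the arithmetic, the field is seen only through the locale
  \<open>unramified_quadratic\<close>.\<close>

locale ring_set =
  fixes R :: "'a::comm_ring_1 set"
  assumes zero_mem [simp, intro]: "0 \<in> R" and one_mem [simp, intro]: "1 \<in> R"
    and add_mem [intro]: "x \<in> R \<Longrightarrow> y \<in> R \<Longrightarrow> x + y \<in> R"
    and uminus_mem [intro]: "x \<in> R \<Longrightarrow> - x \<in> R"
    and mult_mem [intro]: "x \<in> R \<Longrightarrow> y \<in> R \<Longrightarrow> x * y \<in> R"
begin

lemma diff_mem [intro]: "x \<in> R \<Longrightarrow> y \<in> R \<Longrightarrow> x - y \<in> R"
  using add_mem[of x "-y"] uminus_mem[of y] by simp

lemma sum_mem [intro]: "(\<And>i. i \<in> A \<Longrightarrow> f i \<in> R) \<Longrightarrow> sum f A \<in> R"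
  by (induction A rule: infinite_finite_induct) auto

lemma prod_mem [intro]: "(\<And>i. i \<in> A \<Longrightarrow> f i \<in> R) \<Longrightarrow> prod f A \<in> R"
  by (induction A rule: infinite_finite_induct) auto

lemma power_mem [intro]: "x \<in> R \<Longrightarrow> x ^ n \<in> R"
  by (induction n) auto

lemma of_nat_mem [simp, intro]: "of_nat n \<in> R"
  by (induction n) auto

lemma of_int_mem [simp, intro]: "of_int z \<in> R"
  by (cases z) auto

lemma numeral_mem [simp, intro]: "numeral z \<in> R"
  using of_nat_mem[of "numeral z"] by simp

lemma det_mem:
  assumes "A \<in> carrier_mat n n" "\<And>i j. i < n \<Longrightarrow> j < n \<Longrightarrow> A $$ (i,j) \<in> R"
  shows "det A \<in> R"
  unfolding det_def'[OF assms(1)]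
  using assms(2) by (intro sum_mem mult_mem prod_mem) (auto simp: permutes_in_image sign_def)

text \<open>Lets \<open>det_mem\<close> work over the polynomial ring, so that the coefficients of a
  characteristic polynomial stay in \<open>R\<close>.\<close>

lemma ring_set_poly: "ring_set {f. \<forall>i. coeff f i \<in> R}"
  by unfold_locales (auto simp: coeff_mult coeff_1)

lemma coeff_char_poly_mem:
  assumes "A \<in> carrier_mat n n" "\<And>i j. i < n \<Longrightarrow> j < n \<Longrightarrow> A $$ (i,j) \<in> R"
  shows "coeff (char_poly A) i \<in> R"
proof -
  interpret P: ring_set "{f. \<forall>i. coeff f i \<in> R}" by (rule ring_set_poly)
  have "det (char_poly_matrix A) \<in> {f. \<forall>i. coeff f i \<in> R}"
    by (rule P.det_mem[of _ n])
      (use assms in \<open>auto simp: char_poly_matrix_def coeff_pCons coeff_1 split: nat.splits\<close>)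
  then show ?thesis by (simp add: char_poly_def)
qed

end

text \<open>The condition inside \<open>ring_of_integers\<close>, separated from the field that it
  is intersected with.\<close>

definition integral_over :: "'a::field set \<Rightarrow> 'a \<Rightarrow> bool" where
  "integral_over R x \<longleftrightarrow> (\<exists>f. lead_coeff f = 1 \<and> (\<forall>i. coeff f i \<in> R) \<and> poly f x = 0)"

locale field_ring_set = ring_set R for R :: "'a::field set"
begin

text \<open>The determinant trick: \<open>z\<close> acts on the finitely generated module spanned by
  \<open>W\<close> through a matrix over \<open>R\<close>, and the elements of \<open>W\<close>
  themselves form an eigenvector for \<open>z\<close>. So \<open>z\<close> is a root of the
  characteristic polynomial, which is monic over \<open>R\<close>. The nonzero \<open>w0\<close>
  keeps the eigenvector from vanishing.\<close>

lemma integral_overI_module: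
  assumes W: "finite W" "w0 \<in> W" "w0 \<noteq> 0"
    and st: "\<And>w. w \<in> W \<Longrightarrow> \<exists>c. (\<forall>v\<in>W. c v \<in> R) \<and> z * w = (\<Sum>v\<in>W. c v * v)"
  shows "integral_over R z"
proof -
  define n where "n = card W"
  obtain f where f: "bij_betw f {0..<n} W"
    using ex_bij_betw_nat_finite[OF W(1)] n_def by blast
  obtain C where C: "\<And>w v. w \<in> W \<Longrightarrow> v \<in> W \<Longrightarrow> C w v \<in> R"
    "\<And>w. w \<in> W \<Longrightarrow> z * w = (\<Sum>v\<in>W. C w v * v)"
    using st by metis
  define A where "A = mat n n (\<lambda>(i,j). C (f i) (f j))"
  have A: "A \<in> carrier_mat n n" by (simp add: A_def)
  have fW: "f i \<in> W" if "i < n" for i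
    using f that by (auto simp: bij_betw_def)
  obtain i0 where i0: "i0 < n" "f i0 = w0"
    using f W(2) by (auto simp: bij_betw_def image_iff)
  define v where "v = vec n f"
  have "v \<noteq> 0\<^sub>v n"
    using i0 W(3) by (auto simp: v_def vec_eq_iff)
  moreover have "A *\<^sub>v v = z \<cdot>\<^sub>v v"
  proof (rule eq_vecI)
    fix i assume "i < dim_vec (z \<cdot>\<^sub>v v)"
    then have i: "i < n" by (simp add: v_def)
    have "(A *\<^sub>v v) $ i = (\<Sum>j = 0..<n. C (f i) (f j) * f j)"
      using i by (simp add: A_def v_def scalar_prod_def)
    also have "\<dots> = (\<Sum>w\<in>W. C (f i) w * w)"
      using sum.reindex_bij_betw[OF f, of "\<lambda>w. C (f i) w * w"] by simp
    also have "\<dots> = (z \<cdot>\<^sub>v v) $ i"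
      using C(2)[OF fW[OF i]] i by (simp add: v_def)
    finally show "(A *\<^sub>v v) $ i = (z \<cdot>\<^sub>v v) $ i" .
  qed (simp add: A_def v_def)
  ultimately have "eigenvector A v z"
    using A by (auto simp: eigenvector_def v_def)
  then have "poly (char_poly A) z = 0"
    using eigenvalue_root_char_poly[OF A] by (auto simp: eigenvalue_def)
  moreover have "coeff (char_poly A) i \<in> R" for i
    by (rule coeff_char_poly_mem[OF A]) (auto simp: A_def intro!: C fW)
  ultimately show ?thesis
    using degree_monic_char_poly[OF A] unfolding integral_over_def by auto
qed

section \<open>Finite spans and the ring of integral elements\<close>

definition lin_span :: "'a set \<Rightarrow> 'a set" where
  "lin_span W = {\<Sum>w\<in>W. c w * w | c. \<forall>w\<in>W. c w \<in> R}"

lemma lin_span_base: "finite W \<Longrightarrow> w \<in> W \<Longrightarrow> w \<in> lin_span W"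
  unfolding lin_span_def
  by (rule CollectI, rule exI[of _ "\<lambda>v. if v = w then 1 else 0"]) (auto simp: if_distrib[of "\<lambda>x. x * _"] cong: if_cong)

lemma lin_span_add: "x \<in> lin_span W \<Longrightarrow> y \<in> lin_span W \<Longrightarrow> x + y \<in> lin_span W"
proof -
  assume "x \<in> lin_span W" "y \<in> lin_span W"
  then obtain c d where "\<forall>w\<in>W. c w \<in> R" "x = (\<Sum>w\<in>W. c w * w)" "\<forall>w\<in>W. d w \<in> R" "y = (\<Sum>w\<in>W. d w * w)"
    unfolding lin_span_def by blast
  then show ?thesis unfolding lin_span_def
    by (intro CollectI exI[of _ "\<lambda>w. c w + d w"]) (auto simp: sum.distrib algebra_simps)
qed

lemma lin_span_scale: "a \<in> R \<Longrightarrow> x \<in> lin_span W \<Longrightarrow> a * x \<in> lin_span W"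
proof -
  assume a: "a \<in> R" "x \<in> lin_span W"
  then obtain c where "\<forall>w\<in>W. c w \<in> R" "x = (\<Sum>w\<in>W. c w * w)"
    unfolding lin_span_def by blast
  then show ?thesis using a unfolding lin_span_def
    by (intro CollectI exI[of _ "\<lambda>w. a * c w"]) (auto simp: sum_distrib_left algebra_simps)
qed

lemma lin_span_sum: "(\<And>i. i \<in> A \<Longrightarrow> f i \<in> lin_span W) \<Longrightarrow> sum f A \<in> lin_span W"
proof (induction A rule: infinite_finite_induct)
  case (insert x F)
  then show ?case by (simp add: lin_span_add)
qed (auto simp: lin_span_def intro!: exI[of _ "\<lambda>_. 0"])

lemma lin_span_mult:
  assumes "\<And>w. w \<in> W \<Longrightarrow> x * w \<in> lin_span W" "y \<in> lin_span W"
  shows "x * y \<in> lin_span W"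
proof -
  obtain c where c: "\<forall>w\<in>W. c w \<in> R" "y = (\<Sum>w\<in>W. c w * w)"
    using assms(2) unfolding lin_span_def by blast
  have "x * y = (\<Sum>w\<in>W. c w * (x * w))"
    by (simp add: c sum_distrib_left algebra_simps)
  moreover have "(\<Sum>w\<in>W. c w * (x * w)) \<in> lin_span W"
    using c assms(1) by (intro lin_span_sum lin_span_scale[OF _ assms(1)]) auto
  ultimately show ?thesis by simp
qed

text \<open>The monomials \<open>x ^ i * y ^ j\<close> with exponents below the degrees of the two
  monic equations span a module that is stable under \<open>x\<close> and \<open>y\<close>, hence
  under their sum and product; \<open>integral_overI_module\<close> applies to it.\<close>

lemma integral_over_add_mult:
  assumes "integral_over R x" "integral_over R y"
  shows "integral_over R (x + y)" "integral_over R (x * y)"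
proof -
  \<comment> \<open>The degree is positive because a monic constant has no root; that puts 1 among
    the monomials.\<close>
  have key: "\<exists>d>0. \<exists>c. (\<forall>i<d. c i \<in> R) \<and> x ^ d = (\<Sum>i<d. c i * x ^ i)" if int: "integral_over R x" for x
  proof -
    obtain f where f: "lead_coeff f = 1" "\<forall>i. coeff f i \<in> R" "poly f x = 0"
      using int unfolding integral_over_def by blast
    have "degree f \<noteq> 0"
      using f by (metis degree_eq_zeroE lead_coeff_pCons(2) mult_zero_left add.right_neutral mult.commute poly_pCons poly_0 zero_neq_one)
    moreover have "x ^ degree f = (\<Sum>i<degree f. - coeff f i * x ^ i)"
      using f(1,3) unfolding poly_altdef lessThan_Suc_atMost[symmetric]
      by (simp add: sum_negf eq_neg_iff_add_eq_0 add.commute)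
    ultimately show ?thesis using f(2) by (intro exI[of _ "degree f"]) (auto intro!: exI[of _ "\<lambda>i. - coeff f i"])
  qed
  obtain d c where d: "d > 0" "\<forall>i<d. c i \<in> R" "x ^ d = (\<Sum>i<d. c i * x ^ i)"
    using key[OF assms(1)] by blast
  obtain e b where e: "e > 0" "\<forall>i<e. b i \<in> R" "y ^ e = (\<Sum>i<e. b i * y ^ i)"
    using key[OF assms(2)] by blast
  define W where "W = (\<lambda>(i,j). x ^ i * y ^ j) ` ({..<d} \<times> {..<e})"
  have fin: "finite W" by (simp add: W_def)
  have WI: "x ^ i * y ^ j \<in> W" if "i < d" "j < e" for i j
    using that by (auto simp: W_def)
  have "x ^ 0 * y ^ 0 \<in> W" using d e by (intro WI)
  then have one: "1 \<in> W" by simp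
  have xW: "x * w \<in> lin_span W" if "w \<in> W" for w
  proof -
    obtain i j where ij: "i < d" "j < e" "w = x ^ i * y ^ j"
      using \<open>w \<in> W\<close> by (auto simp: W_def)
    show ?thesis
    proof (cases "Suc i < d")
      case True
      then have "x ^ Suc i * y ^ j \<in> lin_span W" using ij by (intro lin_span_base fin WI)
      then show ?thesis by (simp add: ij algebra_simps)
    next
      case False
      then have "x * w = x ^ d * y ^ j" using ij(1) ij(3)
        by (metis Suc_lessI mult.assoc power_Suc)
      also have "\<dots> = (\<Sum>i<d. c i * (x ^ i * y ^ j))"
        by (simp add: d(3) sum_distrib_right mult.assoc)
      also have "\<dots> \<in> lin_span W" using ij d(2) by (auto intro!: lin_span_sum lin_span_scale lin_span_base[OF fin WI])
      finally show ?thesis .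
    qed
  qed
  have yW: "y * w \<in> lin_span W" if "w \<in> W" for w
  proof -
    obtain i j where ij: "i < d" "j < e" "w = x ^ i * y ^ j"
      using \<open>w \<in> W\<close> by (auto simp: W_def)
    show ?thesis
    proof (cases "Suc j < e")
      case True
      then have "x ^ i * y ^ Suc j \<in> lin_span W" using ij by (intro lin_span_base fin WI)
      then show ?thesis by (simp add: ij algebra_simps)
    next
      case False
      then have "e = Suc j" using ij by simp
      then have "y * w = x ^ i * y ^ e" using ij(3) by (simp add: algebra_simps)
      also have "\<dots> = (\<Sum>j<e. b j * (x ^ i * y ^ j))"
        by (simp add: e(3) sum_distrib_left mult.left_commute)
      also have "\<dots> \<in> lin_span W" using ij e(2) by (auto intro!: lin_span_sum lin_span_scale lin_span_base[OF fin WI])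
      finally show ?thesis .
    qed
  qed
  have fin_int: "integral_over R z" if "\<And>w. w \<in> W \<Longrightarrow> z * w \<in> lin_span W" for z
    by (rule integral_overI_module[OF fin one]) (use that in \<open>auto simp: lin_span_def\<close>)
  show "integral_over R (x + y)"
    by (rule fin_int) (simp add: distrib_right lin_span_add xW yW)
  show "integral_over R (x * y)"
    by (rule fin_int) (simp add: mult.assoc lin_span_mult[OF xW] yW)
qed

lemma integral_over_mem: "x \<in> R \<Longrightarrow> integral_over R x"
  unfolding integral_over_def
  by (rule exI[of _ "[:-x, 1:]"]) (auto simp: coeff_pCons split: nat.splits)

lemma ring_set_integral_over: "ring_set {x. integral_over R x}"
proof
  fix x assume "x \<in> {x. integral_over R x}"
  then have "integral_over R (-1 * x)"
    by (intro integral_over_add_mult(2)) (auto intro!: integral_over_mem)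
  then show "- x \<in> {x. integral_over R x}" by simp
qed (auto intro: integral_over_add_mult integral_over_mem)

end

section \<open>The p-adic numbers\<close>

text \<open>Addition and multiplication of \<open>ambient\<close> are those of the type by
  definition; its minus and inverse are defined abstractly and are identified with those of the type
  by uniqueness.\<close>

lemma subfield_ambientD:
  assumes "subfield F (ambient :: 'a::field ring)"
  shows "0 \<in> F" "1 \<in> F" "x \<in> F \<Longrightarrow> y \<in> F \<Longrightarrow> x + y \<in> F" "x \<in> F \<Longrightarrow> y \<in> F \<Longrightarrow> x * y \<in> F"
    "x \<in> F \<Longrightarrow> - x \<in> F" "x \<in> F \<Longrightarrow> inverse x \<in> F"
proof -
  interpret A: ring "ambient :: 'a ring" by (rule ring_from_type_algebra)
  note S = subringE[OF subfieldE(1)[OF assms]]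
  note simps = ring_of_type_algebra_def
  show z: "0 \<in> F" and "1 \<in> F" using S(2,3) by (simp_all add: simps)
  show add: "x + y \<in> F" if "x \<in> F" "y \<in> F" for x y using S(7)[of x y] that by (simp add: simps)
  show "x * y \<in> F" if "x \<in> F" "y \<in> F" using S(6)[of x y] that by (simp add: simps)
  show "- x \<in> F" if "x \<in> F"
  proof -
    have m: "\<ominus>\<^bsub>ambient\<^esub> x \<in> F" using S(5) that by blast
    have "x + \<ominus>\<^bsub>ambient\<^esub> x = 0" using A.r_neg[of x] by (simp add: simps)
    then have "\<ominus>\<^bsub>ambient\<^esub> x = - x" by (metis add_eq_0_iff)
    then show ?thesis using m by simp
  qed
  show "inverse x \<in> F" if "x \<in> F"
  proof (cases "x = 0")
    case False
    then have x: "x \<in> F - {\<zero>\<^bsub>ambient\<^esub>}" using that by (simp add: simps)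
    have "inv\<^bsub>ambient\<^esub> x \<in> F" "x * inv\<^bsub>ambient\<^esub> x = 1"
      using A.subfield_m_inv(1,2)[OF assms x] by (simp_all add: simps)
    then show ?thesis by (metis inverse_unique)
  qed (use z in simp)
qed

locale padic =
  fixes p :: nat and Q :: "'a::field_char_0 set" and N :: "'a \<Rightarrow> real"
  assumes prime: "prime p" and padic: "padic_numbers p Q N"
begin

lemma Q_subfield: "subfield Q ambient"
  using padic by (simp add: padic_numbers_def)

sublocale Q: field_ring_set Q
  by unfold_locales (simp_all add: subfield_ambientD[OF Q_subfield])

lemma Q_inverse [intro]: "x \<in> Q \<Longrightarrow> inverse x \<in> Q"
  by (rule subfield_ambientD(6)[OF Q_subfield])

lemma Q_divide [intro]: "x \<in> Q \<Longrightarrow> y \<in> Q \<Longrightarrow> x / y \<in> Q"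
  by (simp add: divide_inverse Q_inverse Q.mult_mem)

lemma N_nonneg [simp]: "x \<in> Q \<Longrightarrow> 0 \<le> N x"
  and N_eq_0_iff [simp]: "x \<in> Q \<Longrightarrow> N x = 0 \<longleftrightarrow> x = 0"
  and N_mult [simp]: "x \<in> Q \<Longrightarrow> y \<in> Q \<Longrightarrow> N (x * y) = N x * N y"
  and N_triangle: "x \<in> Q \<Longrightarrow> y \<in> Q \<Longrightarrow> N (x + y) \<le> N x + N y"
  using padic by (auto simp: padic_numbers_def absolute_value_on_def)

lemma N_of_rat: "N (of_rat q) = padic_abs p q"
  using padic by (simp add: padic_numbers_def)

lemma p_gt_1: "p > 1" using prime by (rule prime_gt_1_nat)

lemma N_one [simp]: "N 1 = 1"
  using N_mult[of 1 1] N_eq_0_iff[of 1] by (auto simp del: N_mult)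

lemma N_zero [simp]: "N 0 = 0" by simp

lemma N_uminus [simp]: "x \<in> Q \<Longrightarrow> N (- x) = N x"
proof -
  assume x: "x \<in> Q"
  have "N (-1) * N (-1) = 1" using N_mult[of "-1" "-1"] by (simp del: N_mult add: Q.uminus_mem)
  then have "N (-1) = 1"
    using N_nonneg[of "-1"] by (metis Q.one_mem Q.uminus_mem mult_cancel_right1 power2_eq_1_iff power2_eq_square neg_0_le_iff_le not_one_le_zero)
  then show ?thesis using N_mult[of "-1" x] x by (simp del: N_mult add: Q.uminus_mem)
qed

lemma N_power [simp]: "x \<in> Q \<Longrightarrow> N (x ^ n) = N x ^ n"
  by (induction n) (auto simp: Q.power_mem)

lemma N_inverse [simp]: "x \<in> Q \<Longrightarrow> N (inverse x) = inverse (N x)"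
proof (cases "x = 0")
  case False
  assume x: "x \<in> Q"
  then have "N x * N (inverse x) = 1" using False N_mult[of x "inverse x"] by (simp del: N_mult add: Q_inverse)
  then show ?thesis by (metis inverse_unique)
qed simp

lemma N_divide [simp]: "x \<in> Q \<Longrightarrow> y \<in> Q \<Longrightarrow> N (x / y) = N x / N y"
  by (simp add: divide_inverse Q_inverse)

lemma N_minus_commute: "x \<in> Q \<Longrightarrow> y \<in> Q \<Longrightarrow> N (x - y) = N (y - x)"
  using N_uminus[of "x - y"] by (simp add: Q.diff_mem)

lemma N_of_int: "N (of_int a) = (if a = 0 then 0 else inverse (real p ^ multiplicity (int p) a))"
proof -
  have "N (of_int a) = padic_abs p (of_int a)" using N_of_rat[of "of_int a"] by simp
  then show ?thesis using p_gt_1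
    by (simp add: padic_abs_def quotient_of_int power_int_minus)
qed

lemma N_of_int_le_1: "N (of_int a) \<le> 1"
  using p_gt_1 by (simp add: N_of_int inverse_le_1_iff)

lemma N_of_nat_le_1: "N (of_nat a) \<le> 1"
  using N_of_int_le_1[of "int a"] by simp

lemma N_p: "N (of_nat p) = 1 / real p"
  using N_of_int[of "int p"] prime by (simp add: divide_simps)

lemma N_of_int_lt_1_iff: "N (of_int a) < 1 \<longleftrightarrow> int p dvd a"
proof (cases "a = 0")
  case False
  have "\<not> int p dvd a \<longleftrightarrow> multiplicity (int p) a = 0"
    using multiplicity_eq_zero_iff[of a "int p"] False p_gt_1 by simp
  then show ?thesis using False p_gt_1
    by (auto simp: N_of_int inverse_less_1_iff one_less_power)
qed simp

lemma N_sum_le: "finite A \<Longrightarrow> (\<And>i. i \<in> A \<Longrightarrow> f i \<in> Q) \<Longrightarrow> N (sum f A) \<le> (\<Sum>i\<in>A. N (f i))"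
proof (induction A rule: finite_induct)
  case (insert x F)
  then show ?case using N_triangle[of "f x" "sum f F"] by (simp add: Q.sum_mem)
qed simp

text \<open>Only the triangle inequality is assumed of \<open>N\<close>. Integers have absolute
  value at most 1, so the binomial theorem bounds \<open>N (x + y) ^ n\<close> by
  \<open>n + 1\<close> times the \<open>n\<close>-th power of the maximum; letting \<open>n\<close>
  grow removes the factor.\<close>

lemma N_ultrametric:
  assumes "x \<in> Q" "y \<in> Q"
  shows "N (x + y) \<le> max (N x) (N y)"
proof (rule ccontr)
  define m where "m = max (N x) (N y)"
  assume "\<not> N (x + y) \<le> max (N x) (N y)"
  then have gt: "N (x + y) > m" by (simp add: m_def not_le)
  have m0: "m \<ge> 0" using assms by (simp add: m_def le_max_iff_disj)
  have "m > 0"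
  proof (rule ccontr)
    assume "\<not> m > 0"
    then have "N x = 0" "N y = 0" using assms N_nonneg[of x] N_nonneg[of y] unfolding m_def
      by (auto simp del: N_nonneg N_eq_0_iff)
    then have "x + y = 0" using assms by simp
    then show False using gt m0 by simp
  qed
  \<comment> \<open>If the inequality failed, this ratio would exceed 1 although its powers grow at
    most linearly.\<close>
  define r where "r = N (x + y) / m"
  have r: "r > 1" using gt \<open>m > 0\<close> by (simp add: r_def)
  have bound: "r ^ n \<le> real (Suc n)" for n
  proof -
    have "N (x + y) ^ n = N ((x + y) ^ n)" using assms by (simp add: Q.add_mem)
    also have "\<dots> = N (\<Sum>i\<le>n. of_nat (n choose i) * x ^ i * y ^ (n - i))" by (simp add: binomial_ring)
    also have "\<dots> \<le> (\<Sum>i\<le>n. N (of_nat (n choose i) * x ^ i * y ^ (n - i)))"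
      using assms by (intro N_sum_le) auto
    also have "\<dots> \<le> (\<Sum>i\<le>n. m ^ n)"
    proof (rule sum_mono)
      fix i assume i: "i \<in> {..n}"
      have "N (of_nat (n choose i) * x ^ i * y ^ (n - i)) = N (of_nat (n choose i)) * (N x ^ i * N y ^ (n - i))"
        using assms by (simp add: Q.power_mem Q.mult_mem)
      also have "\<dots> \<le> 1 * (m ^ i * m ^ (n - i))"
        using assms N_of_nat_le_1 m0 by (intro mult_mono power_mono) (auto simp: m_def)
      also have "\<dots> = m ^ n" using i by (simp flip: power_add)
      finally show "N (of_nat (n choose i) * x ^ i * y ^ (n - i)) \<le> m ^ n" .
    qed
    finally have "N (x + y) ^ n \<le> real (Suc n) * m ^ n" by simp
    then show ?thesis using \<open>m > 0\<close> by (simp add: r_def power_divide pos_divide_le_eq)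
  qed
  have "(\<lambda>n. real n / r ^ n) \<longlonglongrightarrow> 0"
    using lim_n_over_pown[of r] r by simp
  then have "eventually (\<lambda>n. real n / r ^ n < 1 / 2) sequentially"
    by (rule order_tendstoD) simp
  then obtain M where M: "\<And>n. n \<ge> M \<Longrightarrow> real n / r ^ n < 1 / 2"
    unfolding eventually_sequentially by blast
  define n where "n = max M 1"
  have "real n / r ^ n < 1 / 2" by (rule M) (simp add: n_def)
  then have "2 * real n < r ^ n" using r by (simp add: divide_simps)
  moreover have "real (Suc n) \<le> 2 * real n" by (simp add: n_def)
  ultimately show False using bound[of n] by linarith
qed

lemma N_add_le: "x \<in> Q \<Longrightarrow> y \<in> Q \<Longrightarrow> N x \<le> e \<Longrightarrow> N y \<le> e \<Longrightarrow> N (x + y) \<le> e"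
  using N_ultrametric[of x y] by linarith

lemma N_add_less: "x \<in> Q \<Longrightarrow> y \<in> Q \<Longrightarrow> N x < e \<Longrightarrow> N y < e \<Longrightarrow> N (x + y) < e"
  using N_ultrametric[of x y] by linarith

lemma N_diff_le: "x \<in> Q \<Longrightarrow> y \<in> Q \<Longrightarrow> N x \<le> e \<Longrightarrow> N y \<le> e \<Longrightarrow> N (x - y) \<le> e"
  using N_add_le[of x "-y" e] by (simp add: Q.uminus_mem)

section \<open>The p-adic integers: residues, convergent series, integral closedness\<close>

abbreviation Z where "Z \<equiv> padic_integers Q N"

lemma Z_iff: "x \<in> Z \<longleftrightarrow> x \<in> Q \<and> N x \<le> 1"
  by (simp add: padic_integers_def)

sublocale Z: field_ring_set Z
proof unfold_locales
  fix x y assume "x \<in> Z" "y \<in> Z"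
  then show "x + y \<in> Z" "x * y \<in> Z" "-x \<in> Z"
    by (auto simp: Z_iff N_add_le Q.uminus_mem mult_le_one)
qed (auto simp: Z_iff)

lemma Q_of_rat [simp, intro]: "of_rat q \<in> Q"
proof (cases q)
  case (Fract a b)
  then show ?thesis by (simp add: of_rat_rat Q_divide)
qed

lemma N_eq_of_close: "x \<in> Q \<Longrightarrow> y \<in> Q \<Longrightarrow> N (x - y) < N x \<Longrightarrow> N y = N x"
  using N_ultrametric[of "x - y" y] N_ultrametric[of "y - x" x] N_minus_commute[of x y]
  by (auto simp: Q.diff_mem)

lemma ex_rat_close: "x \<in> Q \<Longrightarrow> e > 0 \<Longrightarrow> \<exists>q. N (x - of_rat q) < e"
  using padic by (simp add: padic_numbers_def)

text \<open>The absolute value is constant near a nonzero \<open>x\<close>, and there are rationals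
  near \<open>x\<close>; so no values arise beyond those of the rationals.\<close>

lemma N_value: "x \<in> Q \<Longrightarrow> x \<noteq> 0 \<Longrightarrow> \<exists>z. N x = real p powi z"
proof -
  assume x: "x \<in> Q" "x \<noteq> 0"
  then have "N x > 0" using N_nonneg[of x] N_eq_0_iff[of x] by (simp del: N_nonneg N_eq_0_iff)
  then obtain q where "N (x - of_rat q) < N x" using ex_rat_close x by blast
  then have eq: "N x = padic_abs p q" using N_eq_of_close[of x "of_rat q"] x by (simp add: N_of_rat)
  then show ?thesis using \<open>N x > 0\<close> by (auto simp: padic_abs_def split: prod.splits if_splits)
qed

text \<open>The nonzero values are powers of \<open>p\<close>, so one below 1 is at most
  \<open>1 / p\<close>.\<close>

lemma N_less_1_imp: "x \<in> Q \<Longrightarrow> N x < 1 \<Longrightarrow> x / of_nat p \<in> Z"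
proof (cases "x = 0")
  case False
  assume x: "x \<in> Q" "N x < 1"
  then obtain z where z: "N x = real p powi z" using N_value False by blast
  have "z < 0"
  proof (rule ccontr)
    assume "\<not> z < 0"
    then have "real p powi z \<ge> 1" using p_gt_1 by (intro one_le_power_int) auto
    then show False using x z by simp
  qed
  then have "real p powi (z + 1) \<le> 1" using power_int_increasing[of "z + 1" 0 "real p"] p_gt_1 by simp
  then have "N x * real p \<le> 1" using z p_gt_1 by (simp add: power_int_add)
  then show ?thesis using x by (auto simp: Z_iff N_p)
qed (simp)

text \<open>A rational \<open>a / b\<close> in lowest terms at distance less than 1 from
  \<open>x\<close> has \<open>b\<close> prime to \<open>p\<close>, so it is congruent to an integer
  modulo \<open>p\<close>.\<close>

lemma ex_residue:
  assumes "x \<in> Z"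
  shows "\<exists>n<p. (x - of_nat n) / of_nat p \<in> Z"
proof -
  have x: "x \<in> Q" "N x \<le> 1" using assms by (auto simp: Z_iff)
  obtain q where q: "N (x - of_rat q) < 1" using ex_rat_close[OF x(1), of 1] by auto
  obtain a b where ab: "q = Rat.Fract a b" "b > 0" "coprime a b" by (cases q)
  have qe: "of_rat q = (of_int a / of_int b :: 'a)" using ab by (simp add: of_rat_rat)
  have Nq: "N (of_rat q) \<le> 1"
    using N_diff_le[of x "x - of_rat q" 1] x q by (simp add: Q.diff_mem)
  have nb: "\<not> int p dvd b"
  proof
    assume d: "int p dvd b"
    then have "\<not> int p dvd a" using ab(3) p_gt_1
      by (metis coprime_common_divisor_int nat_dvd_1_iff_1 abs_of_nat int_one_le_iff_zero_less less_irrefl nat_int of_nat_1 of_nat_less_iff zdvd1_eq)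
    then have "N (of_int a) = 1" using N_of_int_lt_1_iff[of a] N_of_int_le_1[of a] by linarith
    moreover have "N (of_int b) < 1" using d N_of_int_lt_1_iff by blast
    moreover have "N (of_int b) > 0" using ab(2) N_nonneg[of "of_int b"] N_eq_0_iff[of "of_int b"]
      by (simp del: N_nonneg N_eq_0_iff)
    ultimately show False using Nq by (simp add: qe divide_simps)
  qed
  then have "coprime b (int p)" using prime
    by (metis coprime_commute prime_imp_coprime prime_int_nat_transfer nat_int of_nat_0_le_iff)
  then obtain c w where c: "c * b + w * int p = 1" using bezout_int[of b "int p"] by auto
  \<comment> \<open>\<open>c\<close> inverts \<open>b\<close> modulo \<open>p\<close>, so this is
    the residue of \<open>a / b\<close>.\<close>
  define n where "n = nat ((a * c) mod int p)"
  have n: "n < p" using p_gt_1 by (simp add: n_def nat_less_iff)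
  have nn: "int n = (a * c) mod int p" using p_gt_1 by (simp add: n_def)
  have "a - int n * b = a - (a * c - int p * ((a * c) div int p)) * b"
    by (simp add: nn minus_mult_div_eq_mod)
  also have "\<dots> = a * (1 - c * b) + int p * ((a * c) div int p) * b" by (simp add: algebra_simps)
  also have "1 - c * b = w * int p" using c by simp
  finally have "int p dvd a - int n * b" by (metis dvd_add dvd_mult2 dvd_triv_right dvd_mult dvd_triv_left)
  then have lt: "N (of_int (a - int n * b)) < 1" using N_of_int_lt_1_iff by blast
  have "N (of_int b) = 1" using nb N_of_int_lt_1_iff[of b] N_of_int_le_1[of b] by linarith
  moreover have "of_rat q - of_nat n = (of_int (a - int n * b) / of_int b :: 'a)"
    using ab(2) by (simp add: qe divide_simps)
  ultimately have "N (of_rat q - of_nat n) < 1" using lt by (simp del: of_int_diff of_int_mult)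
  then have "N ((x - of_rat q) + (of_rat q - of_nat n)) < 1"
    using q x by (intro N_add_less) (auto)
  then have "N (x - of_nat n) < 1" by simp
  then show ?thesis using n N_less_1_imp[of "x - of_nat n"] x by auto
qed

text \<open>The remainder after \<open>M\<close> terms is recorded as a multiple of
  \<open>p ^ M\<close> rather than by its size: divisibility is the notion of closeness that the
  integers of the extension will have.\<close>

lemma series_converges:
  assumes c: "\<And>m. c m \<in> Z"
  shows "\<exists>l\<in>Z. \<forall>M. \<exists>y\<in>Z. l - (\<Sum>m<M. c m * of_nat p ^ m) = of_nat p ^ M * y"
proof -
  define s where "s M = (\<Sum>m<M. c m * of_nat p ^ m)" for M
  have cQ: "c m \<in> Q" "N (c m) \<le> 1" for m using c by (auto simp: Z_iff)
  have sQ: "s M \<in> Q" for M using cQ by (auto simp: s_def)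
  have diff: "N (s j - s i) \<le> (1 / real p) ^ i" if "i \<le> j" for i j
    using that
  proof (induction j rule: dec_induct)
    case base
    then show ?case by simp
  next
    case (step j)
    have "N (c j * of_nat p ^ j) \<le> 1 * (1 / real p) ^ j"
      using cQ[of j] by (simp add: Q.power_mem N_p mult_mono del: power_one_over) (metis mult_left_le_one_le power_one_over zero_le_power of_nat_0_le_iff inverse_nonnegative_iff_nonnegative inverse_eq_divide N_nonneg mult_right_le_one_le mult_left_le)
    also have "\<dots> \<le> (1 / real p) ^ i"
      using step p_gt_1 by (simp add: power_decreasing del: power_one_over)
    finally have "N (c j * of_nat p ^ j) \<le> (1 / real p) ^ i" .
    then have "N ((s j - s i) + c j * of_nat p ^ j) \<le> (1 / real p) ^ i"
      using step cQ sQ by (intro N_add_le) auto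
    then show ?case by (simp add: s_def algebra_simps)
  qed
  have lim0: "(\<lambda>i. (1 / real p) ^ i) \<longlonglongrightarrow> 0"
    using p_gt_1 by (intro LIMSEQ_power_zero) simp
  have "\<forall>e>0. \<exists>M. \<forall>i\<ge>M. \<forall>j\<ge>M. N (s i - s j) < e"
  proof (intro allI impI)
    fix e :: real assume "e > 0"
    then obtain M where M: "(1 / real p) ^ M < e"
      using order_tendstoD(2)[OF lim0] by (auto simp: eventually_sequentially)
    have "N (s i - s j) < e" if ij: "i \<ge> M" "j \<ge> M" for i j
    proof -
      have "N ((s i - s M) - (s j - s M)) \<le> (1 / real p) ^ M"
        by (rule N_diff_le) (use sQ ij diff in auto)
      then show ?thesis using M by simp
    qed
    then show "\<exists>M. \<forall>i\<ge>M. \<forall>j\<ge>M. N (s i - s j) < e" by blast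
  qed
  moreover have "range s \<subseteq> Q" using sQ by auto
  ultimately obtain l where l: "l \<in> Q" "(\<lambda>i. N (s i - l)) \<longlonglongrightarrow> 0"
    using padic unfolding padic_numbers_def by blast
  have close: "N (l - s M) \<le> (1 / real p) ^ M" for M
  proof -
    have "(1 / real p) ^ M > 0" using p_gt_1 by simp
    then have "eventually (\<lambda>i. N (s i - l) < (1 / real p) ^ M) sequentially"
      using order_tendstoD(2)[OF l(2)] by blast
    then obtain i where i: "i \<ge> M" "N (s i - l) < (1 / real p) ^ M"
      unfolding eventually_sequentially by (metis nat_le_linear)
    have "N ((s i - s M) - (s i - l)) \<le> (1 / real p) ^ M"
      by (rule N_diff_le) (use i sQ l diff[OF i(1)] in auto)
    then show ?thesis by simp
  qed
  have "\<exists>y\<in>Z. l - s M = of_nat p ^ M * y" for M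
  proof
    show "l - s M = of_nat p ^ M * ((l - s M) / of_nat p ^ M)" using p_gt_1 by simp
    show "(l - s M) / of_nat p ^ M \<in> Z"
      using close[of M] l(1) sQ[of M] p_gt_1
      by (auto simp: Z_iff N_p Q.diff_mem Q.power_mem power_divide divide_simps)
  qed
  moreover have "l \<in> Z" using close[of 0] l(1) by (simp add: Z_iff s_def)
  ultimately show ?thesis unfolding s_def by blast
qed

lemma Z_unit_iff: "x \<in> Z \<Longrightarrow> inverse x \<in> Z \<or> x / of_nat p \<in> Z"
proof -
  assume x: "x \<in> Z"
  show ?thesis
  proof (cases "N x < 1")
    case True then show ?thesis using x N_less_1_imp by (auto simp: Z_iff)
  next
    case False then show ?thesis using x by (auto simp: Z_iff)
  qed
qed

text \<open>If \<open>N x > 1\<close>, the leading term of a monic equation for \<open>x\<close>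
  exceeds all others in absolute value, and they cannot cancel it.\<close>

lemma integral_over_Z_iff: "x \<in> Q \<Longrightarrow> integral_over Z x \<longleftrightarrow> x \<in> Z"
proof
  assume x: "x \<in> Q" and "integral_over Z x"
  then obtain f where f: "lead_coeff f = 1" "\<And>i. coeff f i \<in> Z" "poly f x = 0"
    unfolding integral_over_def by blast
  show "x \<in> Z"
  proof (rule ccontr)
    assume "x \<notin> Z"
    then have gt: "N x > 1" using x by (simp add: Z_iff)
    define d where "d = degree f"
    have "x ^ d + (\<Sum>i<d. coeff f i * x ^ i) = 0"
      using f(1,3) unfolding poly_altdef lessThan_Suc_atMost[symmetric] by (simp add: d_def add.commute)
    then have eq: "x ^ d = - (\<Sum>i<d. coeff f i * x ^ i)" by (simp add: eq_neg_iff_add_eq_0)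
    have bd: "N (\<Sum>i<m. coeff f i * x ^ i) < N x ^ d" if "m \<le> d" for m
      using that
    proof (induction m)
      case 0 then show ?case using gt by simp
    next
      case (Suc m)
      have cf: "coeff f i \<in> Q" "N (coeff f i) \<le> 1" for i using f(2) by (auto simp: Z_iff)
      have "N (coeff f m * x ^ m) \<le> 1 * N x ^ m"
        using cf[of m] x gt by (simp add: Q.power_mem mult_right_mono)
      also have "\<dots> < N x ^ d" using Suc gt by simp
      finally have "N (coeff f m * x ^ m) < N x ^ d" .
      then show ?case using Suc x cf by (auto intro!: N_add_less)
    qed
    have "N (x ^ d) < N x ^ d"
      unfolding eq using bd[of d] f(2) x by (subst N_uminus) (auto simp: Z_iff)
    then show False using x by simp
  qed
qed (rule Z.integral_over_mem)

end

section \<open>Discrete valuation of the ring of integers\<close>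

text \<open>Translates the list recursion behind dimension into an indexed sum.\<close>

lemma combine_ambient:
  "length Ks = length Us \<Longrightarrow>
    ring.combine (ambient :: 'a::field ring) Ks Us = (\<Sum>i<length Us. Ks ! i * Us ! i)"
proof (induction Ks Us rule: list_induct2)
  interpret A: ring "ambient :: 'a ring" by (rule ring_from_type_algebra)
  {
    case Nil
    show ?case unfolding A.combine.simps(2) by (simp add: ring_of_type_algebra_def)
  next
    case (Cons k Ks u Us)
    have "A.combine (k # Ks) (u # Us) = k * u + A.combine Ks Us"
      unfolding A.combine.simps(1) by (simp add: ring_of_type_algebra_def)
    then show ?case using Cons
      by (simp add: sum.lessThan_Suc_shift del: sum.lessThan_Suc A.combine.simps)
  }
qed

lemma sum_lessThan_add: "(\<Sum>l<i + n. f l) = (\<Sum>l<i. f l) + (\<Sum>l<n. f (i + l :: nat))"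
  for f :: "nat \<Rightarrow> 'b::comm_monoid_add"
  by (induction n) (auto simp: add.assoc)

text \<open>Serves two arguments on the monic equation of an integer, in which \<open>i\<close> is
  the first index whose coefficient is not divisible by \<open>p\<close>, or not zero.\<close>

lemma poly_split_at:
  fixes f :: "'b::comm_ring_1 poly"
  assumes i: "i \<le> degree f"
  shows "poly f x = (\<Sum>l<i. coeff f l * x ^ l) +
    x ^ i * (coeff f i + x * (\<Sum>l<degree f - i. coeff f (Suc (i + l)) * x ^ l))"
proof -
  have "poly f x = (\<Sum>l<Suc (degree f). coeff f l * x ^ l)"
    by (simp add: poly_altdef lessThan_Suc_atMost)
  also have "\<dots> = (\<Sum>l<i + Suc (degree f - i). coeff f l * x ^ l)" using i by simp
  also have "\<dots> = (\<Sum>l<i. coeff f l * x ^ l) + (\<Sum>l<Suc (degree f - i). coeff f (i + l) * x ^ (i + l))"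
    by (rule sum_lessThan_add)
  finally show ?thesis
    by (simp add: sum.lessThan_Suc_shift sum_distrib_left power_add algebra_simps del: sum.lessThan_Suc)
qed

locale padic_extension = padic p Q N for p :: nat and Q :: "'a::field_char_0 set" and N +
  fixes \<pi> :: 'a
  assumes finite_dim: "ring.finite_dimension ambient Q (UNIV :: 'a set)"
    and prime_element: "prime_element Q N UNIV \<pi>"
begin

abbreviation \<O> where "\<O> \<equiv> ring_of_integers Q N UNIV"

lemma O_iff: "x \<in> \<O> \<longleftrightarrow> integral_over Z x"
  by (simp add: ring_of_integers_def integral_over_def)

sublocale O: field_ring_set \<O>
proof -
  have "\<O> = {x. integral_over Z x}" by (auto simp: O_iff)
  then show "field_ring_set \<O>" using Z.ring_set_integral_over by (simp add: field_ring_set_def)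
qed

lemma Z_subset_O: "x \<in> Z \<Longrightarrow> x \<in> \<O>"
  by (simp add: O_iff Z.integral_over_mem)

text \<open>Finite dimension in the form used below: a single \<open>D\<close> serves all sequences,
  so that it can bound the length of independent ones. Repeated entries are allowed.\<close>

lemma ex_dependent:
  "\<exists>D. \<forall>z :: nat \<Rightarrow> 'a. \<exists>c. (\<forall>i\<le>D. c i \<in> Q) \<and> (\<exists>i\<le>D. c i \<noteq> 0) \<and> (\<Sum>i\<le>D. c i * z i) = 0"
proof -
  interpret A: ring "ambient :: 'a ring" by (rule ring_from_type_algebra)
  obtain D where D: "A.dimension D Q UNIV"
    using finite_dim unfolding A.finite_dimension_def by blast
  have "\<exists>c. (\<forall>i\<le>D. c i \<in> Q) \<and> (\<exists>i\<le>D. c i \<noteq> 0) \<and> (\<Sum>i\<le>D. c i * z i) = 0" for z :: "nat \<Rightarrow> 'a"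
  proof -
    define Us where "Us = map z [0..<Suc D]"
    have len: "length Us = Suc D" by (simp add: Us_def)
    have "\<not> A.independent Q Us"
      using A.independent_length_le_dimension[OF Q_subfield D, of Us] len by auto
    then obtain Ks where Ks: "length Ks = length Us" "A.combine Ks Us = \<zero>\<^bsub>ambient\<^esub>" "set Ks \<subseteq> Q"
      "set Ks \<noteq> {\<zero>\<^bsub>ambient\<^esub>}"
      using A.dependent_imp_non_trivial_combine[OF Q_subfield, of Us] by (auto simp: ring_of_type_algebra_def)
    have "(\<Sum>i<Suc D. Ks ! i * Us ! i) = 0"
      using Ks(2) combine_ambient[OF Ks(1)] len by (simp add: ring_of_type_algebra_def)
    moreover have "(\<Sum>i<Suc D. Ks ! i * Us ! i) = (\<Sum>i<Suc D. Ks ! i * z i)"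
      by (rule sum.cong) (simp_all add: Us_def del: upt_Suc)
    ultimately have "(\<Sum>i\<le>D. Ks ! i * z i) = 0" by (simp add: lessThan_Suc_atMost)
    moreover have "\<forall>i\<le>D. Ks ! i \<in> Q" using Ks(1,3) len by (auto simp: subset_iff)
    moreover have "\<exists>i\<le>D. Ks ! i \<noteq> 0"
    proof (rule ccontr)
      assume "\<not> ?thesis"
      then have "set Ks \<subseteq> {0}" using Ks(1) len by (auto simp: in_set_conv_nth)
      moreover have "set Ks \<noteq> {}" using Ks(1) len by auto
      ultimately have "set Ks = {0}" using subset_singletonD by metis
      then show False using Ks(4) by (simp add: ring_of_type_algebra_def)
    qed
    ultimately show ?thesis by blast
  qed
  then show ?thesis by blast
qed

section \<open>Units and powers of the prime element\<close>

definition unit :: "'a \<Rightarrow> bool" where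
  "unit x \<longleftrightarrow> x \<in> \<O> \<and> x \<noteq> 0 \<and> inverse x \<in> \<O>"

text \<open>\<open>maximal_ideal_of\<close> is by definition the set of non-units, and a prime
  element generates it.\<close>

lemma nonunit: "x \<in> \<O> \<Longrightarrow> \<not> unit x \<Longrightarrow> \<exists>y\<in>\<O>. x = \<pi> * y"
proof -
  assume x: "x \<in> \<O>" "\<not> unit x"
  have "\<not> (\<exists>y\<in>\<O>. x * y = 1)"
    using x by (metis inverse_unique mult_zero_left unit_def zero_neq_one)
  then have "x \<in> maximal_ideal_of Q N UNIV" using x by (simp add: maximal_ideal_of_def)
  then show ?thesis using prime_element by (auto simp: prime_element_def)
qed

lemma pi_mult_neq_1: "y \<in> \<O> \<Longrightarrow> \<pi> * y \<noteq> 1"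
proof -
  assume y: "y \<in> \<O>"
  have "\<pi> * 1 \<in> maximal_ideal_of Q N UNIV"
    using prime_element unfolding prime_element_def by blast
  then show ?thesis using y by (auto simp: maximal_ideal_of_def)
qed

lemma pi_mem [simp, intro]: "\<pi> \<in> \<O>"
proof -
  have "\<pi> * 1 \<in> maximal_ideal_of Q N UNIV"
    using prime_element unfolding prime_element_def by blast
  then show ?thesis by (auto simp: maximal_ideal_of_def)
qed

lemma not_unit_pi_mult: "y \<in> \<O> \<Longrightarrow> \<not> unit (\<pi> * y)"
proof
  assume y: "y \<in> \<O>" "unit (\<pi> * y)"
  then have "\<pi> * (y * inverse (\<pi> * y)) = 1" by (auto simp: unit_def field_simps)
  then show False using pi_mult_neq_1 y unfolding unit_def by blast
qed

lemma unit_mult: "unit x \<Longrightarrow> unit y \<Longrightarrow> unit (x * y)"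
  by (auto simp: unit_def)

lemma unit_inverse: "unit x \<Longrightarrow> unit (inverse x)"
  by (auto simp: unit_def)

lemma unit_power: "unit x \<Longrightarrow> unit (x ^ n)"
  by (induction n) (auto simp: unit_mult, auto simp: unit_def)

text \<open>An integral element of \<open>Q\<close> lies in \<open>Z\<close>, but
  \<open>1 / p\<close> has absolute value \<open>p\<close>.\<close>

lemma inverse_p_notin: "inverse (of_nat p) \<notin> \<O>"
  using integral_over_Z_iff[of "inverse (of_nat p)"] p_gt_1
  by (auto simp: O_iff Z_iff N_p)

lemma Z_unit: "x \<in> Z \<Longrightarrow> inverse x \<in> Z \<Longrightarrow> x \<noteq> 0 \<Longrightarrow> unit x"
  by (simp add: unit_def Z_subset_O)

lemma p_eq_pi_mult: "\<exists>y\<in>\<O>. of_nat p = \<pi> * y"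
  using nonunit[of "of_nat p"] inverse_p_notin by (simp add: unit_def)

lemma pi_nonzero [simp]: "\<pi> \<noteq> 0"
  using p_eq_pi_mult p_gt_1 by auto

text \<open>In the monic equation of \<open>\<pi>\<close> let \<open>i\<close> be the first index
  whose coefficient is not divisible by \<open>p\<close>, that is, a unit. The lower terms add up to
  a multiple of \<open>p\<close>, the others to \<open>\<pi> ^ i\<close> times a unit. So
  \<open>\<pi> ^ i\<close> times a unit is a multiple of \<open>p\<close>, and
  \<open>\<pi> ^ (i + 1)\<close> cannot divide \<open>p\<close>.\<close>

lemma p_not_infinitely_divisible: "\<exists>e. \<not> (\<exists>y\<in>\<O>. of_nat p = \<pi> ^ e * y)"
proof -
  obtain f where f: "lead_coeff f = 1" "\<And>i. coeff f i \<in> Z" "poly f \<pi> = 0"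
    using pi_mem unfolding O_iff integral_over_def by blast
  define P where "P i \<longleftrightarrow> coeff f i / of_nat p \<notin> Z" for i
  have "1 / of_nat p \<notin> Z" using inverse_p_notin Z_subset_O by (auto simp: divide_inverse)
  then have Pd: "P (degree f)" using f(1) by (simp add: P_def)
  define i where "i = (LEAST i. P i)"
  have Pi: "P i" unfolding i_def by (rule LeastI[of P, OF Pd])
  have id: "i \<le> degree f" unfolding i_def by (rule Least_le[of P, OF Pd])
  have small: "coeff f l / of_nat p \<in> Z" if "l < i" for l
    using not_less_Least[of l P] that by (auto simp: i_def P_def)
  define w' where "w' = (\<Sum>l<degree f - i. coeff f (Suc (i + l)) * \<pi> ^ l)"
  define t where "t = (\<Sum>l<i. coeff f l / of_nat p * \<pi> ^ l)"
  have w': "w' \<in> \<O>" unfolding w'_def using f(2) Z_subset_O by blast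
  have t: "t \<in> \<O>" unfolding t_def using small Z_subset_O by blast
  \<comment> \<open>The part of the equation from index \<open>i\<close> on, divided by
    \<open>\<pi> ^ i\<close>; it is a unit because its first term is.\<close>
  define w where "w = coeff f i + \<pi> * w'"
  have w: "w \<in> \<O>" unfolding w_def using w' f(2) Z_subset_O by blast
  have "inverse (coeff f i) \<in> Z" using Pi Z_unit_iff[OF f(2)[of i]] by (simp add: P_def)
  moreover have "coeff f i \<noteq> 0" using Pi by (auto simp: P_def)
  ultimately have u: "unit (coeff f i)" using Z_unit f(2) by blast
  have uw: "unit w"
  proof (rule ccontr)
    assume "\<not> unit w"
    then obtain y where y: "y \<in> \<O>" "w = \<pi> * y" using nonunit w by blast
    then have "coeff f i = \<pi> * (y - w')" by (simp add: w_def algebra_simps)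
    then show False using u not_unit_pi_mult[of "y - w'"] y w' by auto
  qed
  have "of_nat p * t + \<pi> ^ i * w = 0"
  proof -
    have "of_nat p * t = (\<Sum>l<i. coeff f l * \<pi> ^ l)"
      using p_gt_1 by (simp add: t_def sum_distrib_left)
    then show ?thesis using f(3) poly_split_at[OF id, of \<pi>] by (simp add: w_def w'_def)
  qed
  then have eq: "\<pi> ^ i * w = - of_nat p * t" by (simp add: eq_neg_iff_add_eq_0 add.commute)
  have "\<not> (\<exists>y\<in>\<O>. of_nat p = \<pi> ^ Suc i * y)"
  proof
    assume "\<exists>y\<in>\<O>. of_nat p = \<pi> ^ Suc i * y"
    then obtain y where y: "y \<in> \<O>" "of_nat p = \<pi> ^ Suc i * y" by blast
    then have "\<pi> ^ i * w = \<pi> ^ i * (\<pi> * (- y * t))" unfolding eq by (simp add: algebra_simps)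
    then have "w = \<pi> * (- y * t)" by (metis mult_left_cancel pi_nonzero power_not_zero)
    moreover have "- y * t \<in> \<O>" using y t by blast
    ultimately show False using uw not_unit_pi_mult by blast
  qed
  then show ?thesis by blast
qed

text \<open>Factors \<open>\<pi>\<close> are stripped off until a unit is left; \<open>e\<close>
  bounds the number of times.\<close>

lemma pi_power_unit:
  "y \<in> \<O> \<Longrightarrow> \<not> (\<exists>z\<in>\<O>. y = \<pi> ^ e * z) \<Longrightarrow> \<exists>m u. unit u \<and> y = \<pi> ^ m * u"
proof (induction e arbitrary: y)
  case 0
  then show ?case by simp
next
  case (Suc e)
  show ?case
  proof (cases "unit y")
    case True
    then show ?thesis by (intro exI[of _ 0] exI[of _ y]) simp
  next
    case False
    then obtain y' where y': "y' \<in> \<O>" "y = \<pi> * y'" using nonunit Suc.prems by blast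
    then have "\<not> (\<exists>z\<in>\<O>. y' = \<pi> ^ e * z)" using Suc.prems(2) by (auto simp: mult.assoc)
    then obtain m u where "unit u" "y' = \<pi> ^ m * u" using Suc.IH y' by blast
    then show ?thesis using y' by (intro exI[of _ "Suc m"] exI[of _ u]) simp
  qed
qed

lemma p_eq: "\<exists>e u. unit u \<and> of_nat p = \<pi> ^ e * u"
  using p_not_infinitely_divisible pi_power_unit[of "of_nat p"] by blast

text \<open>The lowest nonzero coefficient of a monic equation of \<open>y\<close> is a multiple of
  \<open>y\<close>, and as an element of \<open>Z\<close> it divides a power of
  \<open>p\<close>.\<close>

lemma dvd_p_power:
  assumes "y \<in> \<O>" "y \<noteq> 0"
  shows "\<exists>s. \<exists>t\<in>\<O>. of_nat p ^ s = y * t"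
proof -
  obtain f where f: "lead_coeff f = 1" "\<And>i. coeff f i \<in> Z" "poly f y = 0"
    using assms(1) unfolding O_iff integral_over_def by blast
  have Pd: "coeff f (degree f) \<noteq> 0" using f(1) by simp
  define i where "i = (LEAST i. coeff f i \<noteq> 0)"
  have ci: "coeff f i \<noteq> 0" unfolding i_def by (rule LeastI[of "\<lambda>i. coeff f i \<noteq> 0", OF Pd])
  have id: "i \<le> degree f" unfolding i_def by (rule Least_le[of "\<lambda>i. coeff f i \<noteq> 0", OF Pd])
  have small: "coeff f l = 0" if "l < i" for l
    using not_less_Least[of l "\<lambda>i. coeff f i \<noteq> 0"] that by (auto simp: i_def)
  define w where "w = (\<Sum>l<degree f - i. coeff f (Suc (i + l)) * y ^ l)"
  have w: "w \<in> \<O>" unfolding w_def using f(2) Z_subset_O assms by blast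
  have "y ^ i * (coeff f i + y * w) = 0"
    using poly_split_at[OF id, of y] f(3) small by (simp add: w_def)
  then have c: "coeff f i = - y * w" using assms(2) by (simp add: eq_neg_iff_add_eq_0)
  have cQ: "coeff f i \<in> Q" "N (coeff f i) \<le> 1" using f(2)[of i] by (auto simp: Z_iff)
  obtain z where z: "N (coeff f i) = real p powi z" using N_value[OF cQ(1) ci] by blast
  have "z \<le> 0"
  proof (rule ccontr)
    assume "\<not> z \<le> 0"
    then have "real p powi z > 1" using p_gt_1 by (intro one_less_power_int) auto
    then show False using z cQ by simp
  qed
  define s where "s = nat (- z)"
  have "N (of_nat p ^ s / coeff f i) \<le> 1"
  proof -
    have "real p powi z = inverse (real p ^ s)"
      using \<open>z \<le> 0\<close> by (simp add: s_def power_int_def power_inverse)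
    then show ?thesis using z cQ p_gt_1 by (simp add: Q.power_mem N_p power_divide)
  qed
  then have "of_nat p ^ s / coeff f i \<in> \<O>"
    using cQ by (intro Z_subset_O) (auto simp: Z_iff)
  then have "- w * (of_nat p ^ s / coeff f i) \<in> \<O>" using w by blast
  moreover have "of_nat p ^ s = y * (- w * (of_nat p ^ s / coeff f i))"
    using c ci by (metis (no_types, lifting) mult.assoc mult_minus_left mult_minus_right nonzero_mult_div_cancel_left times_divide_eq_right)
  ultimately show ?thesis by blast
qed

text \<open>As \<open>y\<close> divides some \<open>p ^ s\<close>, which is
  \<open>\<pi> ^ (e * s)\<close> times a unit, \<open>\<pi>\<close> can be taken out of
  \<open>y\<close> only finitely often.\<close>

lemma O_eq_pi_power: assumes "y \<in> \<O>" "y \<noteq> 0" shows "\<exists>m u. unit u \<and> y = \<pi> ^ m * u"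
proof -
  obtain s t where t: "t \<in> \<O>" "of_nat p ^ s = y * t" using dvd_p_power[OF assms] by blast
  obtain e u where e: "unit u" "of_nat p = \<pi> ^ e * u" using p_eq by blast
  have "\<not> (\<exists>z\<in>\<O>. y = \<pi> ^ Suc (e * s) * z)"
  proof
    assume "\<exists>z\<in>\<O>. y = \<pi> ^ Suc (e * s) * z"
    then obtain z where z: "z \<in> \<O>" "y = \<pi> ^ Suc (e * s) * z" by blast
    have "\<pi> ^ (e * s) * u ^ s = y * t" using t e by (simp add: power_mult_distrib power_mult)
    then have "\<pi> ^ (e * s) * u ^ s = \<pi> ^ (e * s) * (\<pi> * (z * t))" by (simp add: z algebra_simps)
    then have "u ^ s = \<pi> * (z * t)" by simp
    then show False using unit_power[OF e(1)] not_unit_pi_mult[OF O.mult_mem[OF z(1) t(1)]] by metis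
  qed
  then show ?thesis using pi_power_unit assms(1) by blast
qed

text \<open>The powers of \<open>x\<close> are dependent over \<open>Q\<close>; multiplying
  \<open>x\<close> by a high power of \<open>p\<close> clears the denominators of the resulting
  equation.\<close>

lemma ex_p_power_mult_mem: "\<exists>r. of_nat p ^ r * x \<in> \<O>"
proof -
  obtain D c where c: "\<forall>i\<le>D. c i \<in> Q" "\<exists>i\<le>D. c i \<noteq> 0" "(\<Sum>i\<le>D. c i * x ^ i) = 0"
    using ex_dependent by meson
  \<comment> \<open>The highest index that occurs; its coefficient is divided out to make the
    equation monic.\<close>
  define d where "d = Max {i. i \<le> D \<and> c i \<noteq> 0}"
  have fin: "finite {i. i \<le> D \<and> c i \<noteq> 0}" by simp
  have d: "d \<le> D" "c d \<noteq> 0" using Max_in[OF fin] c(2) by (auto simp: d_def)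
  have big: "c i = 0" if "d < i" "i \<le> D" for i
    using Max_ge[OF fin, of i] that unfolding d_def by (metis (mono_tags, lifting) mem_Collect_eq not_le)
  have "(\<Sum>i\<le>d. c i * x ^ i) = (\<Sum>i\<le>D. c i * x ^ i)"
    by (rule sum.mono_neutral_left) (use d big in \<open>auto simp: not_le\<close>)
  then have s0: "(\<Sum>i<d. c i * x ^ i) + c d * x ^ d = 0" using c(3) by (simp add: lessThan_Suc_atMost[symmetric])
  have d0: "d \<noteq> 0" using s0 d(2) by (cases "d = 0") auto
  define b where "b i = - c i / c d" for i
  have b: "b i \<in> Q" if "i \<le> D" for i using that c(1) d(1) by (auto simp: b_def)
  have xd: "x ^ d = (\<Sum>i<d. b i * x ^ i)"
  proof -
    have "c d * x ^ d = - (\<Sum>i<d. c i * x ^ i)" using s0 by (simp add: eq_neg_iff_add_eq_0 add.commute)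
    then have "x ^ d = - (\<Sum>i<d. c i * x ^ i) / c d" using d(2) by (simp add: field_simps)
    then show ?thesis by (simp add: b_def sum_divide_distrib sum_negf divide_simps)
  qed
  define B where "B = (\<Sum>i<d. N (b i))"
  obtain r where r: "B < real p ^ r" using real_arch_pow[of "real p" B] p_gt_1 by auto
  have br: "of_nat p ^ r * b i \<in> Z" if "i < d" for i
  proof -
    have bQ: "b i \<in> Q" using b that d by auto
    have "N (b i) \<le> B" unfolding B_def by (rule member_le_sum) (use that b d in auto)
    then have "N (b i) \<le> real p ^ r" using r by simp
    then show ?thesis using bQ p_gt_1 by (auto simp: Z_iff Q.power_mem N_p power_divide divide_simps)
  qed
  define y where "y = of_nat p ^ r * x"
  \<comment> \<open>In degree \<open>i\<close> the scaled equation acquires the factor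
    \<open>p ^ (r * (d - i))\<close>; one \<open>p ^ r\<close> makes \<open>b i\<close> integral,
    and the remaining factor is integral by itself.\<close>
  have yd: "y ^ d = (\<Sum>i<d. (of_nat p ^ (r * (d - Suc i)) * (of_nat p ^ r * b i)) * y ^ i)"
  proof -
    have "y ^ d = of_nat p ^ (r * d) * (\<Sum>i<d. b i * x ^ i)"
      by (simp add: y_def power_mult_distrib power_mult xd)
    also have "\<dots> = (\<Sum>i<d. (of_nat p ^ (r * (d - Suc i)) * (of_nat p ^ r * b i)) * y ^ i)"
      unfolding sum_distrib_left
    proof (rule sum.cong)
      fix i assume "i \<in> {..<d}"
      then obtain k where "d = Suc (i + k)" using less_imp_Suc_add by auto
      then have "r * d = r * (d - Suc i) + r + r * i" by (simp add: algebra_simps)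
      then show "of_nat p ^ (r * d) * (b i * x ^ i) = (of_nat p ^ (r * (d - Suc i)) * (of_nat p ^ r * b i)) * y ^ i"
        by (simp add: y_def power_add power_mult power_mult_distrib)
    qed simp
    finally show ?thesis .
  qed
  define W where "W = (\<lambda>i. y ^ i) ` {..<d}"
  have W: "finite W" "y ^ 0 \<in> W" unfolding W_def using d0 by (simp, intro imageI, simp)
  have "integral_over Z y"
  proof (rule Z.integral_overI_module[OF W])
    fix w assume "w \<in> W"
    then obtain i where i: "i < d" "w = y ^ i" by (auto simp: W_def)
    have "y * w \<in> Z.lin_span W"
    proof (cases "Suc i < d")
      case True
      then have "y ^ Suc i \<in> W" unfolding W_def by (intro imageI) simp
      then show ?thesis using Z.lin_span_base[OF W(1)] i by simp
    next
      case False
      then have di: "d = Suc i" using i by simp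
      have "y * w = y ^ d" by (simp add: di i)
      moreover have "y ^ d \<in> Z.lin_span W"
        unfolding yd by (intro Z.lin_span_sum Z.lin_span_scale Z.lin_span_base[OF W(1)])
          (use br in \<open>auto simp: W_def\<close>)
      ultimately show ?thesis by simp
    qed
    then show "\<exists>c. (\<forall>v\<in>W. c v \<in> Z) \<and> y * w = (\<Sum>v\<in>W. c v * v)" by (auto simp: Z.lin_span_def)
  qed simp
  then show ?thesis by (auto simp: O_iff y_def)
qed

lemma ex_pi_powi_unit: assumes "x \<noteq> 0" shows "\<exists>m u. unit u \<and> x = \<pi> powi m * u"
proof -
  obtain r where r: "of_nat p ^ r * x \<in> \<O>" using ex_p_power_mult_mem by blast
  obtain e u where e: "unit u" "of_nat p = \<pi> ^ e * u" using p_eq by blast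
  have u0: "u \<noteq> 0" using e by (simp add: unit_def)
  obtain m v where m: "unit v" "of_nat p ^ r * x = \<pi> ^ m * v"
    using O_eq_pi_power[OF r] assms p_gt_1 by auto
  have "x = \<pi> powi (int m - int (e * r)) * (v * inverse (u ^ r))"
  proof -
    have "\<pi> ^ (e * r) * u ^ r * x = \<pi> ^ m * v" using m(2) e(2) by (simp add: power_mult_distrib power_mult)
    then show ?thesis using u0 by (simp add: power_int_diff field_simps del: of_nat_mult)
  qed
  moreover have "unit (v * inverse (u ^ r))"
    by (intro unit_mult unit_inverse unit_power m e)
  ultimately show ?thesis by blast
qed

end

section \<open>Completeness and residues\<close>

context padic_extension
begin

text \<open>A family of integers that is maximal among those independent modulo \<open>p\<close> generates \<open>\<O>\<close>
  modulo \<open>p\<close>; the number of its members is bounded by the degree of the extension.\<close>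

definition indep_mod_p :: "nat \<Rightarrow> (nat \<Rightarrow> 'a) \<Rightarrow> bool" where
  "indep_mod_p r z \<longleftrightarrow> (\<forall>i<r. z i \<in> \<O>) \<and>
     (\<forall>n :: nat \<Rightarrow> nat. (\<forall>i<r. n i < p) \<longrightarrow> (\<exists>y\<in>\<O>. (\<Sum>i<r. of_nat (n i) * z i) = of_nat p * y) \<longrightarrow> (\<forall>i<r. n i = 0))"

text \<open>A dependence over \<open>Q\<close>, divided by its largest coefficient, has coefficients
  in \<open>Z\<close> one of which is 1, so it reduces to a nontrivial dependence modulo
  \<open>p\<close>.\<close>

lemma indep_mod_p_bounded: "\<exists>D. \<forall>r z. indep_mod_p r z \<longrightarrow> r \<le> D"
proof -
  obtain D where D: "\<And>z :: nat \<Rightarrow> 'a. \<exists>c. (\<forall>i\<le>D. c i \<in> Q) \<and> (\<exists>i\<le>D. c i \<noteq> 0) \<and> (\<Sum>i\<le>D. c i * z i) = 0"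
    using ex_dependent by blast
  have "r \<le> D" if ind: "indep_mod_p r z" for r z
  proof (rule ccontr)
    assume r: "\<not> r \<le> D"
    obtain c where c: "\<forall>i\<le>D. c i \<in> Q" "\<exists>i\<le>D. c i \<noteq> 0" "(\<Sum>i\<le>D. c i * z i) = 0" using D by blast
    have "\<exists>i0\<in>{..D}. \<forall>i\<in>{..D}. N (c i) \<le> N (c i0)"
    proof -
      have "Max ((\<lambda>i. N (c i)) ` {..D}) \<in> (\<lambda>i. N (c i)) ` {..D}" by (rule Max_in) auto
      then obtain i0 where "Max ((\<lambda>i. N (c i)) ` {..D}) = N (c i0)" "i0 \<in> {..D}" by (rule imageE)
      then show ?thesis by (metis (no_types, lifting) Max_ge finite_atMost finite_imageI imageI)
    qed
    \<comment> \<open>Dividing by the largest coefficient keeps the others in \<open>Z\<close> and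
      leaves a 1 at \<open>i0\<close>.\<close>
    then obtain i0 where i0: "i0 \<le> D" "\<And>i. i \<le> D \<Longrightarrow> N (c i) \<le> N (c i0)" by auto
    have ci0: "c i0 \<noteq> 0"
    proof
      assume "c i0 = 0"
      then have "N (c i) \<le> 0" if "i \<le> D" for i using i0(2)[OF that] by simp
      then show False using c(1,2) N_nonneg N_eq_0_iff by (meson antisym)
    qed
    define c' where "c' i = c i / c i0" for i
    have c': "c' i \<in> Z" if "i \<le> D" for i
    proof -
      have "N (c i0) > 0" using ci0 c(1) i0(1) N_nonneg[of "c i0"] N_eq_0_iff[of "c i0"] by (auto simp del: N_nonneg N_eq_0_iff)
      then show ?thesis using that c(1) i0 by (auto simp: Z_iff c'_def)
    qed
    have sum0: "(\<Sum>i\<le>D. c' i * z i) = 0"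
    proof -
      have "(\<Sum>i\<le>D. c' i * z i) = (\<Sum>i\<le>D. c i * z i) / c i0" by (simp add: c'_def sum_divide_distrib)
      then show ?thesis using c(3) by simp
    qed
    have "\<forall>i\<in>{..D}. \<exists>n. n < p \<and> (c' i - of_nat n) / of_nat p \<in> Z" using ex_residue[OF c'] by auto
    then obtain n where n: "\<And>i. i \<le> D \<Longrightarrow> n i < p" "\<And>i. i \<le> D \<Longrightarrow> (c' i - of_nat (n i)) / of_nat p \<in> Z"
      by (metis atMost_iff)
    \<comment> \<open>Only the members up to index \<open>D\<close> enter the dependence; the others
      get coefficient 0.\<close>
    define m where "m i = (if i \<le> D then n i else 0)" for i
    define e where "e i = (c' i - of_nat (n i)) / of_nat p" for i
    have zO: "z i \<in> \<O>" if "i < r" for i using ind that by (simp add: indep_mod_p_def)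
    have "(\<Sum>i<r. of_nat (m i) * z i) = (\<Sum>i\<le>D. of_nat (n i) * z i)"
      by (rule sum.mono_neutral_cong_right) (use r in \<open>auto simp: m_def\<close>)
    also have "\<dots> = (\<Sum>i\<le>D. c' i * z i - of_nat p * (e i * z i))"
      by (rule sum.cong) (use p_gt_1 in \<open>auto simp: e_def field_simps\<close>)
    also have "\<dots> = of_nat p * (- (\<Sum>i\<le>D. e i * z i))"
      by (simp add: sum_subtractf sum0 sum_distrib_left)
    finally have "(\<Sum>i<r. of_nat (m i) * z i) = of_nat p * (- (\<Sum>i\<le>D. e i * z i))" .
    moreover have "- (\<Sum>i\<le>D. e i * z i) \<in> \<O>"
      by (intro O.uminus_mem O.sum_mem O.mult_mem zO Z_subset_O) (use n r in \<open>auto simp: e_def\<close>)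
    moreover have "\<forall>i<r. m i < p" using n p_gt_1 by (auto simp: m_def)
    ultimately have "\<forall>i<r. m i = 0" using ind unfolding indep_mod_p_def by blast
    moreover have "i0 < r" using i0 r by simp
    ultimately have "m i0 = 0" by blast
    then have "n i0 = 0" using i0(1) by (simp add: m_def)
    then have "1 / of_nat p \<in> Z" using n(2)[OF i0(1)] ci0 by (simp add: c'_def)
    then show False using inverse_p_notin Z_subset_O by (auto simp: divide_inverse)
  qed
  then show ?thesis by blast
qed

text \<open>Adding \<open>y\<close> to an independent family of maximal length gives a dependence
  modulo \<open>p\<close>. The coefficient of \<open>y\<close> in it lies strictly between 0 and
  \<open>p\<close>, so it can be inverted modulo \<open>p\<close> to solve for
  \<open>y\<close>.\<close>

lemma ex_generators_mod_p:
  "\<exists>r z. (\<forall>i<r. z i \<in> \<O>) \<and>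
    (\<forall>y\<in>\<O>. \<exists>n :: nat \<Rightarrow> nat. (\<forall>i<r. n i < p) \<and> (\<exists>w\<in>\<O>. y = (\<Sum>i<r. of_nat (n i) * z i) + of_nat p * w))"
proof -
  obtain D where D: "\<And>r z. indep_mod_p r z \<Longrightarrow> r \<le> D" using indep_mod_p_bounded by blast
  have "\<exists>z. indep_mod_p 0 z" by (auto simp: indep_mod_p_def)
  moreover have "\<forall>r. (\<exists>z. indep_mod_p r z) \<longrightarrow> r \<le> D" using D by blast
  ultimately have "\<exists>r. (\<exists>z. indep_mod_p r z) \<and> (\<forall>r'. (\<exists>z. indep_mod_p r' z) \<longrightarrow> r' \<le> r)"
    by (intro ex_has_greatest_nat[of "\<lambda>r. \<exists>z. indep_mod_p r z" 0 "\<lambda>r. r" "Suc D", simplified]) (auto simp: less_Suc_eq_le)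
  then obtain r z where rz: "indep_mod_p r z" "\<And>r' z'. indep_mod_p r' z' \<Longrightarrow> r' \<le> r" by blast
  have zO: "z i \<in> \<O>" if "i < r" for i using rz(1) that by (simp add: indep_mod_p_def)
  have "\<exists>n :: nat \<Rightarrow> nat. (\<forall>i<r. n i < p) \<and> (\<exists>w\<in>\<O>. y = (\<Sum>i<r. of_nat (n i) * z i) + of_nat p * w)" if y: "y \<in> \<O>" for y
  proof -
    define z' where "z' = z(r := y)"
    have "\<not> indep_mod_p (Suc r) z'" using rz(2)[of "Suc r" z'] by auto
    moreover have "\<forall>i<Suc r. z' i \<in> \<O>" using y zO by (auto simp: z'_def less_Suc_eq)
    ultimately obtain n w where n: "\<forall>i<Suc r. n i < p" "w \<in> \<O>"
      "(\<Sum>i<Suc r. of_nat (n i) * z' i) = of_nat p * w" "\<not> (\<forall>i<Suc r. n i = 0)"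
      unfolding indep_mod_p_def by blast
    have s: "(\<Sum>i<r. of_nat (n i) * z i) + of_nat (n r) * y = of_nat p * w"
      using n(3) by (simp add: z'_def)
    have "n r \<noteq> 0"
    proof
      assume "n r = 0"
      then have "(\<Sum>i<r. of_nat (n i) * z i) = of_nat p * w" using s by simp
      moreover have "\<forall>i<r. n i < p" using n(1) by simp
      ultimately have "\<forall>i<r. n i = 0" using rz(1) n(2) unfolding indep_mod_p_def by blast
      then show False using n(4) \<open>n r = 0\<close> by (auto simp: less_Suc_eq)
    qed
    then have "coprime (int (n r)) (int p)"
    proof -
      have "\<not> p dvd n r" using n(1) \<open>n r \<noteq> 0\<close> by (meson dvd_imp_le lessI neq0_conv not_le)
      then have "coprime p (n r)" using prime by (simp add: prime_imp_coprime)
      then show ?thesis by (simp add: coprime_commute)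
    qed
    then obtain c v where cv: "c * int (n r) + v * int p = 1" using bezout_int[of "int (n r)" "int p"] by auto
    have cv': "of_int c * of_nat (n r) + of_int v * of_nat p = (1 :: 'a)"
      using arg_cong[OF cv, of "of_int :: int \<Rightarrow> 'a"] by simp
    have "y = (of_int c * of_nat (n r) + of_int v * of_nat p) * y" by (simp add: cv')
    also have "\<dots> = of_int c * (of_nat (n r) * y) + of_nat p * (of_int v * y)" by (simp add: algebra_simps)
    also have "of_nat (n r) * y = of_nat p * w - (\<Sum>i<r. of_nat (n i) * z i)" using s by (simp add: algebra_simps)
    finally have y1: "y = of_nat p * (of_int c * w + of_int v * y) + (\<Sum>i<r. - of_int c * of_nat (n i) * z i)"
      by (simp add: algebra_simps sum_distrib_left sum_negf)
    \<comment> \<open>Solving for \<open>y\<close> produces arbitrary integers as coefficients; they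
      are reduced to digits below \<open>p\<close>, and the differences join the multiple of
      \<open>p\<close>.\<close>
    have "\<forall>i. \<exists>k<p. (- of_int c * of_nat (n i) - of_nat k) / of_nat p \<in> Z"
      by (intro allI ex_residue) auto
    then obtain k where k: "\<And>i. k i < p" "\<And>i. (- of_int c * of_nat (n i) - of_nat (k i)) / of_nat p \<in> Z" by metis
    define e :: "nat \<Rightarrow> 'a" where "e i = (- of_int c * of_nat (n i) - of_nat (k i)) / of_nat p" for i
    have eO: "e i \<in> \<O>" for i unfolding e_def by (rule Z_subset_O[OF k(2)])
    have p0: "of_nat p \<noteq> (0 :: 'a)" using p_gt_1 by simp
    have e: "- of_int c * of_nat (n i) = of_nat (k i) + of_nat p * e i" for i
      unfolding e_def times_divide_eq_right nonzero_mult_div_cancel_left[OF p0] by simp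
    have "y = (\<Sum>i<r. of_nat (k i) * z i) + of_nat p * (of_int c * w + of_int v * y + (\<Sum>i<r. e i * z i))"
      by (subst y1) (simp add: e distrib_right distrib_left sum.distrib sum_distrib_left mult.assoc del: mult_minus_left)
    moreover have "of_int c * w + of_int v * y + (\<Sum>i<r. e i * z i) \<in> \<O>"
      using n(2) y eO zO by (intro O.add_mem O.mult_mem O.sum_mem) auto
    ultimately show ?thesis using k(1) by blast
  qed
  then show ?thesis using zO by blast
qed

text \<open>A nonzero integer divides a power of \<open>p\<close>; were it divisible by every power
  as well, \<open>1 / p\<close> would be integral. This takes the place of uniqueness of
  limits.\<close>

lemma eq_0_if_divisible:
  assumes "\<And>M. \<exists>w\<in>\<O>. x = of_nat p ^ M * w"
  shows "x = 0"
proof (rule ccontr)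
  assume "x \<noteq> 0"
  moreover have xO: "x \<in> \<O>" using assms[of 0] by auto
  ultimately obtain s t where t: "t \<in> \<O>" "of_nat p ^ s = x * t" using dvd_p_power by blast
  obtain w where w: "w \<in> \<O>" "x = of_nat p ^ Suc s * w" using assms by blast
  have "of_nat p ^ s * 1 = of_nat p ^ s * (of_nat p * (w * t))" using t(2) w(2) by (simp add: algebra_simps)
  then have "1 = of_nat p * (w * t)" using p_gt_1 by simp
  then have "inverse (of_nat p) = w * t" by (metis inverse_unique)
  then show False using inverse_p_notin w t O.mult_mem by metis
qed

lemma eq_0_if_pi_divisible:
  assumes "\<And>M. \<exists>w\<in>\<O>. x = \<pi> ^ M * w"
  shows "x = 0"
proof (rule eq_0_if_divisible)
  fix M
  obtain e u where e: "unit u" "of_nat p = \<pi> ^ e * u" using p_eq by blast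
  obtain w where w: "w \<in> \<O>" "x = \<pi> ^ (e * M) * w" using assms by blast
  have "of_nat p ^ M = \<pi> ^ (e * M) * u ^ M" using e by (simp add: power_mult_distrib power_mult)
  then have "x = of_nat p ^ M * (inverse u ^ M * w)"
    using e(1) w(2) by (simp add: unit_def power_inverse)
  moreover have "inverse u ^ M * w \<in> \<O>" using e w by (auto simp: unit_def)
  ultimately show "\<exists>w\<in>\<O>. x = of_nat p ^ M * w" by blast
qed

text \<open>Limits and remainders are chosen as functions, since they will occur inside
  sums.\<close>

lemma series_family_converges:
  assumes "\<And>i m. c i m \<in> Z"
  obtains l e where "\<And>i. l i \<in> Z" "\<And>i M. e i M \<in> Z"
    "\<And>i M. l i - (\<Sum>m<M. c i m * of_nat p ^ m) = of_nat p ^ M * e i M"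
proof -
  define S where "S i M = (\<Sum>m<M. c i m * of_nat p ^ m)" for i M
  have "\<forall>i. \<exists>l. l \<in> Z \<and> (\<forall>M. \<exists>y. y \<in> Z \<and> l - S i M = of_nat p ^ M * y)"
  proof
    fix i
    show "\<exists>l. l \<in> Z \<and> (\<forall>M. \<exists>y. y \<in> Z \<and> l - S i M = of_nat p ^ M * y)"
      using series_converges[of "c i", OF assms] unfolding S_def Bex_def .
  qed
  from choice[OF this]
  obtain l where l: "\<forall>i. l i \<in> Z \<and> (\<forall>M. \<exists>y. y \<in> Z \<and> l i - S i M = of_nat p ^ M * y)"
    by (elim exE)
  define e where "e i M = (SOME y. y \<in> Z \<and> l i - S i M = of_nat p ^ M * y)" for i M
  have "e i M \<in> Z \<and> l i - S i M = of_nat p ^ M * e i M" for i M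
    unfolding e_def by (rule someI_ex) (use l in blast)
  then show ?thesis using that[of l e] l unfolding S_def by blast
qed

text \<open>Dividing with remainder modulo \<open>p\<close> again and again writes \<open>y\<close>
  as a \<open>p\<close>-adic series whose digits are combinations of the \<open>z i\<close>.
  Collecting the digits at each \<open>z i\<close> gives a series over \<open>Z\<close>, which
  converges because \<open>Q\<close> is complete.\<close>

lemma ex_generators:
  "\<exists>(r :: nat) z. (\<forall>i<r. z i \<in> \<O>) \<and> (\<forall>y\<in>\<O>. \<exists>c. (\<forall>i<r. c i \<in> Z) \<and> y = (\<Sum>i<r. c i * z i))"
proof -
  obtain r z where z: "\<And>i. i < r \<Longrightarrow> z i \<in> \<O>" and gen: "\<And>y. y \<in> \<O> \<Longrightarrow>
    \<exists>n :: nat \<Rightarrow> nat. (\<forall>i<r. n i < p) \<and> (\<exists>w\<in>\<O>. y = (\<Sum>i<r. of_nat (n i) * z i) + of_nat p * w)"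
    using ex_generators_mod_p by blast
  have "\<exists>n w. w \<in> \<O> \<and> (y \<in> \<O> \<longrightarrow> y = (\<Sum>i<r. of_nat (n i :: nat) * z i) + of_nat p * w)" for y
    using gen[of y] O.zero_mem by (cases "y \<in> \<O>") blast+
  then obtain n w where nw: "\<And>y. w y \<in> \<O>"
    "\<And>y. y \<in> \<O> \<Longrightarrow> y = (\<Sum>i<r. of_nat (n y i :: nat) * z i) + of_nat p * w y" by metis
  have "\<exists>c. (\<forall>i<r. c i \<in> Z) \<and> y = (\<Sum>i<r. c i * z i)" if y: "y \<in> \<O>" for y
  proof -
    \<comment> \<open>\<open>Y m\<close> is the quotient left after \<open>m\<close> digits.\<close>
    define Y where "Y m = (w ^^ m) y" for m
    have YO: "Y m \<in> \<O>" for m using y nw(1) by (cases m) (auto simp: Y_def)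
    have Y0: "Y 0 = y" and YS: "Y (Suc m) = w (Y m)" for m by (simp_all add: Y_def)
    have expand: "y = (\<Sum>i<r. (\<Sum>m<M. of_nat (n (Y m) i) * of_nat p ^ m) * z i) + of_nat p ^ M * Y M" for M
    proof (induction M)
      case (Suc M)
      have "of_nat p ^ M * Y M = (\<Sum>i<r. of_nat (n (Y M) i) * of_nat p ^ M * z i) + of_nat p ^ Suc M * Y (Suc M)"
        by (subst nw(2)[OF YO[of M]]) (simp add: YS algebra_simps sum_distrib_left)
      then show ?case by (subst Suc.IH) (simp add: sum.distrib distrib_right)
    qed (simp add: Y0)
    obtain l e where l: "\<And>i. l i \<in> Z" "\<And>i M. e i M \<in> Z"
      "\<And>i M. l i - (\<Sum>m<M. of_nat (n (Y m) i) * of_nat p ^ m) = of_nat p ^ M * e i M"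
      by (rule series_family_converges[of "\<lambda>i m. of_nat (n (Y m) i)"]) auto
    have "y - (\<Sum>i<r. l i * z i) = 0"
    proof (rule eq_0_if_divisible)
      fix M
      have "l i * z i = (\<Sum>m<M. of_nat (n (Y m) i) * of_nat p ^ m) * z i + of_nat p ^ M * (e i M * z i)" for i
        using l(3)[of i M] by (simp add: algebra_simps)
      then have "(\<Sum>i<r. l i * z i) = (\<Sum>i<r. (\<Sum>m<M. of_nat (n (Y m) i) * of_nat p ^ m) * z i) + of_nat p ^ M * (\<Sum>i<r. e i M * z i)"
        by (simp add: sum.distrib sum_distrib_left)
      then have "y - (\<Sum>i<r. l i * z i) = of_nat p ^ M * (Y M - (\<Sum>i<r. e i M * z i))"
        by (subst expand[of M]) (simp add: right_diff_distrib)
      moreover have "Y M - (\<Sum>i<r. e i M * z i) \<in> \<O>"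
        by (rule O.diff_mem[OF YO O.sum_mem[OF O.mult_mem[OF Z_subset_O[OF l(2)] z]]]) simp
      ultimately show "\<exists>w\<in>\<O>. y - (\<Sum>i<r. l i * z i) = of_nat p ^ M * w" by blast
    qed
    then show ?thesis using l(1) by (intro exI[of _ l]) simp
  qed
  then have "(\<forall>i<r. z i \<in> \<O>) \<and> (\<forall>y\<in>\<O>. \<exists>c. (\<forall>i<r. c i \<in> Z) \<and> y = (\<Sum>i<r. c i * z i))"
    using z by simp
  then show ?thesis by - (rule exI[of _ r], rule exI[of _ z])
qed

text \<open>In terms of a finite generating family, the quotients \<open>t\<close> have coefficients
  in \<open>Z\<close>, so the limit is taken coefficientwise.\<close>

lemma O_complete:
  assumes s0: "s 0 \<in> \<O>" and s: "\<And>m. \<exists>t\<in>\<O>. s (Suc m) - s m = of_nat p ^ m * t"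
  shows "\<exists>l\<in>\<O>. \<forall>M. \<exists>w\<in>\<O>. l - s M = of_nat p ^ M * w"
proof -
  obtain r :: nat and z where rz: "\<forall>i<r. z i \<in> \<O>" "\<forall>y\<in>\<O>. \<exists>c. (\<forall>i<r. c i \<in> Z) \<and> y = (\<Sum>i<r. c i * z i)"
    using ex_generators by (elim exE conjE)
  have z: "z i \<in> \<O>" if "i < r" for i using rz(1) that by blast
  have gen: "\<exists>c. (\<forall>i<r. c i \<in> Z) \<and> y = (\<Sum>i<r. c i * z i)" if "y \<in> \<O>" for y
    using rz(2) that by (rule bspec)
  obtain t where t: "\<And>m. t m \<in> \<O>" "\<And>m. s (Suc m) - s m = of_nat p ^ m * t m" using s by metis
  have "\<forall>m. \<exists>c. (\<forall>i. c i \<in> Z) \<and> t m = (\<Sum>i<r. c i * z i)"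
  proof
    fix m
    obtain c where "\<forall>i<r. c i \<in> Z" "t m = (\<Sum>i<r. c i * z i)" using gen[OF t(1)[of m]] by (elim exE conjE)
    then show "\<exists>c. (\<forall>i. c i \<in> Z) \<and> t m = (\<Sum>i<r. c i * z i)"
      by (intro exI[of _ "\<lambda>i. if i < r then c i else 0"]) auto
  qed
  then obtain c where c: "\<And>m i. c m i \<in> Z" "\<And>m. t m = (\<Sum>i<r. c m i * z i)" by metis
  obtain l e where l: "\<And>i. l i \<in> Z" "\<And>i M. e i M \<in> Z"
    "\<And>i M. l i - (\<Sum>m<M. c m i * of_nat p ^ m) = of_nat p ^ M * e i M"
    by (rule series_family_converges[of "\<lambda>i m. c m i", OF c(1)]) (rule that)
  have sM: "s M = s 0 + (\<Sum>i<r. (\<Sum>m<M. c m i * of_nat p ^ m) * z i)" for M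
  proof (induction M)
    case (Suc M)
    have "s (Suc M) = s M + of_nat p ^ M * t M" using t(2)[of M] by (simp add: algebra_simps)
    then show ?case using Suc
      by (simp add: c(2) sum_distrib_left sum.distrib distrib_right mult.assoc mult.left_commute)
  qed simp
  have "s 0 + (\<Sum>i<r. l i * z i) - s M = of_nat p ^ M * (\<Sum>i<r. e i M * z i)" for M
  proof -
    have "s 0 + (\<Sum>i<r. l i * z i) - s M = (\<Sum>i<r. (l i - (\<Sum>m<M. c m i * of_nat p ^ m)) * z i)"
      unfolding sM[of M] by (simp add: sum_subtractf left_diff_distrib)
    then show ?thesis by (simp add: l(3) sum_distrib_left mult.assoc)
  qed
  moreover have "(\<Sum>i<r. e i M * z i) \<in> \<O>" for M using l(2) z Z_subset_O by (intro O.sum_mem O.mult_mem) auto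
  moreover have "s 0 + (\<Sum>i<r. l i * z i) \<in> \<O>" using l(1) z Z_subset_O s0 by (intro O.add_mem O.sum_mem O.mult_mem) auto
  ultimately show ?thesis by blast
qed

text \<open>Newton's iteration with the derivative of \<open>s * s\<close> frozen at its value 2 for
  \<open>s = 1\<close>. Each step gains one factor \<open>\<pi>\<close>, and 2 is the only
  divisor.\<close>

lemma ex_sqrt:
  assumes half: "inverse 2 \<in> \<O>" and z: "z \<in> \<O>"
  shows "\<exists>s\<in>\<O>. s * s = 1 + \<pi> * z \<and> (\<exists>w\<in>\<O>. s - 1 = \<pi> * w)"
proof -
  define a where "a = 1 + \<pi> * z"
  have aO: "a \<in> \<O>" using z by (auto simp: a_def)
  define F where "F s = s - (s * s - a) * inverse 2" for s
  define S where "S m = (F ^^ m) 1" for m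
  have S0: "S 0 = 1" and SS: "S (Suc m) = F (S m)" for m by (simp_all add: S_def)
  have inv: "(\<exists>w\<in>\<O>. S m = 1 + \<pi> * w) \<and> (\<exists>w\<in>\<O>. S m * S m - a = \<pi> ^ Suc m * w)" for m
  proof (induction m)
    case 0
    show ?case
    proof
      show "\<exists>w\<in>\<O>. S 0 = 1 + \<pi> * w" by (intro bexI[of _ 0]) (auto simp: S0)
      show "\<exists>w\<in>\<O>. S 0 * S 0 - a = \<pi> ^ Suc 0 * w" by (intro bexI[of _ "-z"]) (use z in \<open>auto simp: S0 a_def\<close>)
    qed
  next
    case (Suc m)
    then obtain w v where w: "w \<in> \<O>" "S m = 1 + \<pi> * w" and v: "v \<in> \<O>" "S m * S m - a = \<pi> ^ Suc m * v" by blast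
    define f where "f = S m * S m - a"
    have F: "S (Suc m) = S m - f * inverse 2" by (simp add: SS F_def f_def)
    show ?case
    proof
      have "S (Suc m) = 1 + \<pi> * (w - \<pi> ^ m * v * inverse 2)"
        unfolding F f_def v(2) by (simp add: w(2) right_diff_distrib mult.assoc)
      moreover have "w - \<pi> ^ m * v * inverse 2 \<in> \<O>" using w v half by blast
      ultimately show "\<exists>w\<in>\<O>. S (Suc m) = 1 + \<pi> * w" by blast
      \<comment> \<open>The first summand gains a factor \<open>\<pi>\<close> because
        \<open>S m\<close> is congruent to 1, the second because it is quadratic in the
        error.\<close>
      have "S (Suc m) * S (Suc m) - a = f * (1 - S m) + f * f * (inverse 2 * inverse 2)"
        unfolding F by (simp add: f_def field_simps)
      also have "\<dots> = \<pi> ^ Suc m * v * (- (\<pi> * w)) + (\<pi> ^ Suc m * v) * (\<pi> ^ Suc m * v) * (inverse 2 * inverse 2)"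
        by (simp only: f_def v(2)) (simp add: w(2))
      also have "\<dots> = \<pi> ^ Suc (Suc m) * (- v * w + \<pi> ^ m * v * v * (inverse 2 * inverse 2))"
        by (simp add: algebra_simps)
      finally have "S (Suc m) * S (Suc m) - a = \<pi> ^ Suc (Suc m) * (- v * w + \<pi> ^ m * v * v * (inverse 2 * inverse 2))" .
      moreover have "- v * w + \<pi> ^ m * v * v * (inverse 2 * inverse 2) \<in> \<O>"
        using v w half by (intro O.add_mem O.mult_mem O.uminus_mem O.power_mem) auto
      ultimately show "\<exists>w\<in>\<O>. S (Suc m) * S (Suc m) - a = \<pi> ^ Suc (Suc m) * w" by blast
    qed
  qed
  have SO: "S m \<in> \<O>" for m using inv[of m] by (metis O.add_mem O.mult_mem O.one_mem pi_mem)
  have step: "\<exists>t\<in>\<O>. S (Suc m) - S m = \<pi> ^ m * t" for m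
  proof -
    obtain v where v: "v \<in> \<O>" "S m * S m - a = \<pi> ^ Suc m * v" using inv[of m] by blast
    have "S (Suc m) - S m = \<pi> ^ m * (- (\<pi> * v * inverse 2))" by (simp add: SS F_def v(2))
    moreover have "- (\<pi> * v * inverse 2) \<in> \<O>" using v half by blast
    ultimately show ?thesis by blast
  qed
  have steps: "\<exists>t\<in>\<O>. S (m + j) - S m = \<pi> ^ m * t" for m j
  proof (induction j)
    case 0
    show ?case by (intro bexI[of _ 0]) auto
  next
    case (Suc j)
    then obtain t where t: "t \<in> \<O>" "S (m + j) - S m = \<pi> ^ m * t" by blast
    obtain t' where t': "t' \<in> \<O>" "S (Suc (m + j)) - S (m + j) = \<pi> ^ (m + j) * t'" using step by blast
    have "S (m + Suc j) - S m = \<pi> ^ m * (t + \<pi> ^ j * t')"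
      using t(2) t'(2) by (simp add: algebra_simps power_add)
    then show ?case using t t' by blast
  qed
  obtain e u where e: "unit u" "of_nat p = \<pi> ^ e * u" using p_eq by blast
  have p_pi: "of_nat p ^ m = \<pi> ^ (e * m) * u ^ m" for m using e by (simp add: power_mult_distrib power_mult)
  have u: "u \<in> \<O>" "u \<noteq> 0" "inverse u \<in> \<O>" using e by (auto simp: unit_def)
  \<comment> \<open>With \<open>e = 0\<close> the prime \<open>p\<close> would be a unit;
    \<open>e \<ge> 1\<close> gives \<open>M \<le> e * M\<close> below.\<close>
  have e0: "e \<noteq> 0"
  proof
    assume "e = 0"
    then show False using e inverse_p_notin by (simp add: unit_def)
  qed
  \<comment> \<open>Completeness is stated with powers of \<open>p\<close>, which are powers of
    \<open>\<pi> ^ e\<close> up to units, so only every \<open>e\<close>-th term is used.\<close>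
  have "\<exists>l\<in>\<O>. \<forall>M. \<exists>w\<in>\<O>. l - S (e * M) = of_nat p ^ M * w"
  proof (rule O_complete)
    fix m
    obtain t where t: "t \<in> \<O>" "S (e * m + e) - S (e * m) = \<pi> ^ (e * m) * t" using steps by blast
    have "S (e * Suc m) - S (e * m) = of_nat p ^ m * (inverse u ^ m * t)"
      using t(2) u(2) by (simp add: p_pi power_inverse add.commute)
    moreover have "inverse u ^ m * t \<in> \<O>" using t u by blast
    ultimately show "\<exists>t\<in>\<O>. S (e * Suc m) - S (e * m) = of_nat p ^ m * t" by blast
  qed (simp add: S0)
  then obtain l where l: "l \<in> \<O>" "\<And>M. \<exists>w\<in>\<O>. l - S (e * M) = of_nat p ^ M * w" by blast
  have "l * l - a = 0"
  proof (rule eq_0_if_pi_divisible)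
    fix M
    obtain w where w: "w \<in> \<O>" "l - S (e * M) = of_nat p ^ M * w" using l(2) by blast
    obtain v where v: "v \<in> \<O>" "S (e * M) * S (e * M) - a = \<pi> ^ Suc (e * M) * v" using inv[of "e * M"] by blast
    define k where "k = e * M - M"
    have k: "e * M = M + k" using e0 by (simp add: k_def)
    have pk: "\<pi> ^ (e * M) = \<pi> ^ M * \<pi> ^ k" by (simp add: k power_add)
    have "l * l - a = (l - S (e * M)) * (l + S (e * M)) + (S (e * M) * S (e * M) - a)"
      by (simp add: algebra_simps)
    also have "\<dots> = \<pi> ^ M * (\<pi> ^ k * u ^ M * w * (l + S (e * M)) + \<pi> ^ k * \<pi> * v)"
      by (simp only: w(2) v(2) p_pi pk power_Suc) (simp add: algebra_simps)
    finally have "l * l - a = \<pi> ^ M * (\<pi> ^ k * u ^ M * w * (l + S (e * M)) + \<pi> ^ k * \<pi> * v)" .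
    moreover have "\<pi> ^ k * u ^ M * w * (l + S (e * M)) + \<pi> ^ k * \<pi> * v \<in> \<O>"
      using w u v l(1) SO by (intro O.add_mem O.mult_mem O.power_mem) auto
    ultimately show "\<exists>w\<in>\<O>. l * l - a = \<pi> ^ M * w" by blast
  qed
  moreover have "\<exists>w\<in>\<O>. l - 1 = \<pi> * w"
  proof -
    obtain w where w: "w \<in> \<O>" "l - S (e * 1) = of_nat p ^ 1 * w" using l(2) by blast
    obtain v where v: "v \<in> \<O>" "S (e * 1) = 1 + \<pi> * v" using inv[of "e * 1"] by blast
    obtain y where y: "y \<in> \<O>" "of_nat p = \<pi> * y" using p_eq_pi_mult by blast
    have "l - 1 = \<pi> * (y * w + v)" using w(2) v(2) y(2) by (simp add: algebra_simps)
    then show ?thesis using w v y by blast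
  qed
  ultimately show ?thesis using l(1) by (auto simp: a_def)
qed

text \<open>The digit combinations that exhaust the integers modulo \<open>p\<close> also do so
  modulo its divisor \<open>\<pi>\<close>.\<close>

lemma finite_residues: "\<exists>F. finite F \<and> (\<forall>y\<in>\<O>. \<exists>f\<in>F. \<exists>w\<in>\<O>. y = f + \<pi> * w)"
proof -
  obtain r z where gen: "\<And>y. y \<in> \<O> \<Longrightarrow>
    \<exists>n :: nat \<Rightarrow> nat. (\<forall>i<r. n i < p) \<and> (\<exists>w\<in>\<O>. y = (\<Sum>i<r. of_nat (n i) * z i) + of_nat p * w)"
    using ex_generators_mod_p by blast
  obtain v where v: "v \<in> \<O>" "of_nat p = \<pi> * v" using p_eq_pi_mult by blast
  define F where "F = (\<lambda>n. \<Sum>i<r. of_nat (n i :: nat) * z i) ` (PiE {..<r} (\<lambda>_. {..<p}))"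
  have "finite F" unfolding F_def by (intro finite_imageI finite_PiE) auto
  moreover have "\<exists>f\<in>F. \<exists>w\<in>\<O>. y = f + \<pi> * w" if y: "y \<in> \<O>" for y
  proof -
    obtain n w where n: "\<forall>i<r. n i < p" "w \<in> \<O>" "y = (\<Sum>i<r. of_nat (n i) * z i) + of_nat p * w" using gen[OF y] by blast
    have "(\<Sum>i<r. of_nat (n i) * z i) = (\<Sum>i<r. of_nat (restrict n {..<r} i) * z i)" by (rule sum.cong) auto
    moreover have "restrict n {..<r} \<in> PiE {..<r} (\<lambda>_. {..<p})" using n(1) by auto
    ultimately have "(\<Sum>i<r. of_nat (n i) * z i) \<in> F" unfolding F_def by blast
    moreover have "y = (\<Sum>i<r. of_nat (n i) * z i) + \<pi> * (v * w)" using n(3) v(2) by (simp add: mult.assoc)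
    ultimately show ?thesis using n(2) v(1) by blast
  qed
  ultimately show ?thesis by blast
qed

end

section \<open>Unramified quadratic extensions\<close>

text \<open>The properties of an unramified quadratic extension that the classification of the orbits
  rests on: \<open>R\<close> is the ring of integers of the extension field, which is the whole type,
  and \<open>\<sigma>\<close> the conjugation.\<close>

locale unramified_quadratic = field_ring_set R for R :: "'a::field_char_0 set" +
  fixes \<pi> :: 'a and \<sigma> :: "'a \<Rightarrow> 'a"
  assumes \<sigma>_add [simp]: "\<sigma> (x + y) = \<sigma> x + \<sigma> y"
    and \<sigma>_mult [simp]: "\<sigma> (x * y) = \<sigma> x * \<sigma> y"
    and \<sigma>_\<sigma> [simp]: "\<sigma> (\<sigma> x) = x"
    and \<sigma>_mem [simp, intro]: "x \<in> R \<Longrightarrow> \<sigma> x \<in> R"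
    and \<sigma>_\<pi> [simp]: "\<sigma> \<pi> = \<pi>"
    and \<pi>_mem [simp, intro]: "\<pi> \<in> R"
    and \<pi>_nonzero [simp]: "\<pi> \<noteq> 0"
    and \<pi>_not_unit: "y \<in> R \<Longrightarrow> \<pi> * y \<noteq> 1"
    and nonunit_dvd: "x \<in> R \<Longrightarrow> inverse x \<notin> R \<or> x = 0 \<Longrightarrow> \<exists>y\<in>R. x = \<pi> * y"
    and ex_valuation: "x \<noteq> 0 \<Longrightarrow> \<exists>m u. u \<in> R \<and> inverse u \<in> R \<and> u \<noteq> 0 \<and> x = \<pi> powi m * u"
    and half_mem [simp, intro]: "inverse 2 \<in> R"
    and ex_norm: "u \<in> R \<Longrightarrow> inverse u \<in> R \<Longrightarrow> u \<noteq> 0 \<Longrightarrow> \<sigma> u = u \<Longrightarrow>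
      \<exists>a. a \<in> R \<and> inverse a \<in> R \<and> a \<noteq> 0 \<and> a * \<sigma> a = u"
    and ex_fixed_sqrt: "z \<in> R \<Longrightarrow> \<sigma> z = z \<Longrightarrow>
      \<exists>s\<in>R. \<sigma> s = s \<and> s * s = 1 + \<pi> * z \<and> (\<exists>w\<in>R. s = 1 + \<pi> * w)"

lemma automorphism_overD:
  fixes \<sigma> :: "'a::field \<Rightarrow> 'a"
  assumes "automorphism_over F \<sigma>"
  shows "\<sigma> (x + y) = \<sigma> x + \<sigma> y" "\<sigma> (x * y) = \<sigma> x * \<sigma> y" "\<sigma> 1 = 1" "x \<in> F \<Longrightarrow> \<sigma> x = x"
  using assms ring_iso_memE(2,3,4)[of \<sigma> "ambient :: 'a ring" ambient]
  by (auto simp: automorphism_over_def ring_of_type_algebra_def)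

text \<open>The dimension is an inductive predicate; unfolding it twice gives a spanning pair
  \<open>v\<close>, \<open>w\<close>. Expanding \<open>x * w\<close> instead of \<open>x\<close> and
  dividing by \<open>w\<close> turns this pair into \<open>v / w\<close> and 1.\<close>

lemma quadratic_extension_basis:
  assumes "quadratic_extension F (UNIV :: 'a::field set)"
  obtains \<alpha> where "\<And>x. \<exists>a\<in>F. \<exists>b\<in>F. x = a + b * \<alpha>"
proof -
  interpret A: ring "ambient :: 'a ring" by (rule ring_from_type_algebra)
  have dim: "A.dimension 2 F UNIV" using assms by (simp add: quadratic_extension_def)
  obtain v E where v: "A.dimension 1 F E" "UNIV = A.line_extension F v E"
    using dim by (cases rule: A.dimension.cases) (auto simp: numeral_2_eq_2)
  have zero_dim: "E' = {0}" if "A.dimension 0 F E'" for E'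
    using that by (cases rule: A.dimension.cases) (auto simp: ring_of_type_algebra_def)
  obtain w E' where E': "w \<notin> E'" "E = A.line_extension F w E'" "A.dimension 0 F E'"
    using v(1) by (cases rule: A.dimension.cases) auto
  then have w: "w \<notin> {0}" "E = A.line_extension F w {0}" using zero_dim[OF E'(3)] by simp_all
  have E: "x \<in> E \<longleftrightarrow> (\<exists>b\<in>F. x = b * w)" for x
    unfolding w(2) A.line_extension_mem_iff by (auto simp: ring_of_type_algebra_def)
  have U: "\<exists>a\<in>F. \<exists>b\<in>F. x = a * v + b * w" for x
  proof -
    have "x \<in> A.line_extension F v E" using v(2) by blast
    then obtain a e where "a \<in> F" "e \<in> E" "x = a * v + e"
      unfolding A.line_extension_mem_iff by (auto simp: ring_of_type_algebra_def)
    moreover obtain b where "b \<in> F" "e = b * w" using E \<open>e \<in> E\<close> by blast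
    ultimately show ?thesis by blast
  qed
  have "\<exists>a\<in>F. \<exists>b\<in>F. x = a + b * (v / w)" for x
  proof -
    obtain a b where "a \<in> F" "b \<in> F" "x * w = a * v + b * w" using U by blast
    then show ?thesis using w(1) by (intro bexI[of _ b] bexI[of _ a]) (auto simp: field_simps)
  qed
  then show ?thesis by (rule that)
qed

locale padic_quadratic = padic p Q N for p :: nat and Q :: "'a::field_char_0 set" and N +
  fixes k :: "'a set" and \<sigma> :: "'a \<Rightarrow> 'a" and \<pi> :: 'a
  assumes odd: "odd p"
    and fin_ext: "finite_extension Q k"
    and quad_ext: "quadratic_extension k UNIV"
    and unram: "unramified Q N k UNIV"
    and aut: "automorphism_over k \<sigma>" and nontrivial: "\<sigma> \<noteq> id"
    and prime_el: "prime_element Q N k \<pi>"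
begin

lemma k_subfield: "subfield k ambient" and Q_subset_k: "Q \<subseteq> k"
  using fin_ext by (auto simp: finite_extension_def)

sublocale k: field_ring_set k
  by unfold_locales (simp_all add: subfield_ambientD[OF k_subfield])

lemma k_inverse: "x \<in> k \<Longrightarrow> inverse x \<in> k"
  by (rule subfield_ambientD(6)[OF k_subfield])

lemmas s_add [simp] = automorphism_overD(1)[OF aut]
  and s_mult [simp] = automorphism_overD(2)[OF aut]
  and s_one [simp] = automorphism_overD(3)[OF aut]
  and s_k = automorphism_overD(4)[OF aut]

lemma s_uminus [simp]: "\<sigma> (- x) = - \<sigma> x"
proof -
  have "\<sigma> (-1 * x) = \<sigma> (-1) * \<sigma> x" by (rule s_mult)
  moreover have "\<sigma> (-1) = -1" by (intro s_k k.uminus_mem k.one_mem)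
  ultimately show ?thesis by simp
qed

lemma s_diff [simp]: "\<sigma> (x - y) = \<sigma> x - \<sigma> y"
  using s_add[of x "-y"] by (simp del: s_add)

text \<open>Completing the square turns a generator of the quadratic extension into one that is negated
  by the nontrivial automorphism.\<close>

lemma ex_negated:
  obtains \<beta> where "\<beta> \<noteq> 0" "\<sigma> \<beta> = - \<beta>" "\<And>x. \<exists>a\<in>k. \<exists>b\<in>k. x = a + b * \<beta>"
proof -
  obtain \<alpha> where \<alpha>: "\<And>x. \<exists>a\<in>k. \<exists>b\<in>k. x = a + b * \<alpha>"
    using quadratic_extension_basis[OF quad_ext] by blast
  obtain c b where bc: "c \<in> k" "b \<in> k" "\<alpha> * \<alpha> = c + b * \<alpha>" using \<alpha> by blast
  have half: "inverse 2 \<in> k" by (rule k_inverse) simp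
  define \<beta> where "\<beta> = \<alpha> - b * inverse 2"
  have span: "\<exists>a\<in>k. \<exists>b\<in>k. x = a + b * \<beta>" for x
  proof -
    obtain a' b' where ab: "a' \<in> k" "b' \<in> k" "x = a' + b' * \<alpha>" using \<alpha> by blast
    have "x = (a' + b' * (b * inverse 2)) + b' * \<beta>" by (simp add: ab(3) \<beta>_def algebra_simps)
    then show ?thesis using ab bc half by blast
  qed
  have "\<beta> * \<beta> = \<alpha> * \<alpha> - b * \<alpha> + b * b * inverse 2 * inverse 2"
    by (simp add: \<beta>_def field_simps)
  then have "\<beta> * \<beta> = c + b * b * inverse 2 * inverse 2" unfolding bc(3) by simp
  then have "\<beta> * \<beta> \<in> k" by (simp only:) (intro k.add_mem k.mult_mem bc half)
  then have "\<sigma> \<beta> * \<sigma> \<beta> = \<beta> * \<beta>" using s_k[of "\<beta> * \<beta>"] by simp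
  then have pm: "\<sigma> \<beta> = \<beta> \<or> \<sigma> \<beta> = - \<beta>" by (simp add: square_eq_iff)
  have "\<sigma> \<beta> \<noteq> \<beta>"
  proof
    assume fixed: "\<sigma> \<beta> = \<beta>"
    have "\<sigma> x = x" for x
    proof -
      obtain a b where "a \<in> k" "b \<in> k" "x = a + b * \<beta>" using span by blast
      then show ?thesis using fixed by (simp add: s_k)
    qed
    then show False using nontrivial by auto
  qed
  with pm have "\<sigma> \<beta> = - \<beta>" by blast
  moreover have "\<beta> \<noteq> 0" using \<open>\<sigma> \<beta> \<noteq> \<beta>\<close> \<open>\<sigma> \<beta> = - \<beta>\<close> by auto
  ultimately show ?thesis using span that by blast
qed

text \<open>Neither property is part of \<open>automorphism_over\<close>; both are read off from
  coordinates with respect to 1 and a negated generator.\<close>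

lemma s_s: "\<sigma> (\<sigma> x) = x" and fixed_imp_k: "\<sigma> x = x \<Longrightarrow> x \<in> k"
proof -
  obtain \<beta> where \<beta>: "\<beta> \<noteq> 0" "\<sigma> \<beta> = - \<beta>" "\<And>x. \<exists>a\<in>k. \<exists>b\<in>k. x = a + b * \<beta>" using ex_negated by blast
  obtain a b where ab: "a \<in> k" "b \<in> k" "x = a + b * \<beta>" using \<beta>(3) by blast
  show "\<sigma> (\<sigma> x) = x" using ab \<beta>(2) by (simp add: s_k)
  assume "\<sigma> x = x"
  then have "b * \<beta> = 0" using ab \<beta>(2) by (auto simp: s_k)
  then show "x \<in> k" using \<beta>(1) ab by simp
qed

abbreviation Ok where "Ok \<equiv> ring_of_integers Q N k"
abbreviation OE where "OE \<equiv> ring_of_integers Q N UNIV"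

lemma Ok_iff: "x \<in> Ok \<longleftrightarrow> x \<in> k \<and> x \<in> OE"
  by (auto simp: ring_of_integers_def)

text \<open>\<open>unramified\<close> provides some element that is prime in both fields. Two primes
  of \<open>k\<close> divide each other over the integers of \<open>k\<close>, hence also over the
  integers of the extension, where they generate the same ideal.\<close>

lemma prime_element_E: "prime_element Q N UNIV \<pi>"
proof -
  obtain \<pi>' where p': "prime_element Q N k \<pi>'" "prime_element Q N UNIV \<pi>'" using unram by (auto simp: unramified_def)
  have R: "ring_set OE" using Z.ring_set_integral_over by (simp add: ring_of_integers_def integral_over_def)
  interpret OE: ring_set OE by (rule R)
  have 1: "1 \<in> Ok" by (auto simp: Ok_iff)
  have eq: "{\<pi> * y | y. y \<in> Ok} = {\<pi>' * y | y. y \<in> Ok}"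
    using p'(1) prime_el unfolding prime_element_def by metis
  have "\<pi>' \<in> {\<pi>' * y | y. y \<in> Ok}" "\<pi> \<in> {\<pi> * y | y. y \<in> Ok}"
    using 1 by (auto intro: exI[of _ 1])
  then have "\<pi>' \<in> {\<pi> * y | y. y \<in> Ok}" "\<pi> \<in> {\<pi>' * y | y. y \<in> Ok}"
    by (simp_all only: eq)
  then obtain a b where "\<pi>' = \<pi> * a" "a \<in> Ok" "\<pi> = \<pi>' * b" "b \<in> Ok" by blast
  then have ab: "\<pi>' = \<pi> * a" "a \<in> OE" "\<pi> = \<pi>' * b" "b \<in> OE" by (simp_all only: Ok_iff)
  have "{\<pi>' * y | y. y \<in> OE} = {\<pi> * y | y. y \<in> OE}"
  proof (intro subset_antisym subsetI)
    fix x assume "x \<in> {\<pi>' * y | y. y \<in> OE}"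
    then obtain y where "x = \<pi> * (a * y)" "y \<in> OE" using ab(1) by (auto simp: mult.assoc)
    then show "x \<in> {\<pi> * y | y. y \<in> OE}" using ab by blast
  next
    fix x assume "x \<in> {\<pi> * y | y. y \<in> OE}"
    then obtain y where "x = \<pi>' * (b * y)" "y \<in> OE" using ab(3) by (auto simp: mult.assoc)
    then show "x \<in> {\<pi>' * y | y. y \<in> OE}" using ab by blast
  qed
  then show ?thesis using p'(2) by (simp add: prime_element_def)
qed

sublocale padic_extension p Q N \<pi>
proof
  show "ring.finite_dimension ambient Q (UNIV :: 'a set)"
  proof -
    interpret A: ring "ambient :: 'a ring" by (rule ring_from_type_algebra)
    have "A.finite_dimension k UNIV" using quad_ext
      unfolding quadratic_extension_def A.finite_dimension_def by blast
    moreover have "A.finite_dimension Q k" using fin_ext by (simp add: finite_extension_def)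
    ultimately show ?thesis using A.telescopic_base_dim(1)[OF Q_subfield k_subfield] by blast
  qed
qed (rule prime_element_E)

lemma pi_k: "\<pi> \<in> k" using prime_el by (simp add: prime_element_def)

text \<open>The only use of the oddness of \<open>p\<close>: it gives 2 the absolute value
  1.\<close>

lemma half_O: "inverse 2 \<in> \<O>"
proof -
  have "\<not> int p dvd 2"
  proof
    assume "int p dvd 2"
    then have "p dvd 2" by presburger
    then have "p \<le> 2" by (simp add: dvd_imp_le)
    then show False using odd p_gt_1 by (cases "p = 2") auto
  qed
  then have "\<not> N (of_int 2) < 1" using N_of_int_lt_1_iff[of 2] by simp
  moreover have "N (of_int 2) \<le> 1" by (rule N_of_int_le_1)
  ultimately have "N 2 = 1" by simp
  then have "inverse 2 \<in> Z" by (auto simp: Z_iff)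
  then show ?thesis by (rule Z_subset_O)
qed

text \<open>The coefficients of a monic equation over \<open>Z\<close> lie in \<open>k\<close> and
  are fixed, so \<open>\<sigma>\<close> maps roots to roots.\<close>

lemma s_mem_O: "x \<in> \<O> \<Longrightarrow> \<sigma> x \<in> \<O>"
proof -
  assume "x \<in> \<O>"
  then obtain f where f: "lead_coeff f = 1" "\<And>i. coeff f i \<in> Z" "poly f x = 0"
    unfolding O_iff integral_over_def by blast
  have s0: "\<sigma> 0 = 0" by (rule s_k) simp
  have ssum: "\<sigma> (sum g A) = (\<Sum>a\<in>A. \<sigma> (g a))" if "finite A" for g :: "nat \<Rightarrow> 'a" and A
    using that by (induction A) (auto simp: s0)
  have spow: "\<sigma> (x ^ i) = \<sigma> x ^ i" for i by (induction i) auto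
  have "\<sigma> (coeff f i) = coeff f i" for i using f(2)[of i] Q_subset_k by (intro s_k) (auto simp: Z_iff)
  then have "poly f (\<sigma> x) = \<sigma> (poly f x)" by (simp add: poly_altdef ssum spow)
  then have "poly f (\<sigma> x) = 0" using f(3) s0 by simp
  then show ?thesis using f(1,2) unfolding O_iff integral_over_def by blast
qed

text \<open>\<open>\<sigma> s\<close> is another square root of a fixed element, hence
  \<open>s\<close> or \<open>- s\<close>; the latter is impossible since \<open>s\<close> and
  \<open>\<sigma> s\<close> are both congruent to 1 and 2 is a unit.\<close>

lemma fixed_sqrt:
  assumes "z \<in> \<O>" "\<sigma> z = z"
  shows "\<exists>s\<in>\<O>. \<sigma> s = s \<and> s * s = 1 + \<pi> * z \<and> (\<exists>w\<in>\<O>. s = 1 + \<pi> * w)"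
proof -
  obtain s w where s: "s \<in> \<O>" "s * s = 1 + \<pi> * z" "w \<in> \<O>" "s - 1 = \<pi> * w"
    using ex_sqrt[OF half_O assms(1)] by blast
  have sw: "s = 1 + \<pi> * w" using s(4) by (simp add: algebra_simps)
  have "\<sigma> s * \<sigma> s = s * s" using s(2) assms(2) pi_k s_k[of \<pi>] by (metis s_add s_mult s_one)
  then have "\<sigma> s = s \<or> \<sigma> s = - s" by (simp add: square_eq_iff)
  moreover have "\<sigma> s \<noteq> - s"
  proof
    assume "\<sigma> s = - s"
    then have "1 + \<pi> * \<sigma> w = - (1 + \<pi> * w)" using sw s_k[OF pi_k] by (metis s_add s_mult s_one)
    then have "2 = \<pi> * (- w - \<sigma> w)" by (simp add: algebra_simps eq_neg_iff_add_eq_0)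
    then have "\<pi> * ((- w - \<sigma> w) * inverse 2) = 1" by (metis mult.assoc right_inverse zero_neq_numeral)
    moreover have "(- w - \<sigma> w) * inverse 2 \<in> \<O>" using s(3) s_mem_O half_O by blast
    ultimately show False using pi_mult_neq_1 by blast
  qed
  ultimately show ?thesis using s sw by blast
qed

text \<open>Dividing a negated element by a power of \<open>\<pi>\<close> keeps it negated because
  \<open>\<pi>\<close> is fixed, and can make it a unit because \<open>\<pi>\<close> is a prime of
  the extension.\<close>

lemma ex_negated_unit:
  obtains \<epsilon> where "unit \<epsilon>" "\<sigma> \<epsilon> = - \<epsilon>"
proof -
  obtain \<beta> where \<beta>: "\<beta> \<noteq> 0" "\<sigma> \<beta> = - \<beta>" using ex_negated by metis
  obtain m u where u: "unit u" "\<beta> = \<pi> powi m * u" using ex_pi_powi_unit[OF \<beta>(1)] by blast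
  have "u = \<pi> powi (- m) * \<beta>" by (simp add: u(2) power_int_minus)
  moreover have "\<pi> powi (- m) \<in> k"
    using pi_k k_inverse by (cases m rule: int_cases3) (auto simp: power_int_def)
  ultimately have "\<sigma> u = - u" using \<beta>(2) by (simp add: s_k)
  then show ?thesis using that u(1) by blast
qed

section \<open>Residue classes and norms of units\<close>

definition eqv :: "'a \<Rightarrow> 'a \<Rightarrow> bool" where
  "eqv x y \<longleftrightarrow> (\<exists>w\<in>\<O>. x - y = \<pi> * w)"

lemma eqv_refl [simp]: "eqv x x"
  unfolding eqv_def by (intro bexI[of _ 0]) auto

lemma eqv_sym: "eqv x y \<Longrightarrow> eqv y x"
proof -
  assume "eqv x y"
  then obtain w where "w \<in> \<O>" "x - y = \<pi> * w" by (auto simp: eqv_def)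
  then show ?thesis unfolding eqv_def by (intro bexI[of _ "-w"]) (auto simp: algebra_simps)
qed

lemma eqv_trans: "eqv x y \<Longrightarrow> eqv y z \<Longrightarrow> eqv x z"
proof -
  assume "eqv x y" "eqv y z"
  then obtain w v where "w \<in> \<O>" "x - y = \<pi> * w" "v \<in> \<O>" "y - z = \<pi> * v" by (auto simp: eqv_def)
  then show ?thesis unfolding eqv_def by (intro bexI[of _ "w + v"]) (auto simp: algebra_simps)
qed

lemma eqv_mult: "x \<in> \<O> \<Longrightarrow> y' \<in> \<O> \<Longrightarrow> eqv x x' \<Longrightarrow> eqv y y' \<Longrightarrow> eqv (x * y) (x' * y')"
proof -
  assume x: "x \<in> \<O>" "y' \<in> \<O>" and "eqv x x'" "eqv y y'"
  then obtain w v where w: "w \<in> \<O>" "x - x' = \<pi> * w" "v \<in> \<O>" "y - y' = \<pi> * v" by (auto simp: eqv_def)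
  have "x * y - x' * y' = x * (y - y') + (x - x') * y'" by (simp add: algebra_simps)
  also have "\<dots> = \<pi> * (x * v + w * y')" unfolding w(2,4) by (simp add: algebra_simps)
  finally show ?thesis using x w unfolding eqv_def by blast
qed

text \<open>If \<open>x - y\<close> is a unit, \<open>\<pi>\<close> must divide the other factor of
  \<open>x * x - y * y\<close>.\<close>

lemma eqv_square: "x \<in> \<O> \<Longrightarrow> y \<in> \<O> \<Longrightarrow> eqv (x * x) (y * y) \<Longrightarrow> eqv x y \<or> eqv x (- y)"
proof -
  assume xy: "x \<in> \<O>" "y \<in> \<O>" "eqv (x * x) (y * y)"
  then obtain w where w: "w \<in> \<O>" "x * x - y * y = \<pi> * w" by (auto simp: eqv_def)
  show ?thesis
  proof (cases "unit (x - y)")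
    case False
    then show ?thesis using nonunit[of "x - y"] xy by (auto simp: eqv_def)
  next
    case True
    have "(x - y) * (x - - y) = \<pi> * w" using w(2) by (simp add: algebra_simps)
    then have "x - - y = \<pi> * (inverse (x - y) * w)" using True by (simp add: unit_def field_simps)
    then show ?thesis using True w unfolding eqv_def unit_def by blast
  qed
qed

text \<open>Residue classes are counted as values of \<open>rep\<close>, without a quotient type:
  the predicate under the choice depends only on the class of \<open>x\<close>, so congruent
  elements get the same representative.\<close>

definition rep :: "'a \<Rightarrow> 'a" where
  "rep x = (SOME y. y \<in> Ok \<and> eqv y x)"

lemma rep: "x \<in> Ok \<Longrightarrow> rep x \<in> Ok" "x \<in> Ok \<Longrightarrow> eqv (rep x) x"
  using someI[of "\<lambda>y. y \<in> Ok \<and> eqv y x" x] by (auto simp: rep_def)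

lemma rep_eq_iff: "x \<in> Ok \<Longrightarrow> y \<in> Ok \<Longrightarrow> rep x = rep y \<longleftrightarrow> eqv x y"
proof
  assume "x \<in> Ok" "y \<in> Ok" "rep x = rep y"
  then show "eqv x y" using rep(2)[of x] rep(2)[of y] eqv_sym eqv_trans by metis
next
  assume e: "eqv x y"
  have "eqv z x \<longleftrightarrow> eqv z y" for z using e eqv_sym eqv_trans by blast
  then show "rep x = rep y" by (simp add: rep_def)
qed

sublocale Ok: field_ring_set Ok
  by unfold_locales (auto simp: Ok_iff)

text \<open>The finite list of residues need not lie in \<open>k\<close>; sending a representative
  to a congruent member of the list is injective nevertheless.\<close>

lemma finite_rep: "finite (rep ` Ok)"
proof -
  obtain F where F: "finite F" "\<And>y. y \<in> \<O> \<Longrightarrow> \<exists>f\<in>F. \<exists>w\<in>\<O>. y = f + \<pi> * w" using finite_residues by blast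
  have "\<forall>y\<in>Ok. \<exists>f\<in>F. eqv y f" using F(2) by (auto simp: eqv_def Ok_iff) (metis add_diff_cancel_left')
  then obtain h where h: "\<And>y. y \<in> Ok \<Longrightarrow> h y \<in> F" "\<And>y. y \<in> Ok \<Longrightarrow> eqv y (h y)" by metis
  have "inj_on h (rep ` Ok)"
  proof (rule inj_onI)
    fix x y assume xy: "x \<in> rep ` Ok" "y \<in> rep ` Ok" "h x = h y"
    then obtain x' y' where x': "x' \<in> Ok" "x = rep x'" "y' \<in> Ok" "y = rep y'" by blast
    then have "x \<in> Ok" "y \<in> Ok" using rep by auto
    then have "eqv x y" using h(2)[of x] h(2)[of y] xy(3) eqv_sym eqv_trans by metis
    then have "eqv x' y'" using rep(2)[OF x'(1)] rep(2)[OF x'(3)] x'(2,4) eqv_sym eqv_trans by metis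
    then show "x = y" using rep_eq_iff x' by simp
  qed
  moreover have "h ` rep ` Ok \<subseteq> F" using h(1) rep(1) by auto
  ultimately show ?thesis using F(1) finite_subset finite_imageD by blast
qed

text \<open>At least half of the residue classes are squares, hence for units \<open>u\<close> and \<open>d\<close> the squares
  and the values \<open>u + d b\<^sup>2\<close> share a class.\<close>

lemma card_squares: "card (rep ` Ok) < 2 * card ((\<lambda>x. rep (x * x)) ` Ok)"
proof -
  define R where "R = rep ` Ok"
  have finR: "finite R" using finite_rep by (simp add: R_def)
  have RO: "x \<in> Ok" if "x \<in> R" for x using that rep by (auto simp: R_def)
  have repR: "rep x = x" if xR: "x \<in> R" for x
  proof -
    obtain y where y: "x = rep y" "y \<in> Ok" using xR unfolding R_def by (rule imageE)
    then show ?thesis using rep[OF y(2)] rep_eq_iff[of "rep y" y] by simp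
  qed
  define q where "q x = rep (x * x)" for x
  have qR: "q ` Ok = q ` R"
  proof
    show "q ` R \<subseteq> q ` Ok" using RO by blast
    show "q ` Ok \<subseteq> q ` R"
    proof
      fix y assume "y \<in> q ` Ok"
      then obtain x where x: "x \<in> Ok" "y = q x" by blast
      have "eqv (rep x * rep x) (x * x)" using rep[OF x(1)] x(1) by (intro eqv_mult) (auto simp: Ok_iff)
      then have "q (rep x) = q x" unfolding q_def using rep[OF x(1)] x(1) by (subst rep_eq_iff) auto
      then show "y \<in> q ` R" using x by (auto simp: R_def image_iff intro!: bexI[of _ x])
    qed
  qed
  define r0 where "r0 = rep 0"
  have r0: "r0 \<in> R" by (auto simp: r0_def R_def)
  \<comment> \<open>A fibre of squaring contains at most the classes of \<open>x\<close> and
    \<open>- x\<close>.\<close>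
  have fib: "card {x \<in> R. q x = y} \<le> 2" if yR: "y \<in> q ` R" for y
  proof -
    obtain x where x: "x \<in> R" "y = q x" using yR by blast
    have "{x \<in> R. q x = y} \<subseteq> {x, rep (- x)}"
    proof
      fix z assume z: "z \<in> {x \<in> R. q x = y}"
      then have "eqv (z * z) (x * x)" using x RO rep_eq_iff[of "z * z" "x * x"] by (auto simp: q_def)
      then have "eqv z x \<or> eqv z (- x)" using eqv_square z x RO by (auto simp: Ok_iff)
      then have "rep z = rep x \<or> rep z = rep (- x)"
        using z x RO rep_eq_iff[of z x] rep_eq_iff[of z "- x"] by (auto simp: Ok.uminus_mem)
      then show "z \<in> {x, rep (- x)}" using z x repR by auto
    qed
    then have "card {x \<in> R. q x = y} \<le> card {x, rep (- x)}" by (rule card_mono[rotated]) simp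
    also have "\<dots> \<le> 2" by (simp add: card_insert_if)
    finally show ?thesis .
  qed
  \<comment> \<open>Above 0 there is a single class; this makes the final inequality strict.\<close>
  have fib0: "{x \<in> R. q x = q r0} \<subseteq> {r0}"
  proof
    fix z assume z: "z \<in> {x \<in> R. q x = q r0}"
    have r0': "r0 \<in> Ok" "eqv r0 0" using rep[of 0] by (auto simp: r0_def)
    have "eqv (r0 * r0) (0 * 0)" using r0' by (intro eqv_mult) (auto simp: Ok_iff)
    moreover have "eqv (z * z) (r0 * r0)" using z RO r0' rep_eq_iff[of "z * z" "r0 * r0"] by (auto simp: q_def)
    ultimately have "eqv (z * z) (0 * 0)" using eqv_trans by blast
    then have "eqv z 0" using eqv_square[of z 0] z RO by (auto simp: Ok_iff)
    then have "rep z = r0" using z RO rep_eq_iff[of z 0] by (auto simp: r0_def)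
    then show "z \<in> {r0}" using z repR by auto
  qed
  have "R = (\<Union>y\<in>q ` R. {x \<in> R. q x = y})" by blast
  then have "card R = card (\<Union>y\<in>q ` R. {x \<in> R. q x = y})" by simp
  also have "\<dots> \<le> (\<Sum>y\<in>q ` R. card {x \<in> R. q x = y})" using finR by (intro card_UN_le) simp
  also have "\<dots> = card {x \<in> R. q x = q r0} + (\<Sum>y\<in>q ` R - {q r0}. card {x \<in> R. q x = y})"
    using finR r0 by (intro sum.remove) auto
  also have "\<dots> \<le> 1 + (\<Sum>y\<in>q ` R - {q r0}. 2)"
    using fib0 card_mono[OF _ fib0] fib by (intro add_mono sum_mono) auto
  also have "\<dots> = 1 + 2 * (card (q ` R) - 1)" using finR r0 by simp
  finally have "card R \<le> 1 + 2 * (card (q ` R) - 1)" .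
  moreover have "card (q ` R) > 0" using finR r0 by (auto simp: card_gt_0_iff)
  ultimately have "card R < 2 * card (q ` R)" by linarith
  then show ?thesis using qR by (simp add: R_def q_def)
qed

lemma ex_norm_eqv:
  assumes u: "u \<in> Ok" and d: "d \<in> Ok" "unit d"
  shows "\<exists>a\<in>Ok. \<exists>b\<in>Ok. eqv (a * a) (u + d * (b * b))"
proof (rule ccontr)
  assume neg: "\<not> ?thesis"
  define A where "A = (\<lambda>x. rep (x * x)) ` Ok"
  define B where "B = (\<lambda>x. rep (u + d * (x * x))) ` Ok"
  have sub: "A \<subseteq> rep ` Ok" "B \<subseteq> rep ` Ok" using u d(1) by (auto simp: A_def B_def)
  have finA: "finite A" "finite B" using sub finite_rep finite_subset by blast+
  have inv_d: "inverse d \<in> \<O>" "d \<noteq> 0" "d \<in> \<O>" using d by (auto simp: unit_def)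
  \<comment> \<open>Since \<open>d\<close> is a unit, the class of \<open>u + d * (x * x)\<close>
    determines that of \<open>x * x\<close>; two disjoint sets of this size would exceed the number
    of classes.\<close>
  have "card A \<le> card B"
  proof (rule surj_card_le[OF finA(2)])
    show "A \<subseteq> (\<lambda>y. rep ((y - u) * inverse d)) ` B"
    proof
      fix y assume "y \<in> A"
      then obtain x where x: "x \<in> Ok" "y = rep (x * x)" by (auto simp: A_def)
      define z where "z = rep (u + d * (x * x))"
      have udx: "u + d * (x * x) \<in> Ok" using u d x by blast
      then have z: "z \<in> Ok" "eqv z (u + d * (x * x))" using rep by (auto simp: z_def)
      have "eqv ((z - u) * inverse d) ((u + d * (x * x) - u) * inverse d)"
      proof (rule eqv_mult)
        have "z - u - (u + d * (x * x) - u) = z - (u + d * (x * x))" by simp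
        then show "eqv (z - u) (u + d * (x * x) - u)" using z(2) unfolding eqv_def by (simp only:)
      qed (use z u inv_d in \<open>auto simp: Ok_iff\<close>)
      then have e: "eqv ((z - u) * inverse d) (x * x)" using inv_d by (simp add: field_simps)
      moreover have "(z - u) * inverse d \<in> Ok"
        using z u inv_d d(1) k_inverse[of d] by (auto simp: Ok_iff)
      ultimately have "rep ((z - u) * inverse d) = y" using x rep_eq_iff[of "(z - u) * inverse d" "x * x"] by (simp add: Ok.mult_mem)
      moreover have "z \<in> B" using x by (auto simp: B_def z_def)
      ultimately show "y \<in> (\<lambda>y. rep ((y - u) * inverse d)) ` B" by blast
    qed
  qed
  moreover have "A \<inter> B = {}"
  proof (rule ccontr)
    assume "A \<inter> B \<noteq> {}"
    then obtain a b where ab: "a \<in> Ok" "b \<in> Ok" "rep (a * a) = rep (u + d * (b * b))" by (auto simp: A_def B_def)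
    moreover have "a * a \<in> Ok" "u + d * (b * b) \<in> Ok" using u d ab by blast+
    ultimately have "eqv (a * a) (u + d * (b * b))" using rep_eq_iff by simp
    then show False using neg ab by blast
  qed
  then have "card A + card B \<le> card (rep ` Ok)"
    using sub finA finite_rep by (metis Un_least card_Un_disjoint card_mono)
  ultimately show False using card_squares by (simp add: A_def)
qed

text \<open>With \<open>\<epsilon>\<close> a negated unit, \<open>a + b * \<epsilon>\<close> has
  norm \<open>a * a - d * (b * b)\<close> for \<open>a\<close> and \<open>b\<close> in
  \<open>k\<close>. This reaches \<open>u\<close> modulo \<open>\<pi>\<close>; the quotient is a
  unit of \<open>k\<close> congruent to 1, hence the square of a fixed element, and that square is a
  norm.\<close>

lemma norm_surj:
  assumes u: "unit u" "\<sigma> u = u"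
  shows "\<exists>a. unit a \<and> a * \<sigma> a = u"
proof -
  obtain \<epsilon> where \<epsilon>: "unit \<epsilon>" "\<sigma> \<epsilon> = - \<epsilon>" by (rule ex_negated_unit)
  define d where "d = \<epsilon> * \<epsilon>"
  have dk: "d \<in> k" by (rule fixed_imp_k) (simp add: d_def \<epsilon>)
  have ud: "unit d" using \<epsilon> by (simp add: d_def unit_mult)
  have uk: "u \<in> k" using fixed_imp_k u by blast
  have "u \<in> Ok" "d \<in> Ok" using uk dk ud u by (auto simp: Ok_iff unit_def)
  then obtain a b where ab: "a \<in> Ok" "b \<in> Ok" "eqv (a * a) (u + d * (b * b))" using ex_norm_eqv ud by blast
  then obtain w where w: "w \<in> \<O>" "a * a - (u + d * (b * b)) = \<pi> * w" by (auto simp: eqv_def)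
  define c where "c = a + b * \<epsilon>"
  have sab: "\<sigma> a = a" "\<sigma> b = b" using ab by (auto simp: Ok_iff s_k)
  have norm_c: "c * \<sigma> c = u + \<pi> * w"
    using w(2) sab \<epsilon> by (simp add: c_def d_def algebra_simps)
  have cO: "c \<in> \<O>" using ab \<epsilon> by (auto simp: c_def Ok_iff unit_def)
  have uO: "u \<in> \<O>" "u \<noteq> 0" "inverse u \<in> \<O>" using u by (auto simp: unit_def)
  have uc: "unit (c * \<sigma> c)"
  proof (rule ccontr)
    assume "\<not> unit (c * \<sigma> c)"
    then obtain y where y: "y \<in> \<O>" "c * \<sigma> c = \<pi> * y" using nonunit[OF O.mult_mem[OF cO s_mem_O[OF cO]]] by auto
    then have "u = \<pi> * (y - w)" using norm_c by (simp add: algebra_simps)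
    then show False using u(1) not_unit_pi_mult[OF O.diff_mem[OF y(1) w(1)]] by simp
  qed
  have c0: "c \<noteq> 0" "\<sigma> c \<noteq> 0" using uc by (auto simp: unit_def)
  \<comment> \<open>Chosen to make \<open>1 + \<pi> * z\<close> the quotient of \<open>u\<close> by
    the norm of \<open>c\<close>.\<close>
  define z where "z = - w * inverse (c * \<sigma> c)"
  have zO: "z \<in> \<O>" using O.mult_mem[OF O.uminus_mem[OF w(1)]] uc unfolding z_def unit_def by blast
  have swk: "\<sigma> w = w"
  proof -
    have "\<pi> * w \<in> k" using norm_c uk ab w(2) dk by (metis Ok_iff k.add_mem k.diff_mem k.mult_mem)
    then have "\<pi> * \<sigma> w = \<pi> * w" using s_k[of "\<pi> * w"] s_k[OF pi_k] by simp
    then show ?thesis by simp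
  qed
  have "\<sigma> (c * \<sigma> c) = c * \<sigma> c" by (simp add: s_s)
  then have "c * \<sigma> c \<in> k" by (rule fixed_imp_k)
  then have "\<sigma> z = z" using swk s_k[OF k_inverse] by (simp add: z_def del: inverse_mult_distrib)
  then obtain s where s: "s \<in> \<O>" "\<sigma> s = s" "s * s = 1 + \<pi> * z" using fixed_sqrt[OF zO] by blast
  have "1 + \<pi> * z = u * inverse (c * \<sigma> c)"
  proof -
    have "c * \<sigma> c \<noteq> 0" using c0 by simp
    moreover have "u = c * \<sigma> c - \<pi> * w" using norm_c by simp
    ultimately show ?thesis
      by (simp add: z_def field_simps)
  qed
  then have "s * s * (c * \<sigma> c) = u" using s(3) c0 by (simp add: field_simps)
  then have n: "(s * c) * \<sigma> (s * c) = u" using s(2) by (simp add: algebra_simps)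
  have "unit (s * c)"
  proof -
    have "s * c \<noteq> 0" using n uO by auto
    then have "inverse (s * c) = \<sigma> (s * c) * inverse u" using n uO(2) by (simp add: field_simps)
    moreover have "\<sigma> (s * c) * inverse u \<in> \<O>" by (intro O.mult_mem s_mem_O s(1) cO uO)
    moreover have "s * c \<in> \<O>" by (intro O.mult_mem s(1) cO)
    ultimately show ?thesis using \<open>s * c \<noteq> 0\<close> unfolding unit_def by (simp only: simp_thms)
  qed
  then show ?thesis using n by blast
qed

sublocale E: unramified_quadratic \<O> \<pi> \<sigma>
proof unfold_locales
  fix x :: 'a
  assume "x \<in> \<O>" "inverse x \<notin> \<O> \<or> x = 0"
  then show "\<exists>y\<in>\<O>. x = \<pi> * y" using nonunit[of x] by (auto simp: unit_def)
next
  fix x :: 'a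
  assume "x \<noteq> 0"
  then show "\<exists>m u. u \<in> \<O> \<and> inverse u \<in> \<O> \<and> u \<noteq> 0 \<and> x = \<pi> powi m * u"
    using ex_pi_powi_unit[of x] unfolding unit_def by blast
next
  fix u :: 'a
  assume "u \<in> \<O>" "inverse u \<in> \<O>" "u \<noteq> 0" "\<sigma> u = u"
  then show "\<exists>a. a \<in> \<O> \<and> inverse a \<in> \<O> \<and> a \<noteq> 0 \<and> a * \<sigma> a = u"
    using norm_surj[of u] unfolding unit_def by blast
next
  show "inverse 2 \<in> \<O>" by (rule half_O)
qed (simp_all add: s_s s_mem_O s_k pi_k fixed_sqrt pi_mult_neq_1)

end

section \<open>Hermitian lattices with an isometric involution\<close>

context unramified_quadratic
begin

lemma \<sigma>_0 [simp]: "\<sigma> 0 = 0" using \<sigma>_add[of 0 0] by simp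

lemma \<sigma>_1 [simp]: "\<sigma> 1 = 1"
  using \<sigma>_mult[of 1 "\<sigma> 1"] by simp

lemma \<sigma>_uminus [simp]: "\<sigma> (- x) = - \<sigma> x"
  using \<sigma>_add[of x "- x"] by (simp add: eq_neg_iff_add_eq_0 add.commute del: \<sigma>_add)

lemma \<sigma>_diff [simp]: "\<sigma> (x - y) = \<sigma> x - \<sigma> y"
  using \<sigma>_add[of x "- y"] by (simp del: \<sigma>_add)

lemma \<sigma>_eq_0_iff [simp]: "\<sigma> x = 0 \<longleftrightarrow> x = 0"
  using \<sigma>_\<sigma>[of x] by (metis \<sigma>_0)

lemma \<sigma>_inverse [simp]: "\<sigma> (inverse x) = inverse (\<sigma> x)"
proof (cases "x = 0")
  case False
  then have "\<sigma> x * \<sigma> (inverse x) = 1" by (metis \<sigma>_1 \<sigma>_mult right_inverse)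
  then show ?thesis by (metis inverse_unique)
qed simp

lemma \<sigma>_divide [simp]: "\<sigma> (x / y) = \<sigma> x / \<sigma> y"
  by (simp add: divide_inverse)

lemma \<sigma>_power [simp]: "\<sigma> (x ^ n) = \<sigma> x ^ n"
  by (induction n) auto

lemma \<sigma>_powi [simp]: "\<sigma> (x powi n) = \<sigma> x powi n"
  by (simp add: power_int_def)

lemma \<sigma>_sum: "\<sigma> (sum f A) = (\<Sum>a\<in>A. \<sigma> (f a))"
  by (induction A rule: infinite_finite_induct) auto

lemma \<sigma>_prod: "\<sigma> (prod f A) = (\<Prod>a\<in>A. \<sigma> (f a))"
  by (induction A rule: infinite_finite_induct) auto

lemma \<sigma>_of_nat [simp]: "\<sigma> (of_nat n) = of_nat n"
  by (induction n) auto

lemma \<sigma>_numeral [simp]: "\<sigma> (numeral n) = numeral n"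
  using \<sigma>_of_nat[of "numeral n"] by simp

definition unit :: "'a \<Rightarrow> bool" where
  "unit x \<longleftrightarrow> x \<in> R \<and> inverse x \<in> R \<and> x \<noteq> 0"

lemma unit_mem [intro]: "unit x \<Longrightarrow> x \<in> R" and unit_inverse_mem [intro]: "unit x \<Longrightarrow> inverse x \<in> R"
  and unit_nonzero: "unit x \<Longrightarrow> x \<noteq> 0"
  by (auto simp: unit_def)

lemma unit_mult: "unit x \<Longrightarrow> unit y \<Longrightarrow> unit (x * y)"
  by (auto simp: unit_def mult_mem)

lemma unit_inverse: "unit x \<Longrightarrow> unit (inverse x)"
  by (auto simp: unit_def)

lemma unit_2: "unit 2" unfolding unit_def using half_mem by simp

lemma unit_1 [simp]: "unit 1" by (simp add: unit_def)

lemma unit_uminus: "unit x \<Longrightarrow> unit (- x)"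
  by (auto simp: unit_def)

lemma not_unit_iff: "x \<in> R \<Longrightarrow> \<not> unit x \<longleftrightarrow> (\<exists>y\<in>R. x = \<pi> * y)"
proof
  assume "x \<in> R" "\<not> unit x"
  then show "\<exists>y\<in>R. x = \<pi> * y" using nonunit_dvd[of x] unfolding unit_def by blast
next
  assume "\<exists>y\<in>R. x = \<pi> * y"
  then obtain y where y: "y \<in> R" "x = \<pi> * y" by blast
  show "\<not> unit x"
  proof
    assume u: "unit x"
    then have "\<pi> * (y * inverse x) = 1" using y unit_nonzero[OF u] by (metis mult.assoc right_inverse)
    then show False using \<pi>_not_unit mult_mem[OF y(1) unit_inverse_mem[OF u]] by blast
  qed
qed

lemma nonunit_add: "x \<in> R \<Longrightarrow> y \<in> R \<Longrightarrow> \<not> unit x \<Longrightarrow> \<not> unit y \<Longrightarrow> \<not> unit (x + y)"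
proof -
  assume xy: "x \<in> R" "y \<in> R" "\<not> unit x" "\<not> unit y"
  then obtain a b where ab: "a \<in> R" "b \<in> R" "x = \<pi> * a" "y = \<pi> * b" using not_unit_iff by metis
  then have "x + y = \<pi> * (a + b)" by (simp add: distrib_left)
  then show ?thesis using not_unit_iff[OF add_mem[OF xy(1,2)]] add_mem[OF ab(1,2)] by blast
qed

lemma unit_add_nonunit: "unit x \<Longrightarrow> y \<in> R \<Longrightarrow> \<not> unit y \<Longrightarrow> unit (x + y)"
proof (rule ccontr)
  assume x: "unit x" "y \<in> R" "\<not> unit y" "\<not> unit (x + y)"
  have "\<not> unit (- y)" using x(3) unit_uminus by fastforce
  then have "\<not> unit ((x + y) + - y)"
    by (rule nonunit_add[rotated -1]) (use x in \<open>auto intro: add_mem uminus_mem\<close>)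
  then show False using x(1) by simp
qed

lemma unit_add_pi: "unit x \<Longrightarrow> y \<in> R \<Longrightarrow> unit (x + \<pi> * y)"
  by (rule unit_add_nonunit) (auto simp: not_unit_iff mult_mem)

lemma ex_norm_unit: "unit u \<Longrightarrow> \<sigma> u = u \<Longrightarrow> \<exists>a. unit a \<and> a * \<sigma> a = u"
  using ex_norm unfolding unit_def by blast

text \<open>A surplus factor \<open>\<pi>\<close> on one side would divide a unit.\<close>

lemma unit_powi_eq:
  assumes "unit u" "unit v" "\<pi> powi m * u = \<pi> powi n * v"
  shows "m = n"
proof -
  have *: "m \<ge> n" if uv: "unit u" "unit v" "\<pi> powi m * u = \<pi> powi n * v" for m n u v
  proof (rule ccontr)
    assume "\<not> m \<ge> n"
    define k where "k = nat (n - m - 1)"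
    have n: "n = m + 1 + int k" using \<open>\<not> m \<ge> n\<close> by (simp add: k_def)
    have "\<pi> powi m * u = \<pi> powi m * (\<pi> * (\<pi> ^ k * v))"
      using uv(3) by (simp add: n power_int_add)
    then have "u = \<pi> * (\<pi> ^ k * v)" by simp
    moreover have "\<pi> ^ k * v \<in> R" using uv by (intro mult_mem power_mem) auto
    ultimately show False using uv(1) not_unit_iff unit_mem by blast
  qed
  show ?thesis using *[OF assms] *[OF assms(2,1) assms(3)[symmetric]] by simp
qed

end

text \<open>Form and involution live on a whole type and only the lattice is a set of vectors, so
  passing to an orthogonal complement changes nothing but that set.\<close>

locale herm_space = unramified_quadratic R \<pi> \<sigma> for R :: "'a::field_char_0 set" and \<pi> \<sigma> +
  fixes scale :: "'a \<Rightarrow> 'v::ab_group_add \<Rightarrow> 'v" (infixr "*s" 75)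
    and B :: "'v \<Rightarrow> 'v \<Rightarrow> 'a" and Y :: "'v \<Rightarrow> 'v"
  assumes scale_add_right: "a *s (u + v) = a *s u + a *s v"
    and scale_add_left: "(a + b) *s v = a *s v + b *s v"
    and scale_scale: "a *s b *s v = (a * b) *s v"
    and scale_one [simp]: "1 *s v = v"
    and B_add_left: "B (u + v) w = B u w + B v w"
    and B_scale_left: "B (a *s v) w = a * B v w"
    and B_sym: "B v w = \<sigma> (B w v)"
    and Y_add: "Y (u + v) = Y u + Y v"
    and Y_scale: "Y (a *s v) = a *s Y v"
    and Y_Y: "Y (Y v) = v"
    and Y_adj: "B (Y u) v = B u (Y v)"
begin

declare add_mem [rule del] uminus_mem [rule del] mult_mem [rule del] diff_mem [rule del]
  sum_mem [rule del] prod_mem [rule del] power_mem [rule del] \<sigma>_mem [rule del]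

lemma scale_zero_left [simp]: "0 *s v = 0"
  using scale_add_left[of 0 0 v] by simp

lemma scale_zero_right [simp]: "a *s 0 = 0"
  using scale_add_right[of a 0 0] by simp

lemma scale_minus_left: "(- a) *s v = - (a *s v)"
  using scale_add_left[of a "-a" v] by (simp add: eq_neg_iff_add_eq_0 add.commute)

lemma scale_minus_right: "a *s (- v) = - (a *s v)"
  using scale_add_right[of a v "-v"] by (simp add: eq_neg_iff_add_eq_0 add.commute)

lemma Y_zero [simp]: "Y 0 = 0"
  using Y_scale[of 0 0] by simp

lemma Y_minus: "Y (- v) = - Y v"
  using Y_add[of v "- v"] by (simp add: eq_neg_iff_add_eq_0 add.commute)

lemma Y_diff: "Y (u - v) = Y u - Y v"
  using Y_add[of u "-v"] by (simp add: Y_minus)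

lemma B_add_right: "B w (u + v) = B w u + B w v"
  using B_sym[of w "u + v"] B_sym[of w u] B_sym[of w v] by (simp add: B_add_left)

lemma B_scale_right: "B w (a *s v) = \<sigma> a * B w v"
  using B_sym[of w "a *s v"] B_sym[of w v] by (simp add: B_scale_left)

lemma B_zero_left [simp]: "B 0 v = 0"
  using B_add_left[of 0 0 v] by simp

lemma B_zero_right [simp]: "B v 0 = 0"
  using B_add_right[of v 0 0] by simp

lemma B_minus_left: "B (- u) v = - B u v"
  using B_add_left[of u "-u" v] by (simp add: eq_neg_iff_add_eq_0 add.commute)

lemma B_diff_left: "B (u - v) w = B u w - B v w"
  using B_add_left[of u "-v" w] by (simp add: B_minus_left)

lemma B_sum_left: "B (sum f A) w = (\<Sum>i\<in>A. B (f i) w)"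
  by (induction A rule: infinite_finite_induct) (auto simp: B_add_left)

lemma B_sum_right: "B w (sum f A) = (\<Sum>i\<in>A. B w (f i))"
  by (induction A rule: infinite_finite_induct) (auto simp: B_add_right)

lemma B_Y_Y: "B (Y u) (Y v) = B u v"
  by (simp add: Y_adj Y_Y)

lemma B_eq_0_sym: "B v w = 0 \<longleftrightarrow> B w v = 0"
  by (metis B_sym \<sigma>_eq_0_iff)

lemma B_self_fixed: "\<sigma> (B v v) = B v v"
  by (rule B_sym[symmetric])

section \<open>Self-dual lattices, vectors of unit norm and eigenvectors\<close>

definition submod :: "'v set \<Rightarrow> bool" where
  "submod M \<longleftrightarrow> 0 \<in> M \<and> (\<forall>u\<in>M. \<forall>v\<in>M. u + v \<in> M) \<and> (\<forall>a\<in>R. \<forall>v\<in>M. a *s v \<in> M)"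

text \<open>The second and the third of these conditions say that \<open>M\<close> is a self-dual lattice,
  the fourth that its image under \<open>Y\<close> is commensurable with it.\<close>

definition lattice :: "'v set \<Rightarrow> bool" where
  "lattice M \<longleftrightarrow> submod M \<and> (\<forall>u\<in>M. \<forall>v\<in>M. B u v \<in> R) \<and>
     (\<forall>v. (\<exists>r. (\<pi> ^ r) *s v \<in> M) \<longrightarrow> (\<forall>w\<in>M. B v w \<in> R) \<longrightarrow> v \<in> M) \<and>
     (\<exists>r. \<forall>v\<in>M. (\<pi> ^ r) *s Y v \<in> M) \<and>
     (\<forall>v\<in>M. (\<forall>r. \<exists>w\<in>M. v = (\<pi> ^ r) *s w) \<longrightarrow> v = 0)"

lemma latticeD:
  assumes "lattice M"
  shows "0 \<in> M" "u \<in> M \<Longrightarrow> v \<in> M \<Longrightarrow> u + v \<in> M" "a \<in> R \<Longrightarrow> v \<in> M \<Longrightarrow> a *s v \<in> M"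
    "u \<in> M \<Longrightarrow> v \<in> M \<Longrightarrow> B u v \<in> R"
    "(\<pi> ^ r) *s v \<in> M \<Longrightarrow> (\<And>w. w \<in> M \<Longrightarrow> B v w \<in> R) \<Longrightarrow> v \<in> M"
    "\<exists>r. \<forall>v\<in>M. (\<pi> ^ r) *s Y v \<in> M"
    "v \<in> M \<Longrightarrow> (\<And>r. \<exists>w\<in>M. v = (\<pi> ^ r) *s w) \<Longrightarrow> v = 0"
proof -
  note M = assms[unfolded lattice_def submod_def]
  show "0 \<in> M" using M by (elim conjE)
  show "u \<in> M \<Longrightarrow> v \<in> M \<Longrightarrow> u + v \<in> M" using M by (elim conjE) (drule (1) bspec)+
  show "a \<in> R \<Longrightarrow> v \<in> M \<Longrightarrow> a *s v \<in> M" using M by (elim conjE) simp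
  show "u \<in> M \<Longrightarrow> v \<in> M \<Longrightarrow> B u v \<in> R" using M by (elim conjE) simp
  have sd: "\<forall>v. (\<exists>r. (\<pi> ^ r) *s v \<in> M) \<longrightarrow> (\<forall>w\<in>M. B v w \<in> R) \<longrightarrow> v \<in> M" using M by (elim conjE)
  show "(\<pi> ^ r) *s v \<in> M \<Longrightarrow> (\<And>w. w \<in> M \<Longrightarrow> B v w \<in> R) \<Longrightarrow> v \<in> M"
    by (rule sd[THEN spec, THEN mp, THEN mp, OF exI ballI])
  show "\<exists>r. \<forall>v\<in>M. (\<pi> ^ r) *s Y v \<in> M" using M by (elim conjE)
  show "v \<in> M \<Longrightarrow> (\<And>r. \<exists>w\<in>M. v = (\<pi> ^ r) *s w) \<Longrightarrow> v = 0" using M by (elim conjE) simp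
qed

lemma lattice_uminus: "lattice M \<Longrightarrow> v \<in> M \<Longrightarrow> - v \<in> M"
  using latticeD(3)[of M "-1" v] scale_minus_left[of 1 v] by (simp add: uminus_mem)

lemma lattice_diff: "lattice M \<Longrightarrow> u \<in> M \<Longrightarrow> v \<in> M \<Longrightarrow> u - v \<in> M"
  using latticeD(2)[of M u "-v"] lattice_uminus[of M v] by simp

lemma lattice_sum: "lattice M \<Longrightarrow> (\<And>i. i \<in> A \<Longrightarrow> f i \<in> M) \<Longrightarrow> sum f A \<in> M"
  by (induction A rule: infinite_finite_induct) (auto simp: latticeD(1,2))

text \<open>For \<open>v = u + a *s w\<close> the cross terms contribute 2, a unit;
  \<open>h u u\<close> and \<open>h w w\<close> are non-units if the claim fails, and cannot spoil
  it. The form \<open>h\<close> is left open because the lemma serves both \<open>B\<close> and its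
  twist by \<open>\<pi> ^ m\<close> and \<open>Y\<close>.\<close>

lemma polarize:
  assumes M: "lattice M"
    and h: "\<And>u v w. h (u + v) w = h u w + h v w" "\<And>a v w. h (a *s v) w = a * h v w"
      "\<And>v w. h v w = \<sigma> (h w v)" "\<And>u v. u \<in> M \<Longrightarrow> v \<in> M \<Longrightarrow> h u v \<in> R"
    and uw: "u \<in> M" "w \<in> M" "unit (h u w)"
  shows "\<exists>v\<in>M. unit (h v v)"
proof (rule ccontr)
  assume neg: "\<not> (\<exists>v\<in>M. unit (h v v))"
  have hr: "h w (u + v) = h w u + h w v" "h w (a *s v) = \<sigma> a * h w v" for u v w a
    using h(1)[of u v w] h(2)[of a v w] h(3)[of w "u + v"] h(3)[of w "a *s v"] h(3)[of w u] h(3)[of w v] by simp_all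
  \<comment> \<open>Makes both cross terms equal to 1.\<close>
  define a where "a = \<sigma> (inverse (h u w))"
  have hu0: "h u w \<noteq> 0" using uw(3) unit_nonzero by blast
  have aR: "a \<in> R" unfolding a_def using uw(3) by (intro \<sigma>_mem unit_inverse_mem)
  define v where "v = u + a *s w"
  have vM: "v \<in> M" unfolding v_def by (intro latticeD(2,3)[OF M] uw aR)
  have "h v v = 2 + (h u u + a * \<sigma> a * h w w)"
  proof -
    have "\<sigma> a * h u w = 1" using hu0 by (simp add: a_def)
    moreover have "a * h w u = 1" using hu0 h(3)[of w u] by (simp add: a_def)
    ultimately show ?thesis by (simp add: v_def h(1,2) hr algebra_simps)
  qed
  moreover have "\<not> unit (a * \<sigma> a * h w w)"
  proof -
    have "h w w \<in> R" "\<not> unit (h w w)" using h(4)[OF uw(2,2)] neg uw by blast+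
    then obtain y where y: "y \<in> R" "h w w = \<pi> * y" using not_unit_iff by blast
    have "a * \<sigma> a * h w w = \<pi> * (a * \<sigma> a * y)" by (simp add: y(2))
    moreover have "a * \<sigma> a * y \<in> R" by (intro mult_mem aR \<sigma>_mem y)
    ultimately show ?thesis using not_unit_iff[of "a * \<sigma> a * h w w"] mult_mem[OF \<pi>_mem] by metis
  qed
  moreover have "h u u \<in> R" "\<not> unit (h u u)" "a * \<sigma> a * h w w \<in> R"
    using neg uw h(4) aR by (auto intro!: mult_mem)
  ultimately have "unit (h v v)"
    using unit_add_nonunit[OF unit_2, of "h u u + a * \<sigma> a * h w w"] nonunit_add by (simp add: add_mem)
  then show False using neg vM by blast
qed

text \<open>If \<open>B\<close> took only non-unit values on \<open>M\<close>, self-duality would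
  put \<open>inverse \<pi> *s v\<close> into \<open>M\<close> for every \<open>v\<close>; then every
  vector of \<open>M\<close> would be infinitely divisible by \<open>\<pi>\<close>, hence
  zero.\<close>

lemma ex_unit_norm_vector:
  assumes M: "lattice M" and "M \<noteq> {0}"
  shows "\<exists>v\<in>M. unit (B v v)"
proof -
  obtain u where u: "u \<in> M" "u \<noteq> 0" using assms latticeD(1)[OF M] by auto
  have "\<exists>v\<in>M. \<exists>w\<in>M. unit (B v w)"
  proof (rule ccontr)
    assume neg: "\<not> ?thesis"
    have "\<exists>w\<in>M. v = \<pi> *s w" if v: "v \<in> M" for v
    proof
      show "v = \<pi> *s inverse \<pi> *s v" by (simp add: scale_scale)
      show "inverse \<pi> *s v \<in> M"
      proof (rule latticeD(5)[OF M, of 1])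
        show "(\<pi> ^ 1) *s inverse \<pi> *s v \<in> M" using v by (simp add: scale_scale)
        fix w assume w: "w \<in> M"
        then have "B v w \<in> R" "\<not> unit (B v w)" using latticeD(4)[OF M v w] neg v by blast+
        then obtain y where "y \<in> R" "B v w = \<pi> * y" using not_unit_iff by blast
        then show "B (inverse \<pi> *s v) w \<in> R" by (simp add: B_scale_left mult.assoc[symmetric])
      qed
    qed
    then obtain f where f: "\<And>v. v \<in> M \<Longrightarrow> f v \<in> M" "\<And>v. v \<in> M \<Longrightarrow> v = \<pi> *s f v" by metis
    have "\<exists>w\<in>M. u = (\<pi> ^ r) *s w" for r
    proof (induction r)
      case 0
      show ?case using u by auto
    next
      case (Suc r)
      then obtain w where w: "w \<in> M" "u = (\<pi> ^ r) *s w" by blast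
      then have "u = (\<pi> ^ Suc r) *s f w" using f(2)[OF w(1)] by (metis scale_scale power_Suc2)
      then show ?case using f(1) w by blast
    qed
    then show False using latticeD(7)[OF M u(1)] u(2) by blast
  qed
  then obtain v w where "v \<in> M" "w \<in> M" "unit (B v w)" by blast
  then show ?thesis
    using polarize[OF M, of B v w] B_add_left B_scale_left B_sym latticeD(4)[OF M] by blast
qed

text \<open>The halves of \<open>v + Y v\<close> and \<open>v - Y v\<close> are in the lattice and
  orthogonal, so their norms add up to the unit \<open>B v v\<close> and one of them is a unit. This
  unit is a norm, so the vector can be scaled to norm 1.\<close>

lemma ex_eigenvector:
  assumes M: "lattice M" and ne: "M \<noteq> {0}" and YM: "\<And>v. v \<in> M \<Longrightarrow> Y v \<in> M"
  shows "\<exists>e\<in>M. \<exists>c. (c = 1 \<or> c = -1) \<and> Y e = c *s e \<and> B e e = 1"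
proof -
  obtain v where v: "v \<in> M" "unit (B v v)" using ex_unit_norm_vector[OF M ne] by blast
  define e1 where "e1 = inverse 2 *s (v + Y v)"
  define e2 where "e2 = inverse 2 *s (v - Y v)"
  have eM: "e1 \<in> M" "e2 \<in> M" unfolding e1_def e2_def
    by (rule latticeD(3)[OF M half_mem latticeD(2)[OF M v(1) YM[OF v(1)]]],
        rule latticeD(3)[OF M half_mem lattice_diff[OF M v(1) YM[OF v(1)]]])
  have Ye: "Y e1 = 1 *s e1" by (simp add: e1_def Y_scale Y_add Y_Y add.commute)
  have Ye': "Y e2 = (-1) *s e2"
  proof -
    have "Y e2 = inverse 2 *s - (v - Y v)" by (simp add: e2_def Y_scale Y_diff Y_Y)
    then show ?thesis by (simp only: e2_def scale_minus_right scale_minus_left scale_one)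
  qed
  have vsum: "v = e1 + e2"
  proof -
    have "e1 + e2 = inverse 2 *s (v + v)" by (simp add: e1_def e2_def scale_add_right[symmetric])
    also have "v + v = 2 *s v" using scale_add_left[of 1 1 v] by simp
    also have "inverse 2 *s 2 *s v = (inverse 2 * 2) *s v" by (rule scale_scale)
    finally show ?thesis by simp
  qed
  have "B e1 e2 = - B e1 e2"
    using B_Y_Y[of e1 e2] by (simp add: Ye Ye' B_scale_left B_scale_right)
  then have "B e1 e2 = 0" by (simp add: eq_neg_iff_add_eq_0 flip: mult_2)
  then have "B v v = B e1 e1 + B e2 e2"
    using B_eq_0_sym[of e1 e2] by (simp add: vsum B_add_left B_add_right)
  then have "unit (B e1 e1) \<or> unit (B e2 e2)"
    using v(2) nonunit_add latticeD(4)[OF M] eM by metis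
  then obtain e c where e: "e \<in> M" "c = 1 \<or> c = -1" "Y e = c *s e" "unit (B e e)" using eM Ye Ye' by metis
  obtain a where a: "unit a" "a * \<sigma> a = B e e" using ex_norm_unit[OF e(4) B_self_fixed] by blast
  define e' where "e' = inverse a *s e"
  have "e' \<in> M" unfolding e'_def by (intro latticeD(3)[OF M] unit_inverse_mem a e)
  moreover have "Y e' = c *s e'" by (simp add: e'_def Y_scale e scale_scale mult.commute)
  moreover have "B e' e' = 1"
    using unit_nonzero[OF a(1)] a(2)[symmetric] by (simp add: e'_def B_scale_left B_scale_right field_simps)
  ultimately show ?thesis using e(2) by blast
qed

end

context herm_space
begin

text \<open>For the least \<open>m > 0\<close> with \<open>\<pi>\<^sup>m Y M \<subseteq> M\<close> some \<open>v\<close> in \<open>M\<close> satisfies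
  \<open>B (\<pi>\<^sup>m Y v) v = unit\<close>. Then \<open>v\<close> and \<open>\<pi>\<^sup>m Y v\<close> span a unimodular \<open>Y\<close>-stable plane, and
  Hensel's lemma moves \<open>v\<close> to an isotropic vector of that plane.\<close>

lemma ex_hyperbolic_plane:
  assumes M: "lattice M" and m: "m \<ge> 1"
    and mM: "\<And>v. v \<in> M \<Longrightarrow> (\<pi> ^ m) *s Y v \<in> M"
    and least: "\<not> (\<forall>v\<in>M. (\<pi> ^ (m - 1)) *s Y v \<in> M)"
  shows "\<exists>v\<in>M. \<exists>w\<in>M. B v v = 0 \<and> B w w = 0 \<and> B v w = 1 \<and>
    Y v = (\<pi> powi (- int m)) *s w \<and> Y w = (\<pi> powi int m) *s v"
proof -
  \<comment> \<open>Hermitian because \<open>Y\<close> is self-adjoint, integral by the choice of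
    \<open>m\<close>, and with a unit value by its minimality.\<close>
  define h where "h u v = \<pi> ^ m * B (Y u) v" for u v
  define P where "P = \<pi> ^ m * \<pi> ^ m"
  have h_rules: "h (u + v) w = h u w + h v w" "h (a *s v) w = a * h v w" for u v w a
    by (simp_all add: h_def Y_add Y_scale B_add_left B_scale_left algebra_simps)
  have h_sym: "h v w = \<sigma> (h w v)" for v w
    using B_sym[of "Y v" w] by (simp add: h_def Y_adj)
  have h_scale_right: "h w (a *s v) = \<sigma> a * h w v" for a v w
    by (simp add: h_def B_scale_right)
  have h_add_right: "h w (u + v) = h w u + h w v" for u v w
    by (simp add: h_def B_add_right algebra_simps)
  have h_eq: "h u v = B ((\<pi> ^ m) *s Y u) v" for u v by (simp add: h_def B_scale_left)
  have hR: "h u v \<in> R" if "u \<in> M" "v \<in> M" for u v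
    unfolding h_eq using latticeD(4)[OF M mM[OF that(1)] that(2)] .
  have \<pi>m: "\<pi> ^ m = \<pi> * \<pi> ^ (m - 1)" using m by (cases m) auto
  obtain v0 where v0: "v0 \<in> M" "(\<pi> ^ (m - 1)) *s Y v0 \<notin> M" using least by blast
  \<comment> \<open>A non-integral value exists by self-duality; its product with
    \<open>\<pi>\<close> is a value of \<open>h\<close>, integral and therefore a unit.\<close>
  have "\<exists>w\<in>M. B ((\<pi> ^ (m - 1)) *s Y v0) w \<notin> R"
  proof (rule ccontr)
    assume "\<not> ?thesis"
    then have "B ((\<pi> ^ (m - 1)) *s Y v0) w \<in> R" if "w \<in> M" for w using that by blast
    moreover have "(\<pi> ^ 1) *s (\<pi> ^ (m - 1)) *s Y v0 \<in> M"
      using mM[OF v0(1)] by (simp add: scale_scale \<pi>m)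
    ultimately show False using latticeD(5)[OF M] v0(2) by blast
  qed
  then obtain w0 where w0: "w0 \<in> M" "\<pi> ^ (m - 1) * B (Y v0) w0 \<notin> R" by (auto simp: B_scale_left)
  have "unit (h v0 w0)"
  proof (rule ccontr)
    assume "\<not> unit (h v0 w0)"
    then obtain y where y: "y \<in> R" "h v0 w0 = \<pi> * y" using not_unit_iff[OF hR[OF v0(1) w0(1)]] by blast
    then have "\<pi> * (\<pi> ^ (m - 1) * B (Y v0) w0) = \<pi> * y" by (simp add: h_def \<pi>m)
    then show False using y w0(2) by simp
  qed
  then obtain v where v: "v \<in> M" "unit (h v v)"
    using polarize[OF M, of h v0 w0] h_rules h_sym hR v0(1) w0(1) by blast
  define c where "c = h v v"
  define b where "b = B v v"
  define w where "w = (\<pi> ^ m) *s Y v"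
  have cu: "unit c" using v(2) by (simp add: c_def)
  have c0: "c \<noteq> 0" using cu unit_nonzero by blast
  have \<sigma>c: "\<sigma> c = c" unfolding c_def by (rule h_sym[symmetric])
  have \<sigma>b: "\<sigma> b = b" unfolding b_def by (rule B_self_fixed)
  have bR: "b \<in> R" unfolding b_def by (rule latticeD(4)[OF M v(1) v(1)])
  have wM: "w \<in> M" unfolding w_def by (rule mM[OF v(1)])
  have Yw: "Y w = (\<pi> ^ m) *s v" by (simp add: w_def Y_scale Y_Y)
  have Bwv: "B w v = c" by (simp add: w_def c_def h_def B_scale_left)
  have Bvw: "B v w = c" using B_sym[of v w] by (simp add: Bwv \<sigma>c)
  have Bww: "B w w = P * b" by (simp add: w_def B_scale_left B_scale_right B_Y_Y b_def P_def)
  have hvw: "h v w = P * b"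
    by (simp add: h_def w_def B_scale_right B_Y_Y b_def P_def)
  have hwv: "h w v = P * b" using h_sym[of w v] by (simp add: hvw P_def \<sigma>b)
  have hww: "h w w = P * c" by (simp add: h_def Yw B_scale_left Bvw P_def)
  define k where "k = m - 1"
  have Pk: "P = \<pi> * (\<pi> ^ k * \<pi> ^ m)" using m by (simp add: P_def \<pi>m k_def)
  \<comment> \<open>The vector \<open>v + t *s w\<close> is isotropic if
    \<open>b + 2 * t * c + t * t * P * b = 0\<close>. Up to the factor \<open>4 * c * c\<close> the
    discriminant is \<open>1 - P * b * b / (c * c)\<close>, and \<open>m \<ge> 1\<close> makes it
    congruent to 1, so that its root \<open>s\<close> exists.\<close>
  define z where "z = - (\<pi> ^ k * \<pi> ^ m * b * b * inverse c * inverse c)"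
  have zR: "z \<in> R" unfolding z_def
    by (intro uminus_mem mult_mem power_mem \<pi>_mem bR unit_inverse_mem cu)
  have \<sigma>z: "\<sigma> z = z" by (simp add: z_def \<sigma>b \<sigma>c)
  obtain s w1 where s: "s \<in> R" "\<sigma> s = s" "s * s = 1 + \<pi> * z" "w1 \<in> R" "s = 1 + \<pi> * w1"
    using ex_fixed_sqrt[OF zR \<sigma>z] by blast
  have s1u: "unit (1 + s)"
    using unit_add_pi[OF unit_2 s(4)] s(5) by (simp add: add.assoc[symmetric])
  have s1: "1 + s \<noteq> 0" using unit_nonzero[OF s1u] .
  define q where "q = c * (1 + s)"
  have q0: "q \<noteq> 0" using c0 s1 by (simp add: q_def)
  \<comment> \<open>The integral root of the quadratic equation, in the form that avoids dividing by
    \<open>P * b\<close>, which is not a unit and may vanish.\<close>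
  define t where "t = - b * inverse q"
  have tR: "t \<in> R" unfolding t_def q_def by (intro mult_mem uminus_mem bR unit_inverse_mem unit_mult cu s1u)
  have \<sigma>t: "\<sigma> t = t" by (simp add: t_def q_def \<sigma>b \<sigma>c s(2))
  have quad: "b + 2 * t * c + t * t * P * b = 0"
  proof -
    have "s * s = 1 - P * b * b * inverse c * inverse c" by (simp add: s(3) z_def Pk algebra_simps)
    then have Pb: "P * b * b = c * c * (1 - s * s)" using c0 by (simp add: field_simps)
    have "(b + 2 * t * c + t * t * P * b) * (q * q) = b * (q * q - 2 * c * q + P * b * b)"
      using q0 by (simp add: t_def field_simps)
    also have "q * q - 2 * c * q + P * b * b = 0"
      unfolding Pb by (simp add: q_def algebra_simps)
    finally show ?thesis using q0 by simp
  qed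
  define v' where "v' = v + t *s w"
  define w' where "w' = (\<pi> ^ m) *s Y v'"
  have v'M: "v' \<in> M" unfolding v'_def by (intro latticeD(2,3)[OF M] v(1) wM tR)
  have w'M: "w' \<in> M" unfolding w'_def by (rule mM[OF v'M])
  have Bv': "B v' v' = 0"
  proof -
    have "B v' v' = b + 2 * t * c + t * t * P * b"
      by (simp add: v'_def B_add_left B_add_right B_scale_left B_scale_right Bvw Bwv Bww \<sigma>t b_def[symmetric] algebra_simps)
    then show ?thesis using quad by simp
  qed
  have Bw': "B w' w' = 0" by (simp add: w'_def B_scale_left B_scale_right B_Y_Y Bv')
  define c' where "c' = h v' v'"
  \<comment> \<open>The corrections carry the factor \<open>P\<close>, so the value of
    \<open>h\<close> at the isotropic vector remains a unit.\<close>
  have c'_eq: "c' = c + \<pi> * (\<pi> ^ k * \<pi> ^ m * (2 * t * b + t * t * c))"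
  proof -
    have "c' = c + 2 * t * (P * b) + t * t * (P * c)"
      by (simp add: c'_def v'_def h_rules h_scale_right h_add_right hvw hwv hww \<sigma>t c_def[symmetric] algebra_simps)
    then show ?thesis by (simp add: Pk algebra_simps)
  qed
  have c'u: "unit c'" unfolding c'_eq
    by (intro unit_add_pi cu mult_mem power_mem \<pi>_mem add_mem tR bR unit_mem[OF cu] numeral_mem)
  have \<sigma>c': "\<sigma> c' = c'" unfolding c'_def by (rule h_sym[symmetric])
  obtain a where a: "unit a" "a * \<sigma> a = c'" using ex_norm_unit[OF c'u \<sigma>c'] by blast
  have a0: "a \<noteq> 0" using unit_nonzero[OF a(1)] .
  define v'' where "v'' = inverse a *s v'"
  define w'' where "w'' = inverse a *s w'"
  have "B w' v' = c'" by (simp add: w'_def B_scale_left c'_def h_def)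
  then have "B v' w' = a * \<sigma> a" using B_sym[of v' w'] \<sigma>c' a(2) by simp
  then have "B v'' w'' = 1" using a0 by (simp add: v''_def w''_def B_scale_left B_scale_right field_simps)
  moreover have "B v'' v'' = 0" "B w'' w'' = 0"
    by (simp_all add: v''_def w''_def B_scale_left B_scale_right Bv' Bw')
  moreover have "v'' \<in> M" "w'' \<in> M"
    unfolding v''_def w''_def by (intro latticeD(3)[OF M] unit_inverse_mem a v'M w'M)+
  moreover have "Y v'' = (\<pi> powi (- int m)) *s w''"
    by (simp add: v''_def w''_def w'_def Y_scale scale_scale power_int_minus field_simps)
  moreover have "Y w'' = (\<pi> powi int m) *s v''"
    by (simp add: v''_def w''_def w'_def Y_scale scale_scale Y_Y mult.commute)
  ultimately show ?thesis by blast
qed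

text \<open>A Witt-type basis: \<open>\<tau>\<close> exchanges the two vectors of a hyperbolic plane and fixes the vectors
  that are eigenvectors of \<open>Y\<close>.\<close>

definition witt_system :: "'v set \<Rightarrow> nat \<Rightarrow> (nat \<Rightarrow> 'v) \<Rightarrow> (nat \<Rightarrow> nat) \<Rightarrow> (nat \<Rightarrow> 'a) \<Rightarrow> bool" where
  "witt_system M r g \<tau> c \<longleftrightarrow>
     (\<forall>i<r. g i \<in> M \<and> \<tau> i < r \<and> \<tau> (\<tau> i) = i \<and> Y (g i) = c i *s g (\<tau> i) \<and>
        (\<tau> i = i \<longrightarrow> c i = 1 \<or> c i = -1) \<and> (\<tau> i \<noteq> i \<longrightarrow> (\<exists>z. c i = \<pi> powi z))) \<and>
     (\<forall>i<r. \<forall>j<r. B (g i) (g j) = (if j = \<tau> i then 1 else 0))"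

lemma witt_systemD:
  assumes "witt_system M r g \<tau> c" "i < r"
  shows "g i \<in> M" "\<tau> i < r" "\<tau> (\<tau> i) = i" "Y (g i) = c i *s g (\<tau> i)"
    "\<tau> i = i \<Longrightarrow> c i = 1 \<or> c i = -1" "\<tau> i \<noteq> i \<Longrightarrow> \<exists>z. c i = \<pi> powi z"
    "j < r \<Longrightarrow> B (g i) (g j) = (if j = \<tau> i then 1 else 0)"
  using assms unfolding witt_system_def by simp_all

text \<open>Compares \<open>Y (Y (g i))\<close> with \<open>g i\<close>; this will make the
  exponents of a pair opposite.\<close>

lemma witt_system_c_mult: "witt_system M r g \<tau> c \<Longrightarrow> i < r \<Longrightarrow> c i * c (\<tau> i) = 1"
proof -
  assume W: "witt_system M r g \<tau> c" "i < r"
  note D = witt_systemD[OF W] witt_systemD[OF W(1) witt_systemD(2)[OF W]]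
  have "Y (Y (g i)) = (c i * c (\<tau> i)) *s g i" by (simp add: D Y_scale scale_scale)
  then have "g i = (c i * c (\<tau> i)) *s g i" by (simp add: Y_Y)
  then have "B (g i) (g (\<tau> i)) = c i * c (\<tau> i) * B (g i) (g (\<tau> i))" by (metis B_scale_left)
  then show ?thesis using D(7)[of "\<tau> i"] D(2) by simp
qed

definition complement :: "'v set \<Rightarrow> nat \<Rightarrow> (nat \<Rightarrow> 'v) \<Rightarrow> 'v set" where
  "complement M r g = {v \<in> M. \<forall>i<r. B v (g i) = 0}"

text \<open>\<open>g (\<tau> i)\<close> is dual to \<open>g i\<close>, so
  \<open>B v (g (\<tau> i))\<close> is the coefficient of \<open>v\<close> at
  \<open>g i\<close>.\<close>

lemma witt_projection:
  assumes M: "lattice M" and W: "witt_system M r g \<tau> c" and v: "v \<in> M"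
  shows "v - (\<Sum>i<r. B v (g (\<tau> i)) *s g i) \<in> complement M r g"
proof -
  note D = witt_systemD[OF W]
  have "(\<Sum>i<r. B v (g (\<tau> i)) *s g i) \<in> M"
    by (intro lattice_sum[OF M] latticeD(3,4)[OF M] v D) (auto intro!: D)
  then have "v - (\<Sum>i<r. B v (g (\<tau> i)) *s g i) \<in> M" by (rule lattice_diff[OF M v])
  moreover have "B (v - (\<Sum>i<r. B v (g (\<tau> i)) *s g i)) (g j) = 0" if j: "j < r" for j
  proof -
    have "(\<Sum>i<r. B v (g (\<tau> i)) * B (g i) (g j)) = (\<Sum>i<r. if i = \<tau> j then B v (g j) else 0)"
    proof (rule sum.cong[OF refl])
      fix i assume "i \<in> {..<r}"
      then have i: "i < r" by simp
      have "j = \<tau> i \<longleftrightarrow> i = \<tau> j" using D(3)[OF i] D(3)[OF j] by metis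
      then show "B v (g (\<tau> i)) * B (g i) (g j) = (if i = \<tau> j then B v (g j) else 0)"
        using D(7)[OF i j] by auto
    qed
    also have "\<dots> = B v (g j)" using D(2)[OF j] by simp
    finally show ?thesis by (simp add: B_diff_left B_sum_left B_scale_left)
  qed
  ultimately show ?thesis by (simp add: complement_def)
qed

text \<open>Self-duality descends because a vector of \<open>M\<close> splits into a part in the
  complement and a part in the span of the system, and the latter pairs to 0 with the complement.
  \<open>Y\<close> maps that span to itself, hence also its orthogonal space.\<close>

lemma lattice_complement:
  assumes M: "lattice M" and W: "witt_system M r g \<tau> c"
  shows "lattice (complement M r g)"
proof -
  note D = witt_systemD[OF W]
  let ?C = "complement M r g"
  have sub: "v \<in> M" if "v \<in> ?C" for v using that by (simp add: complement_def)
  have orth: "B v (g i) = 0" if "v \<in> ?C" "i < r" for v i using that by (simp add: complement_def)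
  have CI: "v \<in> ?C" if "v \<in> M" "\<And>i. i < r \<Longrightarrow> B v (g i) = 0" for v using that by (simp add: complement_def)
  show ?thesis unfolding lattice_def submod_def
  proof (intro conjI ballI allI impI)
    show "0 \<in> ?C" by (rule CI) (simp_all add: latticeD(1)[OF M])
    show "u + v \<in> ?C" if "u \<in> ?C" "v \<in> ?C" for u v
      by (rule CI) (simp_all add: latticeD(2)[OF M sub[OF that(1)] sub[OF that(2)]] B_add_left orth that)
    show "a *s v \<in> ?C" if "a \<in> R" "v \<in> ?C" for a v
      by (rule CI) (simp_all add: latticeD(3)[OF M that(1) sub[OF that(2)]] B_scale_left orth that)
    show "B u v \<in> R" if "u \<in> ?C" "v \<in> ?C" for u v
      by (rule latticeD(4)[OF M sub[OF that(1)] sub[OF that(2)]])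
    show "v = 0" if "v \<in> ?C" "\<forall>r'. \<exists>w\<in>?C. v = (\<pi> ^ r') *s w" for v
      by (rule latticeD(7)[OF M sub[OF that(1)]]) (use that(2) sub in blast)
    show "\<exists>r'. \<forall>v\<in>?C. (\<pi> ^ r') *s Y v \<in> ?C"
    proof -
      obtain r' where r': "\<forall>v\<in>M. (\<pi> ^ r') *s Y v \<in> M" using latticeD(6)[OF M] by blast
      have "(\<pi> ^ r') *s Y v \<in> ?C" if v: "v \<in> ?C" for v
        by (rule CI) (use r' sub[OF v] D in \<open>simp_all add: B_scale_left Y_adj B_scale_right orth[OF v]\<close>)
      then show ?thesis by blast
    qed
    fix v assume ex: "\<exists>r'. (\<pi> ^ r') *s v \<in> ?C" and int: "\<forall>w\<in>?C. B v w \<in> R"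
    obtain r' where r': "(\<pi> ^ r') *s v \<in> ?C" using ex by blast
    have 0: "B v (g i) = 0" if "i < r" for i using orth[OF r' that] by (simp add: B_scale_left)
    have "v \<in> M"
    proof (rule latticeD(5)[OF M sub[OF r']])
      fix w assume w: "w \<in> M"
      define w' where "w' = w - (\<Sum>i<r. B w (g (\<tau> i)) *s g i)"
      have w': "w' \<in> ?C" unfolding w'_def by (rule witt_projection[OF M W w])
      have "w = w' + (\<Sum>i<r. B w (g (\<tau> i)) *s g i)" by (simp add: w'_def)
      then have "B v w = B v w' + (\<Sum>i<r. B v (B w (g (\<tau> i)) *s g i))"
        by (metis B_add_right B_sum_right)
      also have "(\<Sum>i<r. B v (B w (g (\<tau> i)) *s g i)) = 0"
        by (rule sum.neutral) (simp add: B_scale_right 0)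
      finally show "B v w \<in> R" using int w' by simp
    qed
    then show "v \<in> ?C" using 0 by (rule CI)
  qed
qed

text \<open>Both splitting results apply to the complement, which is a lattice of the same kind; the
  new vectors get the indices \<open>r\<close>, or \<open>r\<close> and \<open>Suc r\<close>, and
  are orthogonal to the old ones.\<close>

lemma witt_system_extend:
  assumes M: "lattice M" and W: "witt_system M r g \<tau> c" and ne: "complement M r g \<noteq> {0}"
  shows "\<exists>r' g' \<tau>' c'. witt_system M r' g' \<tau>' c' \<and> r' > r"
proof -
  note D = witt_systemD[OF W]
  let ?C = "complement M r g"
  have C: "lattice ?C" by (rule lattice_complement[OF M W])
  have sub: "v \<in> M" if "v \<in> ?C" for v using that by (simp add: complement_def)
  have orth: "B v (g i) = 0" "B (g i) v = 0" if "v \<in> ?C" "i < r" for v i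
    using that B_eq_0_sym[of v "g i"] by (simp_all add: complement_def)
  \<comment> \<open>The least power of \<open>\<pi>\<close> that clears the denominators of
    \<open>Y\<close> on the complement; \<open>m = 0\<close> is the case in which \<open>Y\<close>
    preserves it.\<close>
  define m where "m = (LEAST m. \<forall>v\<in>?C. (\<pi> ^ m) *s Y v \<in> ?C)"
  have m: "\<forall>v\<in>?C. (\<pi> ^ m) *s Y v \<in> ?C" unfolding m_def by (rule LeastI_ex) (rule latticeD(6)[OF C])
  show ?thesis
  proof (cases "m = 0")
    case True
    then obtain e a where e: "e \<in> ?C" "a = 1 \<or> a = -1" "Y e = a *s e" "B e e = 1"
      using ex_eigenvector[OF C ne] m by auto
    have "witt_system M (Suc r) (g(r := e)) (\<tau>(r := r)) (c(r := a))"
      unfolding witt_system_def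
    proof (intro conjI allI impI)
      fix i assume i: "i < Suc r"
      consider "i < r" | "i = r" using i by linarith
      note cs = this
      show "(g(r := e)) i \<in> M" using cs by cases (use D(1) sub[OF e(1)] in auto)
      show "(\<tau>(r := r)) i < Suc r" using cs by cases (use D(2) in \<open>auto simp: less_SucI\<close>)
      show "(\<tau>(r := r)) ((\<tau>(r := r)) i) = i" using cs by cases (use D(2,3) in \<open>auto dest: less_imp_neq\<close>)
      show "Y ((g(r := e)) i) = (c(r := a)) i *s (g(r := e)) ((\<tau>(r := r)) i)"
        using cs by cases (use D(2)[of i] D(4) e in auto)
      show "(c(r := a)) i = 1 \<or> (c(r := a)) i = - 1" if "(\<tau>(r := r)) i = i"
        using cs by cases (use D(5)[of i] e that in auto)
      show "\<exists>z. (c(r := a)) i = \<pi> powi z" if "(\<tau>(r := r)) i \<noteq> i"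
        using cs by cases (use D(6)[of i] that in auto)
      fix j assume j: "j < Suc r"
      have "i < r \<or> i = r" "j < r \<or> j = r" using i j by auto
      then show "B ((g(r := e)) i) ((g(r := e)) j) = (if j = (\<tau>(r := r)) i then 1 else 0)"
        by (elim disjE; insert D(2)[of i] D(7)[of i j] e(4) orth[OF e(1), of i] orth[OF e(1), of j]; simp)
    qed
    then show ?thesis by blast
  next
    case False
    then have m1: "m \<ge> 1" by simp
    have "\<not> (\<forall>v\<in>?C. (\<pi> ^ (m - 1)) *s Y v \<in> ?C)"
      using not_less_Least[of "m - 1" "\<lambda>m. \<forall>v\<in>?C. (\<pi> ^ m) *s Y v \<in> ?C"] m1 unfolding m_def[symmetric] by linarith
    then obtain v w where vw: "v \<in> ?C" "w \<in> ?C" "B v v = 0" "B w w = 0" "B v w = 1"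
      "Y v = (\<pi> powi (- int m)) *s w" "Y w = (\<pi> powi int m) *s v"
      using ex_hyperbolic_plane[OF C m1] m by blast
    have Bwv: "B w v = 1" using B_sym[of w v] vw by simp
    define g' where "g' = g(r := v, Suc r := w)"
    define \<tau>' where "\<tau>' = \<tau>(r := Suc r, Suc r := r)"
    define c' where "c' = c(r := \<pi> powi (- int m), Suc r := \<pi> powi int m)"
    have g': "g' r = v" "g' (Suc r) = w" "\<And>i. i < r \<Longrightarrow> g' i = g i" by (auto simp: g'_def)
    have \<tau>': "\<tau>' r = Suc r" "\<tau>' (Suc r) = r" "\<And>i. i < r \<Longrightarrow> \<tau>' i = \<tau> i" by (auto simp: \<tau>'_def)
    have c': "c' r = \<pi> powi (- int m)" "c' (Suc r) = \<pi> powi int m" "\<And>i. i < r \<Longrightarrow> c' i = c i" by (auto simp: c'_def)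
    have "witt_system M (Suc (Suc r)) g' \<tau>' c'"
      unfolding witt_system_def
    proof (intro conjI allI impI)
      fix i assume i: "i < Suc (Suc r)"
      consider "i < r" | "i = r" | "i = Suc r" using i by linarith
      note cs = this
      show "g' i \<in> M" using cs by cases (use D(1) sub[OF vw(1)] sub[OF vw(2)] in \<open>auto simp: g'\<close>)
      show "\<tau>' i < Suc (Suc r)" using cs by cases (use D(2)[of i] in \<open>auto simp: \<tau>'\<close>)
      show "\<tau>' (\<tau>' i) = i" using cs by cases (use D(2,3)[of i] in \<open>auto simp: \<tau>'\<close>)
      show "Y (g' i) = c' i *s g' (\<tau>' i)"
        using cs by cases (use D(2)[of i] D(4)[of i] vw in \<open>auto simp: g' \<tau>' c'\<close>)
      show "c' i = 1 \<or> c' i = - 1" if "\<tau>' i = i"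
        using cs by cases (use D(5)[of i] that in \<open>auto simp: \<tau>' c'\<close>)
      show "\<exists>z. c' i = \<pi> powi z" if "\<tau>' i \<noteq> i"
        using cs by cases (use D(6)[of i] that in \<open>auto simp: \<tau>' c' simp del: power_int_of_nat\<close>)
      fix j assume j: "j < Suc (Suc r)"
      have "i < r \<or> i = r \<or> i = Suc r" "j < r \<or> j = r \<or> j = Suc r" using i j by auto
      then show "B (g' i) (g' j) = (if j = \<tau>' i then 1 else 0)"
        by (elim disjE; insert D(2)[of i] D(7)[of i j] vw(3,4,5) Bwv orth[OF vw(1), of i] orth[OF vw(2), of i]
            orth[OF vw(1), of j] orth[OF vw(2), of j]; simp add: g' \<tau>')
    qed
    then show ?thesis by (meson less_Suc_eq)
  qed
qed

text \<open>With \<open>\<iota>\<close> of norm -1 and \<open>a\<close> of norm 2, the sum and the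
  difference of \<open>g i\<close> and \<open>\<iota> *s g j\<close>, divided by \<open>a\<close>,
  are isotropic, pair to 1 and are exchanged by \<open>Y\<close>. They form a plane with exponent 0,
  and two fixed points of \<open>\<tau>\<close> disappear.\<close>

lemma witt_system_pair:
  assumes M: "lattice M" and W: "witt_system M r g \<tau> c"
    and ij: "i < r" "j < r" "\<tau> i = i" "\<tau> j = j" "c i = 1" "c j = -1"
  shows "\<exists>g' \<tau>' c'. witt_system M r g' \<tau>' c' \<and> card {l. l < r \<and> \<tau>' l = l} < card {l. l < r \<and> \<tau> l = l}"
proof -
  note D = witt_systemD[OF W]
  have "i \<noteq> j" using ij(5,6) by auto
  obtain \<iota> where \<iota>: "unit \<iota>" "\<iota> * \<sigma> \<iota> = -1" using ex_norm_unit[of "-1"] unit_uminus[OF unit_1] by auto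
  obtain a where a: "unit a" "a * \<sigma> a = 2" using ex_norm_unit[of 2] unit_2 by auto
  have a0: "a \<noteq> 0" using unit_nonzero[OF a(1)] .
  define v where "v = inverse a *s (g i + \<iota> *s g j)"
  define w where "w = inverse a *s (g i + (- \<iota>) *s g j)"
  have vM: "v \<in> M" "w \<in> M" unfolding v_def w_def
    by (intro latticeD(2,3)[OF M] unit_inverse_mem unit_mem uminus_mem a \<iota> D(1) ij)+
  have Yv: "Y v = w" "Y w = v"
    using D(4)[OF ij(1)] D(4)[OF ij(2)] ij
    by (simp_all add: v_def w_def Y_scale Y_add scale_scale)
  have Bij: "B (g i) (g i) = 1" "B (g j) (g j) = 1" "B (g i) (g j) = 0" "B (g j) (g i) = 0"
    using D(7)[OF ij(1), of i] D(7)[OF ij(2), of j] D(7)[OF ij(1), of j] D(7)[OF ij(2), of i] ij \<open>i \<noteq> j\<close> by auto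
  have inv_a: "inverse a * inverse (\<sigma> a) = inverse 2" using a(2) by (metis inverse_mult_distrib)
  have Bvv: "B v v = 0" "B w w = 0" "B v w = 1" "B w v = 1"
  proof -
    have "B v v = inverse a * inverse (\<sigma> a) * (1 + \<iota> * \<sigma> \<iota>)" "B w w = inverse a * inverse (\<sigma> a) * (1 + \<iota> * \<sigma> \<iota>)"
      "B v w = inverse a * inverse (\<sigma> a) * (1 - \<iota> * \<sigma> \<iota>)" "B w v = inverse a * inverse (\<sigma> a) * (1 - \<iota> * \<sigma> \<iota>)"
      by (simp_all add: v_def w_def B_scale_left B_scale_right B_add_left B_add_right Bij algebra_simps)
    then show "B v v = 0" "B w w = 0" "B v w = 1" "B w v = 1" by (simp_all add: inv_a \<iota>)
  qed
  have Bo: "B v (g l) = 0" "B w (g l) = 0" "B (g l) v = 0" "B (g l) w = 0" if l: "l < r" "l \<noteq> i" "l \<noteq> j" for l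
  proof -
    have "B (g i) (g l) = 0" "B (g j) (g l) = 0" using D(7)[OF ij(1) l(1)] D(7)[OF ij(2) l(1)] ij l by auto
    then show "B v (g l) = 0" "B w (g l) = 0" by (simp_all add: v_def w_def B_scale_left B_add_left)
    then show "B (g l) v = 0" "B (g l) w = 0" using B_eq_0_sym by blast+
  qed
  define g' where "g' = g(i := v, j := w)"
  define \<tau>' where "\<tau>' = \<tau>(i := j, j := i)"
  define c' where "c' = c(i := 1, j := 1)"
  have g': "g' i = v" "g' j = w" "\<And>l. l \<noteq> i \<Longrightarrow> l \<noteq> j \<Longrightarrow> g' l = g l" using \<open>i \<noteq> j\<close> by (auto simp: g'_def)
  have \<tau>': "\<tau>' i = j" "\<tau>' j = i" "\<And>l. l \<noteq> i \<Longrightarrow> l \<noteq> j \<Longrightarrow> \<tau>' l = \<tau> l" using \<open>i \<noteq> j\<close> by (auto simp: \<tau>'_def)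
  have c': "c' i = 1" "c' j = 1" "\<And>l. l \<noteq> i \<Longrightarrow> l \<noteq> j \<Longrightarrow> c' l = c l" using \<open>i \<noteq> j\<close> by (auto simp: c'_def)
  have \<tau>_ne: "\<tau> l \<noteq> i" "\<tau> l \<noteq> j" if "l < r" "l \<noteq> i" "l \<noteq> j" for l
    using D(3)[OF that(1)] that ij by metis+
  have "witt_system M r g' \<tau>' c'"
    unfolding witt_system_def
  proof (intro conjI allI impI)
    fix l assume l: "l < r"
    consider "l \<noteq> i" "l \<noteq> j" | "l = i" | "l = j" by blast
    note cs = this
    show "g' l \<in> M" using cs by cases (use D(1)[OF l] vM in \<open>auto simp: g'\<close>)
    show "\<tau>' l < r" using cs by cases (use D(2)[OF l] ij in \<open>auto simp: \<tau>'\<close>)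
    show "\<tau>' (\<tau>' l) = l" using cs by cases (use D(3)[OF l] \<tau>_ne[OF l] in \<open>auto simp: \<tau>'\<close>)
    show "Y (g' l) = c' l *s g' (\<tau>' l)"
      using cs by cases (use D(4)[OF l] \<tau>_ne[OF l] Yv in \<open>auto simp: g' \<tau>' c'\<close>)
    show "c' l = 1 \<or> c' l = - 1" if "\<tau>' l = l"
      using cs by cases (use D(5)[OF l] that in \<open>auto simp: \<tau>' c'\<close>)
    show "\<exists>z. c' l = \<pi> powi z" if "\<tau>' l \<noteq> l"
      using cs by cases (use D(6)[OF l] that in \<open>auto simp: \<tau>' c' intro: exI[of _ 0]\<close>)
    fix l' assume l': "l' < r"
    have "l \<noteq> i \<and> l \<noteq> j \<or> l = i \<or> l = j" "l' \<noteq> i \<and> l' \<noteq> j \<or> l' = i \<or> l' = j" by blast+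
    then show "B (g' l) (g' l') = (if l' = \<tau>' l then 1 else 0)"
      by (elim disjE; insert D(7)[OF l l'] \<tau>_ne[OF l] Bvv Bo[OF l] Bo[OF l'] \<open>i \<noteq> j\<close>; simp add: g' \<tau>')
  qed
  moreover have "{l. l < r \<and> \<tau>' l = l} \<subset> {l. l < r \<and> \<tau> l = l}"
  proof
    show "{l. l < r \<and> \<tau>' l = l} \<subseteq> {l. l < r \<and> \<tau> l = l}"
      using ij \<open>i \<noteq> j\<close> by (auto simp: \<tau>'_def split: if_splits)
    have "i \<in> {l. l < r \<and> \<tau> l = l}" "i \<notin> {l. l < r \<and> \<tau>' l = l}" using ij(1,3) \<open>i \<noteq> j\<close> \<tau>'(1) by simp_all
    then show "{l. l < r \<and> \<tau>' l = l} \<noteq> {l. l < r \<and> \<tau> l = l}" by metis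
  qed
  then have "card {l. l < r \<and> \<tau>' l = l} < card {l. l < r \<and> \<tau> l = l}"
    by (intro psubset_card_mono) simp_all
  ultimately show ?thesis by blast
qed

text \<open>Take a longest system, and among these one with the fewest fixed points. The length
  forces the complement to vanish, the number of fixed points forces their eigenvalues to
  agree.\<close>

lemma ex_witt_basis:
  assumes M: "lattice M" and bound: "\<And>r g \<tau> c. witt_system M r g \<tau> c \<Longrightarrow> r \<le> n"
  shows "\<exists>r g \<tau> c. witt_system M r g \<tau> c \<and> (\<forall>v\<in>M. v = (\<Sum>i<r. B v (g (\<tau> i)) *s g i)) \<and>
    (\<forall>i<r. \<forall>j<r. \<tau> i = i \<longrightarrow> \<tau> j = j \<longrightarrow> c i = c j)"
proof -
  define P where "P r \<longleftrightarrow> (\<exists>g \<tau> c. witt_system M r g \<tau> c)" for r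
  have "P 0" by (auto simp: P_def witt_system_def)
  moreover have Pn: "r \<le> n" if "P r" for r using that bound by (auto simp: P_def)
  ultimately have PG: "P (Greatest P)" by (intro GreatestI_nat[of P 0 n]) auto
  define r where "r = Greatest P"
  have rmax: "r' \<le> r" if "P r'" for r' unfolding r_def using that Pn by (intro Greatest_le_nat[of P r' n]) auto
  define F where "F k \<longleftrightarrow> (\<exists>g \<tau> c. witt_system M r g \<tau> c \<and> card {l. l < r \<and> \<tau> l = l} = k)" for k
  have "\<exists>k. F k" using PG by (auto simp: F_def P_def r_def)
  then have "F (Least F)" by (rule LeastI_ex)
  then obtain g \<tau> c where W: "witt_system M r g \<tau> c" "card {l. l < r \<and> \<tau> l = l} = Least F"
    by (auto simp: F_def)
  have "c i = c j" if ij: "i < r" "j < r" "\<tau> i = i" "\<tau> j = j" for i j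
  proof (rule ccontr)
    assume "c i \<noteq> c j"
    then have "(c i = 1 \<and> c j = -1) \<or> (c j = 1 \<and> c i = -1)"
      using witt_systemD(5)[OF W(1)] ij by metis
    then have "\<exists>g' \<tau>' c'. witt_system M r g' \<tau>' c' \<and> card {l. l < r \<and> \<tau>' l = l} < card {l. l < r \<and> \<tau> l = l}"
      using witt_system_pair[OF M W(1), of i j] witt_system_pair[OF M W(1), of j i] ij by fastforce
    then obtain g' \<tau>' c' where less: "witt_system M r g' \<tau>' c'" "card {l. l < r \<and> \<tau>' l = l} < Least F"
      using W(2) by auto
    then have "F (card {l. l < r \<and> \<tau>' l = l})" by (auto simp: F_def)
    then show False using not_less_Least less(2) by blast
  qed
  moreover have "complement M r g = {0}"
  proof (rule ccontr)
    assume "complement M r g \<noteq> {0}"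
    then obtain r' where "P r'" "r' > r" using witt_system_extend[OF M W(1)] by (auto simp: P_def)
    then show False using rmax[of r'] by simp
  qed
  then have "v = (\<Sum>i<r. B v (g (\<tau> i)) *s g i)" if "v \<in> M" for v
    using witt_projection[OF M W(1) that] by simp
  ultimately show ?thesis using W(1) by blast
qed

end

section \<open>Matrices\<close>

lemma index_mult_mat_sum:
  "A \<in> carrier_mat a b \<Longrightarrow> B \<in> carrier_mat b c \<Longrightarrow> i < a \<Longrightarrow> k < c \<Longrightarrow>
    (A * B) $$ (i, k) = (\<Sum>l<b. A $$ (i, l) * B $$ (l, k))"
  by (simp add: scalar_prod_def lessThan_atLeast0)

lemma sum_two_terms:
  fixes f :: "nat \<Rightarrow> 'b::semiring_0"
  assumes "i < d" "j < d"
  shows "(\<Sum>k<d. ((if k = i then a else 0) + (if k = j then b else 0)) * f k) = a * f i + b * f j"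
proof -
  have "(\<Sum>k<d. ((if k = i then a else 0) + (if k = j then b else 0)) * f k) =
      (\<Sum>k<d. (if k = i then a * f i else 0) + (if k = j then b * f j else 0))"
    by (rule sum.cong) (auto simp: distrib_right)
  then show ?thesis using assms by (simp add: sum.distrib)
qed

text \<open>A product through dimension \<open>d\<close> has rank at most \<open>d\<close>: if
  \<open>r\<close> were larger, padding the left factor with zero columns to a square matrix would
  make an invertible matrix kill a unit vector.\<close>

lemma right_inverse_imp_le:
  fixes G :: "nat \<Rightarrow> nat \<Rightarrow> 'b::field"
  assumes "\<And>i j. i < r \<Longrightarrow> j < r \<Longrightarrow> (\<Sum>l<d. G i l * H l j) = (if i = j then 1 else 0)"
  shows "r \<le> d"
proof (rule ccontr)
  assume "\<not> r \<le> d"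
  then have dr: "d < r" by simp
  define A where "A = mat r r (\<lambda>(i, l). if l < d then G i l else 0)"
  define C where "C = mat r r (\<lambda>(l, j). if l < d then H l j else 0)"
  have A: "A \<in> carrier_mat r r" and C: "C \<in> carrier_mat r r" by (simp_all add: A_def C_def)
  have "A * C = 1\<^sub>m r"
  proof (rule eq_matI)
    fix i j assume "i < dim_row (1\<^sub>m r :: 'b mat)" "j < dim_col (1\<^sub>m r :: 'b mat)"
    then have ij: "i < r" "j < r" by auto
    have "(A * C) $$ (i, j) = (\<Sum>l<r. A $$ (i, l) * C $$ (l, j))" by (rule index_mult_mat_sum[OF A C ij])
    also have "\<dots> = (\<Sum>l<d. G i l * H l j)"
      by (rule sum.mono_neutral_cong_right) (use dr ij in \<open>auto simp: A_def C_def\<close>)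
    finally show "(A * C) $$ (i, j) = 1\<^sub>m r $$ (i, j)" using assms[OF ij] ij by simp
  qed (simp_all add: A_def C_def)
  then have "det A * det C = 1" using det_mult[OF A C] by simp
  then have "det A \<noteq> 0" by auto
  moreover have "A *\<^sub>v unit_vec r d = 0\<^sub>v r"
    by (rule eq_vecI) (use dr A in \<open>auto simp: A_def scalar_prod_right_unit\<close>)
  moreover have "unit_vec r d \<in> carrier_vec r" "unit_vec r d \<noteq> (0\<^sub>v r :: 'b vec)" using dr by auto
  ultimately show False using det_0_iff_vec_prod_zero_field[OF A] by blast
qed

section \<open>Conjugate transpose, the antidiagonal matrix and its isometries\<close>

lemma conj_transpose_carrier [simp, intro]: "A \<in> carrier_mat a b \<Longrightarrow> conj_transpose s A \<in> carrier_mat b a"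
  by (simp add: conj_transpose_def)

lemma conj_transpose_dim [simp]:
  "dim_row (conj_transpose s A) = dim_col A" "dim_col (conj_transpose s A) = dim_row A"
  by (simp_all add: conj_transpose_def)

lemma conj_transpose_index [simp]:
  "i < dim_col A \<Longrightarrow> j < dim_row A \<Longrightarrow> conj_transpose s A $$ (i, j) = s (A $$ (j, i))"
  by (simp add: conj_transpose_def)

lemma antidiag_carrier [simp, intro]: "antidiag d \<in> carrier_mat d d"
  by (simp add: antidiag_def)

lemma antidiag_dim [simp]: "dim_row (antidiag d) = d" "dim_col (antidiag d) = d"
  by (simp_all add: antidiag_def)

lemma antidiag_index [simp]:
  "i < d \<Longrightarrow> k < d \<Longrightarrow> antidiag d $$ (i, k) = (if k = d - Suc i then 1 else 0)"
  by (auto simp: antidiag_def)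

lemma antidiag_index': "i < d \<Longrightarrow> k < d \<Longrightarrow> antidiag d $$ (i, k) = (if i = d - Suc k then 1 else 0)"
  by (auto simp: antidiag_def)

lemma mult_antidiag_index:
  fixes A :: "'b::comm_ring_1 mat"
  assumes "A \<in> carrier_mat a d" "i < a" "k < d"
  shows "(A * antidiag d) $$ (i, k) = A $$ (i, d - Suc k)"
proof -
  have "(A * antidiag d) $$ (i, k) = (\<Sum>l<d. A $$ (i, l) * antidiag d $$ (l, k))"
    by (rule index_mult_mat_sum) (use assms in auto)
  also have "\<dots> = (\<Sum>l<d. if l = d - Suc k then A $$ (i, l) else 0)"
    by (rule sum.cong) (use assms in \<open>auto simp: antidiag_index' simp del: antidiag_index\<close>)
  finally show ?thesis using assms by simp
qed

lemma antidiag_mult_index: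
  fixes A :: "'b::comm_ring_1 mat"
  assumes "A \<in> carrier_mat d b" "i < d" "k < b"
  shows "(antidiag d * A) $$ (i, k) = A $$ (d - Suc i, k)"
proof -
  have "(antidiag d * A) $$ (i, k) = (\<Sum>l<d. antidiag d $$ (i, l) * A $$ (l, k))"
    by (rule index_mult_mat_sum) (use assms in auto)
  also have "\<dots> = (\<Sum>l<d. if l = d - Suc i then A $$ (l, k) else 0)"
    by (rule sum.cong) (use assms in auto)
  finally show ?thesis using assms by simp
qed

lemma antidiag_antidiag: "antidiag d * antidiag d = (1\<^sub>m d :: 'b::comm_ring_1 mat)"
proof (rule eq_matI)
  fix i j assume "i < dim_row (1\<^sub>m d :: 'b mat)" "j < dim_col (1\<^sub>m d :: 'b mat)"
  then have ij: "i < d" "j < d" by auto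
  have "(antidiag d * antidiag d) $$ (i, j) = (antidiag d :: 'b mat) $$ (d - Suc i, j)"
    by (rule antidiag_mult_index) (use ij in auto)
  also have "\<dots> = (if i = j then 1 else 0)" using ij by auto
  finally show "(antidiag d * antidiag d) $$ (i, j) = (1\<^sub>m d :: 'b mat) $$ (i, j)" using ij by simp
qed simp_all

lemma antidiag_cancel_left: "A \<in> carrier_mat d b \<Longrightarrow> antidiag d * (antidiag d * A) = A" for A :: "'b::comm_ring_1 mat"
  by (subst assoc_mult_mat[symmetric, of _ d d _ d _ b]) (auto simp: antidiag_antidiag)

locale herm_matrices = unramified_quadratic R \<pi> \<sigma> for R :: "'a::field_char_0 set" and \<pi> \<sigma> +
  fixes d :: nat
begin

abbreviation ct :: "'a mat \<Rightarrow> 'a mat" where "ct \<equiv> conj_transpose \<sigma>"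
abbreviation J :: "'a mat" where "J \<equiv> antidiag d"

declare add_mem [rule del] uminus_mem [rule del] mult_mem [rule del] diff_mem [rule del]
  sum_mem [rule del] prod_mem [rule del] power_mem [rule del] \<sigma>_mem [rule del]

lemmas assoc_sq = assoc_mult_mat[of _ d d _ d _ d]
  and mult_sq = mult_carrier_mat[of _ d d _ d]

lemma ct_ct [simp]: "ct (ct A) = A"
  by (rule eq_matI) auto

lemma ct_mult: "A \<in> carrier_mat a b \<Longrightarrow> B \<in> carrier_mat b c \<Longrightarrow> ct (A * B) = ct B * ct A"
proof (rule eq_matI)
  fix i k assume A: "A \<in> carrier_mat a b" and B: "B \<in> carrier_mat b c"
    and "i < dim_row (ct B * ct A)" "k < dim_col (ct B * ct A)"
  then have ik: "i < c" "k < a" by auto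
  have "ct (A * B) $$ (i, k) = \<sigma> ((A * B) $$ (k, i))" using A B ik by (intro conj_transpose_index) auto
  also have "\<dots> = (\<Sum>l<b. \<sigma> (A $$ (k, l)) * \<sigma> (B $$ (l, i)))"
    by (subst index_mult_mat_sum[OF A B ik(2,1)]) (simp add: \<sigma>_sum)
  also have "\<dots> = (\<Sum>l<b. ct B $$ (i, l) * ct A $$ (l, k))"
    using A B ik by (intro sum.cong) (auto simp: mult.commute)
  also have "\<dots> = (ct B * ct A) $$ (i, k)"
    by (rule index_mult_mat_sum[symmetric]) (use A B ik in auto)
  finally show "ct (A * B) $$ (i, k) = (ct B * ct A) $$ (i, k)" .
qed auto

lemma ct_one [simp]: "ct (1\<^sub>m m) = 1\<^sub>m m"
  by (rule eq_matI) auto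

lemma ct_J [simp]: "ct J = J"
  by (rule eq_matI) (auto simp: antidiag_index' simp del: antidiag_index)

lemma det_ct: "A \<in> carrier_mat m m \<Longrightarrow> det (ct A) = \<sigma> (det A)"
proof -
  assume A: "A \<in> carrier_mat m m"
  have "det (ct A) = det (map_mat \<sigma> A)" unfolding conj_transpose_def by (rule det_transpose) (use A in auto)
  also have "\<dots> = \<sigma> (det A)"
    using A by (auto simp: det_def'[of _ m] \<sigma>_sum \<sigma>_prod sign_def intro!: sum.cong prod.cong)
  finally show ?thesis .
qed

text \<open>Stated for the rows of \<open>g\<close>, because vectors are rows here;
  \<open>unitary_group\<close> speaks of the columns, and \<open>isometry_iff\<close> connects the
  two.\<close>

definition isometry :: "'a mat \<Rightarrow> bool" where
  "isometry g \<longleftrightarrow> g \<in> carrier_mat d d \<and> g * J * ct g = J"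

text \<open>Either equation exhibits \<open>J * ct g * J\<close> as an inverse of \<open>g\<close>
  on one side, hence on both.\<close>

lemma isometry_iff: "isometry g \<longleftrightarrow> g \<in> carrier_mat d d \<and> ct g * J * g = J"
proof -
  have *: "ct g * J * g = J" if g: "g \<in> carrier_mat d d" and e: "g * J * ct g = J" for g :: "'a mat"
  proof -
    have "g * (J * ct g * J) = g * J * ct g * J" using g by (simp add: assoc_sq mult_sq)
    also have "\<dots> = 1\<^sub>m d" by (simp add: e antidiag_antidiag)
    finally have "(J * ct g * J) * g = 1\<^sub>m d"
      by (intro mat_mult_left_right_inverse[of g d]) (use g in auto)
    then have "J * (J * ct g * J * g) = J * 1\<^sub>m d" by simp
    then have "J * (J * (ct g * J * g)) = J" using g by (simp add: assoc_sq mult_sq)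
    then show ?thesis using antidiag_cancel_left[of "ct g * J * g" d d] g by (simp add: mult_sq)
  qed
  show ?thesis using *[of g] *[of "ct g"] by (auto simp: isometry_def)
qed

lemma isometry_inverse:
  assumes "isometry g"
  shows "g * (J * ct g * J) = 1\<^sub>m d" "(J * ct g * J) * g = 1\<^sub>m d" "isometry (J * ct g * J)"
proof -
  have g: "g \<in> carrier_mat d d" "g * J * ct g = J" "ct g * J * g = J"
    using assms isometry_iff[of g] by (auto simp: isometry_def)
  have "g * (J * ct g * J) = g * J * ct g * J" using g(1) by (simp add: assoc_sq mult_sq)
  also have "\<dots> = 1\<^sub>m d" by (simp add: g(2) antidiag_antidiag)
  finally show 1: "g * (J * ct g * J) = 1\<^sub>m d" .
  then show "(J * ct g * J) * g = 1\<^sub>m d"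
    by (intro mat_mult_left_right_inverse[of g d]) (use g in auto)
  have "ct (J * ct g * J) = J * g * J"
    using g(1) by (simp add: ct_mult[of _ d d _ d] assoc_sq mult_sq)
  then have "J * ct g * J * J * ct (J * ct g * J) = J * ct g * J * (J * (J * (g * J)))"
    using g(1) by (simp add: assoc_sq mult_sq)
  also have "\<dots> = J * (ct g * J * g) * J"
    using g(1) by (subst antidiag_cancel_left[of _ _ d]) (simp_all add: assoc_sq mult_sq)
  also have "\<dots> = J" by (simp add: g(3) antidiag_antidiag)
  finally show "isometry (J * ct g * J)" using g(1) by (simp add: isometry_def mult_sq)
qed

lemma isometry_invertible: "isometry g \<Longrightarrow> invertible_mat g"
  using isometry_inverse[of g] by (auto simp: isometry_def invertible_mat_def inverts_mat_def square_mat.simps intro!: exI[of _ "J * ct g * J"])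

lemma isometry_mult: "isometry g \<Longrightarrow> isometry h \<Longrightarrow> isometry (g * h)"
proof -
  assume "isometry g" "isometry h"
  then have g: "g \<in> carrier_mat d d" "g * J * ct g = J" and h: "h \<in> carrier_mat d d" "h * J * ct h = J"
    by (auto simp: isometry_def)
  have "g * h * J * ct (g * h) = g * (h * J * ct h) * ct g"
    using g(1) h(1) by (simp add: ct_mult[of _ d d _ d] assoc_sq mult_sq)
  then show ?thesis using g h by (simp add: isometry_def mult_sq)
qed

lemma gram_index:
  assumes "g \<in> carrier_mat a d" "h \<in> carrier_mat b d" "i < a" "k < b"
  shows "(g * J * ct h) $$ (i, k) = (\<Sum>l<d. g $$ (i, l) * \<sigma> (h $$ (k, d - Suc l)))"
proof -
  have "(g * J * ct h) $$ (i, k) = (\<Sum>l<d. (g * J) $$ (i, l) * ct h $$ (l, k))"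
    by (rule index_mult_mat_sum[of _ a d _ b]) (use assms in auto)
  also have "\<dots> = (\<Sum>l<d. g $$ (i, d - Suc l) * \<sigma> (h $$ (k, d - Suc (d - Suc l))))"
    using assms by (intro sum.cong) (auto simp: mult_antidiag_index[of _ a] simp del: index_mult_mat(1))
  also have "\<dots> = (\<Sum>l<d. g $$ (i, l) * \<sigma> (h $$ (k, d - Suc l)))"
    by (rule sum.nat_diff_reindex)
  finally show ?thesis .
qed

definition hermitian :: "'a mat \<Rightarrow> bool" where
  "hermitian x \<longleftrightarrow> isometry x \<and> ct x = x"

section \<open>Row vectors as a Hermitian space with involution\<close>

definition vscale :: "'a \<Rightarrow> (nat \<Rightarrow> 'a) \<Rightarrow> nat \<Rightarrow> 'a" where
  "vscale a v = (\<lambda>i. a * v i)"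

definition vform :: "(nat \<Rightarrow> 'a) \<Rightarrow> (nat \<Rightarrow> 'a) \<Rightarrow> 'a" where
  "vform v w = (\<Sum>i<d. v i * \<sigma> (w (d - Suc i)))"

text \<open>Row vectors are multiplied by \<open>x J\<close> from the right; coordinates beyond \<open>d\<close> are kept, so that
  this is an involution of all sequences.\<close>

definition vinv :: "'a mat \<Rightarrow> (nat \<Rightarrow> 'a) \<Rightarrow> nat \<Rightarrow> 'a" where
  "vinv x v = (\<lambda>j. if j < d then \<Sum>i<d. v i * x $$ (i, d - Suc j) else v j)"

text \<open>Vanishing beyond \<open>d\<close> confines the lattice to \<open>d\<close> coordinates
  although the space consists of all sequences; in the self-duality condition of
  \<open>lattice\<close> it is the requirement that a multiple of \<open>v\<close> lies in the set
  that excludes other tails.\<close>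

definition int_vectors :: "(nat \<Rightarrow> 'a) set" where
  "int_vectors = {v. (\<forall>i<d. v i \<in> R) \<and> (\<forall>i\<ge>d. v i = 0)}"

definition std :: "nat \<Rightarrow> nat \<Rightarrow> 'a" where
  "std i = (\<lambda>j. if j = i then 1 else 0)"

lemma vform_std: "i < d \<Longrightarrow> vform v (std (d - Suc i)) = v i"
proof -
  assume i: "i < d"
  have "vform v (std (d - Suc i)) = (\<Sum>l<d. if l = i then v l else 0)"
    unfolding vform_def std_def using i by (intro sum.cong) auto
  then show ?thesis using i by simp
qed

lemma std_mem: "i < d \<Longrightarrow> std i \<in> int_vectors"
  by (simp add: std_def int_vectors_def)

text \<open>The square of \<open>x * J\<close> is 1, since \<open>x\<close> is both an isometry and
  hermitian.\<close>

lemma hermitian_square: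
  assumes "hermitian x" "i < d" "k < d"
  shows "(\<Sum>l<d. x $$ (i, d - Suc l) * x $$ (l, d - Suc k)) = (if i = k then 1 else 0)"
proof -
  have x: "x \<in> carrier_mat d d" "x * J * x = J" using assms by (auto simp: hermitian_def isometry_def)
  have "(x * J * x) $$ (i, d - Suc k) = (\<Sum>l<d. (x * J) $$ (i, l) * x $$ (l, d - Suc k))"
    by (rule index_mult_mat_sum[of _ d d _ d]) (use x assms in auto)
  also have "(\<Sum>l<d. (x * J) $$ (i, l) * x $$ (l, d - Suc k)) = (\<Sum>l<d. x $$ (i, d - Suc l) * x $$ (l, d - Suc k))"
    using x assms by (intro sum.cong) (auto simp: mult_antidiag_index[of _ d] simp del: index_mult_mat(1))
  finally have "(x * J * x) $$ (i, d - Suc k) = (\<Sum>l<d. x $$ (i, d - Suc l) * x $$ (l, d - Suc k))" .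
  moreover have "d - Suc k = d - Suc i \<longleftrightarrow> i = k" using assms(2,3) by linarith
  ultimately show ?thesis using assms(2,3) by (simp add: x(2))
qed

text \<open>\<open>hermitian_square\<close> makes \<open>vinv x\<close> an involution; adjointness
  is the symmetry of \<open>x\<close>, with one reversal of the summation index to match
  \<open>vform\<close>.\<close>

lemma herm_space_axioms':
  assumes x: "hermitian x"
  shows "herm_space R \<pi> \<sigma> vscale vform (vinv x)"
proof -
  have xc: "x \<in> carrier_mat d d" and xs: "ct x = x" using x by (auto simp: hermitian_def isometry_def)
  have \<sigma>x: "\<sigma> (x $$ (i, k)) = x $$ (k, i)" if "i < d" "k < d" for i k
    using that xc conj_transpose_index[of k x i \<sigma>] xs by auto
  show ?thesis
  proof unfold_locales
    fix v w :: "nat \<Rightarrow> 'a"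
    have "\<sigma> (vform w v) = (\<Sum>i<d. \<sigma> (w i) * v (d - Suc i))" by (simp add: vform_def \<sigma>_sum)
    also have "\<dots> = (\<Sum>i<d. \<sigma> (w (d - Suc i)) * v (d - Suc (d - Suc i)))"
      by (rule sum.nat_diff_reindex[symmetric])
    also have "\<dots> = vform v w" unfolding vform_def by (intro sum.cong) (auto simp: mult.commute)
    finally show "vform v w = \<sigma> (vform w v)" by simp
  next
    fix v :: "nat \<Rightarrow> 'a"
    show "vinv x (vinv x v) = v"
    proof
      fix j
      show "vinv x (vinv x v) j = v j"
      proof (cases "j < d")
        case True
        have "vinv x (vinv x v) j = (\<Sum>i<d. (\<Sum>l<d. v l * x $$ (l, d - Suc i)) * x $$ (i, d - Suc j))"
          using True by (simp add: vinv_def)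
        also have "\<dots> = (\<Sum>l<d. v l * (\<Sum>i<d. x $$ (l, d - Suc i) * x $$ (i, d - Suc j)))"
          unfolding sum_distrib_left sum_distrib_right by (subst sum.swap) (simp add: mult.assoc)
        also have "\<dots> = (\<Sum>l<d. if l = j then v l else 0)"
          using True by (intro sum.cong) (auto simp: hermitian_square[OF x])
        finally show ?thesis using True by simp
      qed (simp add: vinv_def)
    qed
  next
    fix u v :: "nat \<Rightarrow> 'a"
    have "vform (vinv x u) v = (\<Sum>j<d. (\<Sum>i<d. u i * x $$ (i, d - Suc j)) * \<sigma> (v (d - Suc j)))"
      by (simp add: vform_def vinv_def)
    also have "\<dots> = (\<Sum>j<d. (\<Sum>i<d. u i * x $$ (i, j)) * \<sigma> (v j))"
      by (rule sum.nat_diff_reindex)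
    also have "\<dots> = (\<Sum>i<d. u i * (\<Sum>j<d. x $$ (i, j) * \<sigma> (v j)))"
      unfolding sum_distrib_left sum_distrib_right by (subst sum.swap) (simp add: mult.assoc)
    also have "\<dots> = vform u (vinv x v)"
      unfolding vform_def
    proof (rule sum.cong[OF refl])
      fix i assume "i \<in> {..<d}"
      then have i: "i < d" by simp
      have "\<sigma> (vinv x v (d - Suc i)) = (\<Sum>j<d. \<sigma> (v j) * \<sigma> (x $$ (j, i)))"
        using i by (simp add: vinv_def \<sigma>_sum)
      also have "\<dots> = (\<Sum>j<d. x $$ (i, j) * \<sigma> (v j))"
        using i by (intro sum.cong) (auto simp: \<sigma>x mult.commute)
      finally show "u i * (\<Sum>j<d. x $$ (i, j) * \<sigma> (v j)) = u i * \<sigma> (vinv x v (d - Suc i))" by simp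
    qed
    finally show "vform (vinv x u) v = vform u (vinv x v)" .
  qed (auto simp: vscale_def vform_def vinv_def fun_eq_iff algebra_simps sum.distrib sum_distrib_left)
qed

lemma ex_pi_power_mult_mem: "\<exists>r. \<pi> ^ r * y \<in> R"
proof (cases "y = 0")
  case False
  obtain m u where u: "u \<in> R" "y = \<pi> powi m * u" using ex_valuation[OF False] by blast
  have "\<pi> ^ nat (- m) * \<pi> powi m \<in> R"
  proof (cases "m \<ge> 0")
    case True
    then show ?thesis by (auto simp: power_int_def intro!: power_mem)
  next
    case False
    then show ?thesis by (simp add: power_int_def power_mult_distrib[symmetric])
  qed
  then have "\<pi> ^ nat (- m) * y \<in> R" using mult_mem[OF _ u(1)] by (simp add: u(2) mult.assoc[symmetric])
  then show ?thesis by blast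
qed auto

lemma eq_0_if_pi_power_divides:
  assumes "\<And>r. \<exists>w\<in>R. y = \<pi> ^ r * w"
  shows "y = 0"
proof (rule ccontr)
  assume "y \<noteq> 0"
  then obtain m u where u: "unit u" "y = \<pi> powi m * u" using ex_valuation[of y] unfolding unit_def by blast
  \<comment> \<open>One power of \<open>\<pi>\<close> more than \<open>y\<close> contains; for
    negative \<open>m\<close> it is 0 after truncation, which is enough because such a
    \<open>y\<close> is not integral.\<close>
  define r where "r = nat (m + 1)"
  obtain w where w: "w \<in> R" "y = \<pi> ^ r * w" using assms by blast
  define s where "s = nat (int r - m - 1)"
  have "int r = m + 1 + int s" by (simp add: s_def r_def)
  then have "\<pi> powi int r = \<pi> powi m * (\<pi> * \<pi> ^ s)"
    by (simp only: power_int_add[OF disjI1[OF \<pi>_nonzero]] power_int_1_right power_int_of_nat mult.assoc)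
  then have "\<pi> ^ r = \<pi> powi m * (\<pi> * \<pi> ^ s)" by simp
  then have "u = \<pi> * (\<pi> ^ s * w)" using u(2) w(2) by simp
  moreover have "\<pi> ^ s * w \<in> R" by (intro mult_mem power_mem \<pi>_mem w)
  ultimately show False using u(1) not_unit_iff unit_mem by blast
qed

lemma ex_common_pi_power:
  assumes "finite S"
  shows "\<exists>r. \<forall>y\<in>S. \<pi> ^ r * y \<in> R"
  using assms
proof (induction S rule: finite_induct)
  case (insert y S)
  then obtain r where r: "\<forall>y\<in>S. \<pi> ^ r * y \<in> R" by blast
  obtain r' where r': "\<pi> ^ r' * y \<in> R" using ex_pi_power_mult_mem by blast
  have "\<pi> ^ (r + r') * z \<in> R" if "z \<in> insert y S" for z
  proof -
    have "\<pi> ^ (r + r') * z = \<pi> ^ r' * (\<pi> ^ r * z)" "\<pi> ^ (r + r') * z = \<pi> ^ r * (\<pi> ^ r' * z)"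
      by (simp_all add: power_add mult_ac)
    then show ?thesis using that r r' mult_mem power_mem \<pi>_mem by (metis insertE)
  qed
  then show ?case by blast
qed auto

text \<open>Self-duality is tested on the standard vectors, commensurability by a common denominator
  of the entries of \<open>x\<close>.\<close>

lemma lattice_int_vectors:
  assumes x: "hermitian x"
  shows "herm_space.lattice R \<pi> vscale vform (vinv x) int_vectors"
proof -
  interpret H: herm_space R \<pi> \<sigma> vscale vform "vinv x" by (rule herm_space_axioms'[OF x])
  show ?thesis unfolding H.lattice_def H.submod_def
  proof (intro conjI ballI allI impI)
    show "0 \<in> int_vectors" by (simp add: int_vectors_def)
    show "u + v \<in> int_vectors" if "u \<in> int_vectors" "v \<in> int_vectors" for u v
      using that by (auto simp: int_vectors_def intro: add_mem)
    show "vscale a v \<in> int_vectors" if "a \<in> R" "v \<in> int_vectors" for a v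
      using that by (auto simp: int_vectors_def vscale_def intro: mult_mem)
    show "vform u v \<in> R" if "u \<in> int_vectors" "v \<in> int_vectors" for u v
      using that by (auto simp: int_vectors_def vform_def intro!: sum_mem mult_mem \<sigma>_mem)
    fix v assume ex: "\<exists>r. vscale (\<pi> ^ r) v \<in> int_vectors" and B: "\<forall>w\<in>int_vectors. vform v w \<in> R"
    have "v i \<in> R" if i: "i < d" for i
      using B[THEN bspec, OF std_mem[of "d - Suc i"]] vform_std[OF i, of v] i by simp
    moreover have "v i = 0" if "i \<ge> d" for i using ex that by (auto simp: int_vectors_def vscale_def)
    ultimately show "v \<in> int_vectors" by (simp add: int_vectors_def)
  next
    have "finite ((\<lambda>(i, k). x $$ (i, k)) ` ({..<d} \<times> {..<d}))" by simp
    then obtain r where r: "\<forall>y\<in>(\<lambda>(i, k). x $$ (i, k)) ` ({..<d} \<times> {..<d}). \<pi> ^ r * y \<in> R"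
      using ex_common_pi_power by blast
    have "vscale (\<pi> ^ r) (vinv x v) \<in> int_vectors" if v: "v \<in> int_vectors" for v
    proof -
      have "\<pi> ^ r * (\<Sum>i<d. v i * x $$ (i, d - Suc j)) \<in> R" if j: "j < d" for j
      proof -
        have "\<pi> ^ r * (\<Sum>i<d. v i * x $$ (i, d - Suc j)) = (\<Sum>i<d. v i * (\<pi> ^ r * x $$ (i, d - Suc j)))"
          by (simp add: sum_distrib_left mult_ac)
        also have "\<dots> \<in> R"
          by (intro sum_mem mult_mem r[THEN bspec]) (use v j in \<open>auto simp: int_vectors_def\<close>)
        finally show ?thesis .
      qed
      then show ?thesis using v by (simp add: int_vectors_def vscale_def vinv_def)
    qed
    then show "\<exists>r. \<forall>v\<in>int_vectors. vscale (\<pi> ^ r) (vinv x v) \<in> int_vectors" by blast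
  next
    fix v assume v: "v \<in> int_vectors" "\<forall>r. \<exists>w\<in>int_vectors. v = vscale (\<pi> ^ r) w"
    show "v = 0"
    proof
      fix i
      show "v i = 0 i"
      proof (cases "i < d")
        case True
        have "v i = 0"
        proof (rule eq_0_if_pi_power_divides)
          fix r
          obtain w where "w \<in> int_vectors" "v = vscale (\<pi> ^ r) w" using v(2) by blast
          then show "\<exists>w\<in>R. v i = \<pi> ^ r * w" using True by (auto simp: int_vectors_def vscale_def)
        qed
        then show ?thesis by simp
      qed (use v(1) in \<open>simp add: int_vectors_def\<close>)
    qed
  qed
qed

text \<open>The length is \<open>d\<close> by two rank comparisons: the Gram matrix of a Witt system
  is a permutation matrix, which bounds it from above; the standard vectors are combinations of the
  basis, which bounds it from below.\<close>

lemma ex_basis: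
  assumes x: "hermitian x"
  shows "\<exists>g \<tau> c. herm_space.witt_system \<pi> vscale vform (vinv x) int_vectors d g \<tau> c \<and>
    (\<forall>i<d. \<forall>j<d. \<tau> i = i \<longrightarrow> \<tau> j = j \<longrightarrow> c i = c j)"
proof -
  interpret H: herm_space R \<pi> \<sigma> vscale vform "vinv x" by (rule herm_space_axioms'[OF x])
  have L: "H.lattice int_vectors" by (rule lattice_int_vectors[OF x])
  have bound: "r \<le> d" if W: "H.witt_system int_vectors r g \<tau> c" for r g \<tau> c
  proof (rule right_inverse_imp_le)
    fix i j assume ij: "i < r" "j < r"
    have "(\<Sum>l<d. g i l * \<sigma> (g (\<tau> j) (d - Suc l))) = vform (g i) (g (\<tau> j))" by (simp add: vform_def)
    also have "\<dots> = (if i = j then 1 else 0)"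
      using H.witt_systemD(7)[OF W ij(1) H.witt_systemD(2)[OF W ij(2)]] H.witt_systemD(3)[OF W ij(1)] H.witt_systemD(3)[OF W ij(2)]
      by metis
    finally show "(\<Sum>l<d. g i l * \<sigma> (g (\<tau> j) (d - Suc l))) = (if i = j then 1 else 0)" .
  qed
  obtain r g \<tau> c where W: "H.witt_system int_vectors r g \<tau> c"
    and span: "\<forall>v\<in>int_vectors. v = (\<Sum>i<r. vscale (vform v (g (\<tau> i))) (g i))"
    and same: "\<forall>i<r. \<forall>j<r. \<tau> i = i \<longrightarrow> \<tau> j = j \<longrightarrow> c i = c j"
  proof -
    have "\<exists>r g \<tau> c. H.witt_system int_vectors r g \<tau> c \<and>
      (\<forall>v\<in>int_vectors. v = (\<Sum>i<r. vscale (vform v (g (\<tau> i))) (g i))) \<and>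
      (\<forall>i<r. \<forall>j<r. \<tau> i = i \<longrightarrow> \<tau> j = j \<longrightarrow> c i = c j)"
      by (rule H.ex_witt_basis[OF L]) (rule bound)
    then show ?thesis using that by blast
  qed
  have "d \<le> r"
  proof (rule right_inverse_imp_le)
    fix i j assume ij: "i < d" "j < d"
    have sum_app: "(\<Sum>a\<in>A. f a) j = (\<Sum>a\<in>A. f a j)" for f :: "nat \<Rightarrow> nat \<Rightarrow> 'a" and A
      by (induction A rule: infinite_finite_induct) auto
    have "std i j = (\<Sum>a<r. vscale (vform (std i) (g (\<tau> a))) (g a)) j"
      using span[THEN bspec, OF std_mem[OF ij(1)]] by (rule arg_cong)
    also have "\<dots> = (\<Sum>a<r. vform (std i) (g (\<tau> a)) * g a j)" by (simp add: sum_app vscale_def)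
    finally show "(\<Sum>a<r. vform (std i) (g (\<tau> a)) * g a j) = (if i = j then 1 else 0)" by (auto simp: std_def)
  qed
  then have "r = d" using bound[OF W] by simp
  then show ?thesis using W same by blast
qed

end

section \<open>Reduction under the integral group\<close>

lemma mat_diag_carrier [simp]: "mat_diag m f \<in> carrier_mat m m"
  by (simp add: mat_diag_def)

lemma mat_diag_index [simp]: "i < m \<Longrightarrow> k < m \<Longrightarrow> mat_diag m f $$ (i, k) = (if i = k then f i else 0)"
  by (auto simp: mat_diag_def)

lemma char_poly_mat_diag:
  fixes f :: "nat \<Rightarrow> 'b::field"
  shows "char_poly (mat_diag m f) = (\<Prod>i<m. [:- f i, 1:])"
proof -
  have ut: "upper_triangular (mat_diag m f)" by (auto simp: upper_triangular_def mat_diag_def)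
  have diag: "diag_mat (mat_diag m f) = map f [0..<m]"
    by (auto simp: diag_mat_def mat_diag_def intro!: map_cong)
  have "char_poly (mat_diag m f) = (\<Prod>a\<leftarrow>map f [0..<m]. [:- a, 1:])"
    using char_poly_upper_triangular[OF mat_diag_carrier ut] by (simp add: diag)
  also have "\<dots> = (\<Prod>i\<leftarrow>[0..<m]. [:- f i, 1:])" by (simp add: comp_def)
  also have "\<dots> = (\<Prod>i\<in>set [0..<m]. [:- f i, 1:])"
    by (rule prod.distinct_set_conv_list[symmetric]) simp
  finally show ?thesis by (simp add: lessThan_atLeast0)
qed

text \<open>The eigenvectors of the transposition-like matrix below are \<open>e\<^sub>i + c\<^sub>i e\<^sub>\<tau>\<^sub>i\<close> and
  \<open>e\<^sub>i - c\<^sub>i e\<^sub>\<tau>\<^sub>i\<close>.\<close>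

definition pair_mat :: "nat \<Rightarrow> (nat \<Rightarrow> nat) \<Rightarrow> (nat \<Rightarrow> 'b::zero) \<Rightarrow> 'b mat" where
  "pair_mat d \<tau> c = mat d d (\<lambda>(i, k). if k = \<tau> i then c i else 0)"

lemma pair_mat_carrier [simp]: "pair_mat d \<tau> c \<in> carrier_mat d d"
  by (simp add: pair_mat_def)

text \<open>The rows of \<open>T\<close> are the eigenvectors: the one with the plus sign stands at
  the smaller index of a pair and has eigenvalue 1, the one with the minus sign at the larger index
  and has eigenvalue -1; at a fixed point the unit vector has eigenvalue \<open>c i\<close>.\<close>

lemma char_poly_pair_mat:
  fixes c :: "nat \<Rightarrow> 'b::field_char_0"
  assumes \<tau>: "\<And>i. i < d \<Longrightarrow> \<tau> i < d" "\<And>i. i < d \<Longrightarrow> \<tau> (\<tau> i) = i"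
    and c: "\<And>i. i < d \<Longrightarrow> c i * c (\<tau> i) = 1"
  shows "char_poly (pair_mat d \<tau> c) =
    (\<Prod>i<d. [:- (if \<tau> i = i then c i else if i < \<tau> i then 1 else -1), 1:])"
proof -
  define D where "D i = (if \<tau> i = i then c i else if i < \<tau> i then 1 else -1)" for i
  define b where "b i = (if \<tau> i = i then 0 else if i < \<tau> i then c i else - c i)" for i
  \<comment> \<open>Coefficients of the inverse of \<open>T\<close>, which recover the unit vectors
    from the two eigenvectors of a pair; hence the halves.\<close>
  define a' where "a' i = (if \<tau> i = i then 1 else 1 / 2 :: 'b)" for i
  define b' where "b' i = (if \<tau> i = i then 0 else if i < \<tau> i then - c i / 2 else c i / 2)" for i
  define T where "T = mat d d (\<lambda>(i, k). (if k = i then 1 else 0) + (if k = \<tau> i then b i else 0))"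
  define T' where "T' = mat d d (\<lambda>(i, k). (if k = i then a' i else 0) + (if k = \<tau> i then b' i else 0))"
  let ?C = "pair_mat d \<tau> c"
  have carr: "T \<in> carrier_mat d d" "T' \<in> carrier_mat d d" by (simp_all add: T_def T'_def)
  have T'T: "T' * T = 1\<^sub>m d"
  proof (rule eq_matI)
    fix i k assume "i < dim_row (1\<^sub>m d :: 'b mat)" "k < dim_col (1\<^sub>m d :: 'b mat)"
    then have ik: "i < d" "k < d" by auto
    have "(T' * T) $$ (i, k) = (\<Sum>l<d. T' $$ (i, l) * T $$ (l, k))" by (rule index_mult_mat_sum[OF carr(2,1) ik])
    also have "\<dots> = (\<Sum>l<d. ((if l = i then a' i else 0) + (if l = \<tau> i then b' i else 0)) * T $$ (l, k))"
      using ik by (intro sum.cong) (auto simp: T'_def)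
    also have "\<dots> = a' i * T $$ (i, k) + b' i * T $$ (\<tau> i, k)" by (rule sum_two_terms[OF ik(1) \<tau>(1)[OF ik(1)]])
    also have "\<dots> = a' i * ((if k = i then 1 else 0) + (if k = \<tau> i then b i else 0)) +
        b' i * ((if k = \<tau> i then 1 else 0) + (if k = i then b (\<tau> i) else 0))"
      using ik \<tau>[OF ik(1)] by (simp add: T_def)
    also have "\<dots> = (if i = k then 1 else 0)"
    proof -
      consider "\<tau> i = i" | "i < \<tau> i" | "\<tau> i < i" by linarith
      then show ?thesis
        by cases (use \<tau>(2)[OF ik(1)] c[OF ik(1)] in \<open>auto simp: a'_def b'_def b_def field_simps\<close>)
    qed
    finally show "(T' * T) $$ (i, k) = 1\<^sub>m d $$ (i, k)" using ik by simp
  qed (use carr in auto)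
  then have TT': "T * T' = 1\<^sub>m d" by (rule mat_mult_left_right_inverse[OF carr(2,1)])
  have TC: "T * ?C = mat_diag d D * T"
  proof (rule eq_matI)
    fix i k assume "i < dim_row (mat_diag d D * T)" "k < dim_col (mat_diag d D * T)"
    then have ik: "i < d" "k < d" using carr by (auto simp: mat_diag_def)
    have "(T * ?C) $$ (i, k) = (\<Sum>l<d. T $$ (i, l) * ?C $$ (l, k))" by (rule index_mult_mat_sum[OF carr(1) pair_mat_carrier ik])
    also have "\<dots> = (\<Sum>l<d. ((if l = i then 1 else 0) + (if l = \<tau> i then b i else 0)) * ?C $$ (l, k))"
      using ik by (intro sum.cong) (auto simp: T_def)
    also have "\<dots> = 1 * ?C $$ (i, k) + b i * ?C $$ (\<tau> i, k)" by (rule sum_two_terms[OF ik(1) \<tau>(1)[OF ik(1)]])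
    also have "\<dots> = (if k = \<tau> i then c i else 0) + b i * (if k = i then c (\<tau> i) else 0)"
      using ik \<tau>[OF ik(1)] by (simp add: pair_mat_def)
    also have "\<dots> = D i * ((if k = i then 1 else 0) + (if k = \<tau> i then b i else 0))"
    proof -
      consider "\<tau> i = i" | "i < \<tau> i" | "\<tau> i < i" by linarith
      then show ?thesis
        by cases (use c[OF ik(1)] in \<open>auto simp: D_def b_def\<close>)
    qed
    also have "\<dots> = D i * T $$ (i, k)" using ik by (simp add: T_def)
    also have "\<dots> = (mat_diag d D * T) $$ (i, k)"
      using ik mat_diag_mult_left[OF carr(1)] by simp
    finally show "(T * ?C) $$ (i, k) = (mat_diag d D * T) $$ (i, k)" .
  qed (use carr in \<open>auto simp: mat_diag_def pair_mat_def\<close>)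
  have "?C = T' * (T * ?C)" using carr by (simp add: assoc_mult_mat[symmetric, of _ d d _ d _ d] T'T left_mult_one_mat[OF pair_mat_carrier])
  then have "?C = T' * mat_diag d D * T"
    unfolding TC using carr by (simp add: assoc_mult_mat[symmetric, of _ d d _ d _ d])
  then have "similar_mat ?C (mat_diag d D)"
    by (intro similar_matI[of _ _ T' T d]) (use carr T'T TT' in auto)
  then have "char_poly ?C = char_poly (mat_diag d D)" by (rule char_poly_similar)
  then show ?thesis by (simp only: char_poly_mat_diag D_def)
qed

lemma prod_linear_signs:
  fixes D :: "nat \<Rightarrow> 'b::field_char_0"
  assumes "\<And>i. i < d \<Longrightarrow> D i = 1 \<or> D i = -1"
  shows "(\<Prod>i<d. [:- D i, 1:]) = [:-1, 1:] ^ card {i. i < d \<and> D i = 1} * [:1, 1:] ^ card {i. i < d \<and> D i \<noteq> 1}"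
proof -
  have "(\<Prod>i<d. [:- D i, 1:]) = (\<Prod>i<d. if D i = 1 then [:-1, 1:] else [:1, 1:])"
  proof (rule prod.cong[OF refl])
    fix i assume "i \<in> {..<d}"
    then have "D i = 1 \<or> D i = -1" using assms by simp
    then show "[:- D i, 1:] = (if D i = 1 then [:-1, 1:] else [:1, 1:])" by auto
  qed
  also have "\<dots> = [:-1, 1:] ^ card ({..<d} \<inter> {i. D i = 1}) * [:1, 1:] ^ card ({..<d} \<inter> - {i. D i = 1})"
    by (subst prod.If_cases) simp_all
  also have "{..<d} \<inter> {i. D i = 1} = {i. i < d \<and> D i = 1}" by auto
  also have "{..<d} \<inter> - {i. D i = 1} = {i. i < d \<and> D i \<noteq> 1}" by auto
  finally show ?thesis .
qed

lemma standard_char_poly_eq: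
  "([:0, 1:] ^ 2 - 1) ^ n * ([:0, 1:] - 1) = ([:-1, 1:] ^ Suc n * [:1, 1:] ^ n :: 'b::field_char_0 poly)"
proof -
  have "[:0, 1:] ^ 2 - 1 = ([:-1, 1:] * [:1, 1:] :: 'b poly)" by (simp add: power2_eq_square one_pCons)
  moreover have "[:0, 1:] - 1 = ([:-1, 1:] :: 'b poly)" by (simp add: one_pCons)
  moreover have "(P * Q) ^ n * P = P ^ Suc n * Q ^ n" for P Q :: "'b poly"
    by (simp add: power_mult_distrib mult_ac)
  ultimately show ?thesis by (simp only:)
qed

text \<open>The exponent \<open>a\<close> is the multiplicity of the root 1.\<close>

lemma linear_powers_eq_imp:
  assumes "[:-1, 1:] ^ a * [:1, 1:] ^ b = ([:-1, 1:] ^ a' * [:1, 1:] ^ b' :: 'b::field_char_0 poly)"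
  shows "a = a'"
proof -
  have ord: "order 1 ([:-1, 1:] ^ a * [:1, 1:] ^ b :: 'b poly) = a" for a b
  proof -
    have "order 1 ([:-1, 1:] ^ a * [:1, 1:] ^ b :: 'b poly) = order 1 ([:-1, 1:] ^ a :: 'b poly) + order 1 ([:1, 1:] ^ b :: 'b poly)"
      by (rule order_mult) simp
    also have "order 1 ([:1, 1:] ^ b :: 'b poly) = 0" by (rule order_0I) simp
    also have "order 1 ([:-1, 1:] ^ a :: 'b poly) = a" by (rule order_power_n_n)
    finally show ?thesis by simp
  qed
  show ?thesis using arg_cong[OF assms, of "order 1"] by (simp only: ord)
qed

context herm_matrices
begin

lemma form_index:
  assumes x: "x \<in> carrier_mat d d" and A: "A \<in> carrier_mat a d" and ik: "i < a" "k < a"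
    and g: "\<And>i l. i < a \<Longrightarrow> l < d \<Longrightarrow> A $$ (i, l) = g i l"
  shows "(A * x * ct A) $$ (i, k) = vform (vinv x (g i)) (g k)"
proof -
  have "(A * x * ct A) $$ (i, k) = (\<Sum>j<d. (A * x) $$ (i, j) * ct A $$ (j, k))"
    by (rule index_mult_mat_sum[of _ a d _ a]) (use x A ik in auto)
  also have "\<dots> = (\<Sum>j<d. (\<Sum>l<d. g i l * x $$ (l, j)) * \<sigma> (g k j))"
  proof (rule sum.cong[OF refl])
    fix j assume "j \<in> {..<d}"
    then have j: "j < d" by simp
    have "(A * x) $$ (i, j) = (\<Sum>l<d. A $$ (i, l) * x $$ (l, j))" by (rule index_mult_mat_sum[OF A x ik(1) j])
    also have "\<dots> = (\<Sum>l<d. g i l * x $$ (l, j))" by (rule sum.cong) (use g ik in auto)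
    finally show "(A * x) $$ (i, j) * ct A $$ (j, k) = (\<Sum>l<d. g i l * x $$ (l, j)) * \<sigma> (g k j)"
      using A ik j g by simp
  qed
  also have "\<dots> = (\<Sum>j<d. (\<Sum>l<d. g i l * x $$ (l, d - Suc j)) * \<sigma> (g k (d - Suc j)))"
    by (rule sum.nat_diff_reindex[symmetric])
  also have "\<dots> = vform (vinv x (g i)) (g k)" by (simp add: vform_def vinv_def)
  finally show ?thesis .
qed

lemma gram_form_index:
  assumes A: "A \<in> carrier_mat a d" and ik: "i < a" "k < a"
    and g: "\<And>i l. i < a \<Longrightarrow> l < d \<Longrightarrow> A $$ (i, l) = g i l"
  shows "(A * J * ct A) $$ (i, k) = vform (g i) (g k)"
  unfolding gram_index[OF A A ik] vform_def using ik by (intro sum.cong) (auto simp: g)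

text \<open>Let \<open>A\<close> have the basis vectors as rows. Then
  \<open>A * (x * J) = pair_mat d \<tau> c * A\<close>, and \<open>A\<close> is invertible because
  its Gram matrix is the permutation matrix of \<open>\<tau>\<close>, which is its own
  inverse.\<close>

lemma similar_pair_mat:
  assumes x: "hermitian x" and W: "herm_space.witt_system \<pi> vscale vform (vinv x) int_vectors d g \<tau> c"
  shows "char_poly (x * J) = char_poly (pair_mat d \<tau> c)"
proof -
  interpret H: herm_space R \<pi> \<sigma> vscale vform "vinv x" by (rule herm_space_axioms'[OF x])
  note D = H.witt_systemD[OF W]
  have xc: "x \<in> carrier_mat d d" using x by (simp add: hermitian_def isometry_def)
  define A where "A = mat d d (\<lambda>(i, k). g i k)"
  let ?P = "pair_mat d \<tau> (\<lambda>_. 1) :: 'a mat"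
  have A: "A \<in> carrier_mat d d" by (simp add: A_def)
  have "A * J * ct A = ?P"
  proof (rule eq_matI)
    fix i k assume "i < dim_row ?P" "k < dim_col ?P"
    then have ik: "i < d" "k < d" by (auto simp: pair_mat_def)
    then show "(A * J * ct A) $$ (i, k) = ?P $$ (i, k)"
      using gram_form_index[OF A ik, of g] D(7)[OF ik] by (simp add: A_def pair_mat_def)
  qed (use A in \<open>auto simp: pair_mat_def\<close>)
  moreover have PP: "?P * ?P = 1\<^sub>m d"
  proof (rule eq_matI)
    fix i k assume "i < dim_row (1\<^sub>m d :: 'a mat)" "k < dim_col (1\<^sub>m d :: 'a mat)"
    then have ik: "i < d" "k < d" by auto
    have "(?P * ?P) $$ (i, k) = (\<Sum>l<d. ?P $$ (i, l) * ?P $$ (l, k))" by (rule index_mult_mat_sum) (use ik in auto)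
    also have "\<dots> = (\<Sum>l<d. if l = \<tau> i then ?P $$ (l, k) else 0)"
      by (rule sum.cong) (use ik in \<open>auto simp: pair_mat_def\<close>)
    also have "\<dots> = ?P $$ (\<tau> i, k)" using D(2)[OF ik(1)] by simp
    also have "\<dots> = 1\<^sub>m d $$ (i, k)" using D(2,3)[OF ik(1)] ik by (auto simp: pair_mat_def)
    finally show "(?P * ?P) $$ (i, k) = 1\<^sub>m d $$ (i, k)" .
  qed (auto simp: pair_mat_def)
  ultimately have "A * J * ct A * ?P = 1\<^sub>m d" by simp
  then have inv: "A * (J * ct A * ?P) = 1\<^sub>m d" using A by (simp add: assoc_sq mult_sq)
  define A' where "A' = J * ct A * ?P"
  have A': "A' \<in> carrier_mat d d" using A by (simp add: A'_def mult_sq)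
  have inv': "A * A' = 1\<^sub>m d" using inv by (simp add: A'_def)
  then have inv2: "A' * A = 1\<^sub>m d" by (rule mat_mult_left_right_inverse[OF A A'])
  have "A * (x * J) = pair_mat d \<tau> c * A"
  proof (rule eq_matI)
    fix i k assume "i < dim_row (pair_mat d \<tau> c * A)" "k < dim_col (pair_mat d \<tau> c * A)"
    then have ik: "i < d" "k < d" using A by (auto simp: pair_mat_def)
    have "(A * (x * J)) $$ (i, k) = (\<Sum>l<d. A $$ (i, l) * (x * J) $$ (l, k))"
      by (rule index_mult_mat_sum) (use A xc ik in \<open>auto simp: mult_sq\<close>)
    also have "\<dots> = (\<Sum>l<d. g i l * x $$ (l, d - Suc k))"
      using ik xc by (intro sum.cong) (auto simp: A_def mult_antidiag_index[of _ d] simp del: index_mult_mat(1))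
    also have "\<dots> = vinv x (g i) k" using ik by (simp add: vinv_def)
    also have "\<dots> = c i * g (\<tau> i) k" using D(4)[OF ik(1)] by (simp add: vscale_def)
    also have "\<dots> = (\<Sum>l<d. if l = \<tau> i then c i * g l k else 0)" using D(2)[OF ik(1)] by simp
    also have "\<dots> = (\<Sum>l<d. pair_mat d \<tau> c $$ (i, l) * A $$ (l, k))"
      by (rule sum.cong) (use ik in \<open>auto simp: pair_mat_def A_def\<close>)
    also have "\<dots> = (pair_mat d \<tau> c * A) $$ (i, k)"
      by (rule index_mult_mat_sum[symmetric]) (use A ik in auto)
    finally show "(A * (x * J)) $$ (i, k) = (pair_mat d \<tau> c * A) $$ (i, k)" .
  qed (use A xc in \<open>auto simp: pair_mat_def\<close>)
  then have "A' * (A * (x * J)) = A' * (pair_mat d \<tau> c * A)" by simp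
  then have "(A' * A) * (x * J) = A' * pair_mat d \<tau> c * A"
    using A A' xc by (simp add: assoc_sq mult_sq)
  then have "x * J = A' * pair_mat d \<tau> c * A" using xc by (simp add: inv2 mult_sq)
  then have "similar_mat (x * J) (pair_mat d \<tau> c)"
    by (intro similar_matI[of _ _ A' A d]) (use A A' xc inv' inv2 in \<open>auto simp: mult_sq\<close>)
  then show ?thesis by (rule char_poly_similar)
qed

text \<open>Counting the root 1 of the characteristic polynomial: each pair contributes one, and
  each fixed point one if the common sign is 1. With sign -1 the pairs alone would have to supply
  \<open>n + 1\<close>, too many for dimension \<open>2 * n + 1\<close>; with sign 1 the count
  leaves exactly one fixed point.\<close>

lemma one_fixed_point:
  assumes x: "hermitian x" and W: "herm_space.witt_system \<pi> vscale vform (vinv x) int_vectors d g \<tau> c"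
    and same: "\<And>i j. i < d \<Longrightarrow> j < d \<Longrightarrow> \<tau> i = i \<Longrightarrow> \<tau> j = j \<Longrightarrow> c i = c j"
    and d: "d = 2 * n + 1" and cp: "char_poly (x * J) = ([:0, 1:] ^ 2 - 1) ^ n * ([:0, 1:] - 1)"
  shows "\<exists>f<d. {i. i < d \<and> \<tau> i = i} = {f} \<and> c f = 1"
proof -
  interpret H: herm_space R \<pi> \<sigma> vscale vform "vinv x" by (rule herm_space_axioms'[OF x])
  note D = H.witt_systemD[OF W]
  define E where "E i = (if \<tau> i = i then c i else if i < \<tau> i then 1 else -1)" for i
  have E1: "E i = 1 \<or> E i = -1" if "i < d" for i using D(5)[OF that] by (auto simp: E_def)
  have "[:-1, 1:] ^ card {i. i < d \<and> E i = 1} * [:1, 1:] ^ card {i. i < d \<and> E i \<noteq> 1} = ([:-1, 1:] ^ Suc n * [:1, 1:] ^ n :: 'a poly)"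
  proof -
    have "(\<Prod>i<d. [:- E i, 1:]) = char_poly (x * J)"
      unfolding similar_pair_mat[OF x W] E_def using H.witt_system_c_mult[OF W] D(2,3)
      by (subst char_poly_pair_mat) auto
    then show ?thesis using prod_linear_signs[of d E, OF E1] cp standard_char_poly_eq[of n, where 'b = 'a] by metis
  qed
  then have cardE: "card {i. i < d \<and> E i = 1} = Suc n" by (rule linear_powers_eq_imp)
  define A1 where "A1 = {i. i < d \<and> i < \<tau> i}"
  define A2 where "A2 = {i. i < d \<and> \<tau> i < i}"
  define F where "F = {i. i < d \<and> \<tau> i = i}"
  have fin: "finite A1" "finite A2" "finite F" by (simp_all add: A1_def A2_def F_def)
  have "bij_betw \<tau> A1 A2"
    by (rule bij_betw_byWitness[of _ \<tau>]) (use D(2,3) in \<open>auto simp: A1_def A2_def\<close>)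
  then have cardA: "card A1 = card A2" by (rule bij_betw_same_card)
  have "{..<d} = A1 \<union> A2 \<union> F" by (auto simp: A1_def A2_def F_def)
  then have "d = card (A1 \<union> A2 \<union> F)" by (metis card_lessThan)
  also have "\<dots> = card (A1 \<union> A2) + card F" by (rule card_Un_disjoint) (use fin in \<open>auto simp: A1_def A2_def F_def\<close>)
  also have "card (A1 \<union> A2) = card A1 + card A2" by (rule card_Un_disjoint) (use fin in \<open>auto simp: A1_def A2_def\<close>)
  finally have dcard: "2 * n + 1 = 2 * card A1 + card F" using cardA d by simp
  have "\<exists>f\<in>F. c f = 1"
  proof (rule ccontr)
    assume "\<not> (\<exists>f\<in>F. c f = 1)"
    then have "{i. i < d \<and> E i = 1} = A1" by (auto simp: E_def A1_def F_def split: if_splits)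
    then show False using cardE dcard by simp
  qed
  then obtain f where f: "f \<in> F" "c f = 1" by blast
  then have "c i = 1" if "i \<in> F" for i using same[of i f] that by (auto simp: F_def)
  then have "{i. i < d \<and> E i = 1} = A1 \<union> F" by (auto simp: E_def A1_def F_def split: if_splits)
  moreover have "card (A1 \<union> F) = card A1 + card F" by (rule card_Un_disjoint) (use fin in \<open>auto simp: A1_def F_def\<close>)
  ultimately have "card F = 1" using cardE dcard by simp
  then have "F = {f}" using f(1) by (auto simp: card_Suc_eq)
  then show ?thesis using f by (auto simp: F_def)
qed

text \<open>From each pair the index with the larger exponent is taken, and the exponents are sorted
  in decreasing order.\<close>

lemma ex_arrangement:
  fixes \<tau> :: "nat \<Rightarrow> nat" and z :: "nat \<Rightarrow> int"
  assumes d: "d = 2 * n + 1" and \<tau>: "\<And>i. i < d \<Longrightarrow> \<tau> i < d" "\<And>i. i < d \<Longrightarrow> \<tau> (\<tau> i) = i"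
    and f: "{i. i < d \<and> \<tau> i = i} = {f}" and z: "\<And>i. i < d \<Longrightarrow> z (\<tau> i) = - z i"
  shows "\<exists>xs. map z xs \<in> dominant n \<and> distinct xs \<and> (\<forall>a\<in>set xs. a < d \<and> a \<noteq> f \<and> \<tau> a \<noteq> f \<and> \<tau> a \<notin> set xs)"
proof -
  \<comment> \<open>If the exponents of a pair are both 0, the smaller index is taken, so that each
    pair is met once.\<close>
  define A where "A = {i. i < d \<and> \<tau> i \<noteq> i \<and> (z i > 0 \<or> z i = 0 \<and> i < \<tau> i)}"
  have fin: "finite A" by (simp add: A_def)
  have fd: "f < d" "\<tau> f = f" using f by auto
  have disj: "A \<inter> \<tau> ` A = {}"
  proof (rule ccontr)
    assume "A \<inter> \<tau> ` A \<noteq> {}"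
    then obtain i where i: "i \<in> A" "\<tau> i \<in> A" by auto
    then have "i < d" by (simp add: A_def)
    then show False using i z[of i] \<tau>[of i] by (auto simp: A_def)
  qed
  have un: "{..<d} - {f} = A \<union> \<tau> ` A"
  proof
    show "A \<union> \<tau> ` A \<subseteq> {..<d} - {f}" using \<tau> fd by (auto simp: A_def)
    show "{..<d} - {f} \<subseteq> A \<union> \<tau> ` A"
    proof
      fix i assume "i \<in> {..<d} - {f}"
      then have i: "i < d" "\<tau> i \<noteq> i" using f by auto
      show "i \<in> A \<union> \<tau> ` A"
      proof (cases "i \<in> A")
        case False
        then have "\<tau> i \<in> A" using i z[OF i(1)] \<tau>[OF i(1)] by (auto simp: A_def)
        then show ?thesis using \<tau>(2)[OF i(1)] by (metis UnI2 imageI)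
      qed simp
    qed
  qed
  have inj: "inj_on \<tau> A" by (rule inj_onI) (metis (no_types, lifting) A_def \<tau>(2) mem_Collect_eq)
  have "card ({..<d} - {f}) = card A + card (\<tau> ` A)"
    unfolding un by (rule card_Un_disjoint) (use fin disj in auto)
  then have cardA: "card A = n" using fd d card_image[OF inj] by simp
  define xs where "xs = sort_key (\<lambda>i. - z i) (sorted_list_of_set A)"
  have set: "set xs = A" and dist: "distinct xs" and len: "length xs = n"
    using fin cardA by (simp_all add: xs_def)
  have "sorted (map (\<lambda>i. - z i) xs)" unfolding xs_def by (rule sorted_sort_key)
  then have "sorted_wrt (\<ge>) (map z xs)" by (simp add: sorted_wrt_map)
  moreover have "0 \<le> z a" if "a \<in> A" for a using that by (auto simp: A_def)
  then have "\<forall>a\<in>set (map z xs). 0 \<le> a" by (simp add: set)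
  ultimately have "map z xs \<in> dominant n" using len by (simp add: dominant_def)
  moreover have "a < d \<and> a \<noteq> f \<and> \<tau> a \<noteq> f \<and> \<tau> a \<notin> A" if "a \<in> A" for a
  proof -
    have "a < d" "\<tau> a \<noteq> a" using that by (simp_all add: A_def)
    moreover have "\<tau> a \<notin> A" using disj that by blast
    ultimately show ?thesis using fd \<tau>(2)[of a] by metis
  qed
  ultimately show ?thesis using dist set by blast
qed

text \<open>The rows of \<open>k\<close> are the Witt basis in a suitable order.\<close>

lemma K_reduction:
  assumes x: "hermitian x" and d: "d = 2 * n + 1"
    and cp: "char_poly (x * J) = ([:0, 1:] ^ 2 - 1) ^ n * ([:0, 1:] - 1)"
  shows "\<exists>k lam. isometry k \<and> elements_mat k \<subseteq> R \<and> lam \<in> dominant n \<and> k * x * ct k = x_diag \<pi> n lam"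
proof -
  interpret H: herm_space R \<pi> \<sigma> vscale vform "vinv x" by (rule herm_space_axioms'[OF x])
  have xc: "x \<in> carrier_mat d d" using x by (simp add: hermitian_def isometry_def)
  obtain g \<tau> c where W: "H.witt_system int_vectors d g \<tau> c"
    and same: "\<And>i j. i < d \<Longrightarrow> j < d \<Longrightarrow> \<tau> i = i \<Longrightarrow> \<tau> j = j \<Longrightarrow> c i = c j"
    using ex_basis[OF x] by blast
  note D = H.witt_systemD[OF W]
  obtain f where f: "f < d" "{i. i < d \<and> \<tau> i = i} = {f}" "c f = 1" using one_fixed_point[OF x W same d cp] by blast
  have "\<exists>z. c i = \<pi> powi z" if "i < d" for i
  proof (cases "\<tau> i = i")
    case True
    then have "i = f" using f(2) that by blast
    then show ?thesis using f(3) by (intro exI[of _ 0]) simp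
  qed (rule D(6)[OF that])
  then obtain z where z: "\<And>i. i < d \<Longrightarrow> c i = \<pi> powi z i" by metis
  \<comment> \<open>The constants of a pair are inverse to each other; at the fixed point this says
    that the exponent is 0.\<close>
  have z\<tau>: "z (\<tau> i) = - z i" if i: "i < d" for i
  proof -
    have "\<pi> powi (z i + z (\<tau> i)) * 1 = \<pi> powi 0 * 1"
      using H.witt_system_c_mult[OF W i] z[OF i] z[OF D(2)[OF i]] by (simp add: power_int_add)
    then have "z i + z (\<tau> i) = 0" by (rule unit_powi_eq[OF unit_1 unit_1])
    then show ?thesis by simp
  qed
  obtain xs where xs: "map z xs \<in> dominant n" "distinct xs"
    "\<And>a. a \<in> set xs \<Longrightarrow> a < d" "\<And>a. a \<in> set xs \<Longrightarrow> a \<noteq> f" "\<And>a. a \<in> set xs \<Longrightarrow> \<tau> a \<noteq> f" "\<And>a. a \<in> set xs \<Longrightarrow> \<tau> a \<notin> set xs"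
  proof -
    have "\<exists>xs. map z xs \<in> dominant n \<and> distinct xs \<and> (\<forall>a\<in>set xs. a < d \<and> a \<noteq> f \<and> \<tau> a \<noteq> f \<and> \<tau> a \<notin> set xs)"
      by (rule ex_arrangement[OF d _ _ f(2)]) (simp_all add: D(2,3) z\<tau>)
    then show ?thesis using that by blast
  qed
  have len: "length xs = n" using xs(1) by (simp add: dominant_def)
  \<comment> \<open>The selected members of the pairs come first, then the fixed point, then the
    partners in reverse order; this turns \<open>\<tau>\<close> into
    \<open>i \<mapsto> d - Suc i\<close>, the permutation of \<open>J\<close>.\<close>
  define \<rho> where "\<rho> i = (if i < n then xs ! i else if i = n then f else \<tau> (xs ! (2 * n - i)))" for i
  have \<tau>f: "\<tau> f = f" using f by auto
  have xsi: "xs ! i \<in> set xs" if "i < n" for i using that len by simp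
  have \<rho>d: "\<rho> i < d" if "i < d" for i
    using that d f(1) xs(3)[OF xsi] D(2) xsi by (auto simp: \<rho>_def)
  have \<rho>_rev: "\<tau> (\<rho> i) = \<rho> (d - Suc i)" if i: "i < d" for i
  proof -
    consider "i < n" | "i = n" | "n < i" by linarith
    then show ?thesis
    proof cases
      case 1
      then show ?thesis by (auto simp: \<rho>_def d)
    next
      case 2
      then show ?thesis by (simp add: \<rho>_def d \<tau>f)
    next
      case 3
      have "2 * n - i < n" using 3 i d by linarith
      then show ?thesis using 3 D(3)[OF xs(3)[OF xsi]] by (simp add: \<rho>_def d)
    qed
  qed
  have \<rho>_inj: "\<rho> i = \<rho> k \<longleftrightarrow> i = k" if ik: "i < d" "k < d" for i k
  proof
    assume e: "\<rho> i = \<rho> k"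
    have \<tau>inj: "\<tau> a = \<tau> b \<Longrightarrow> a = b" if "a \<in> set xs" "b \<in> set xs" for a b
      using D(3)[OF xs(3)[OF that(1)]] D(3)[OF xs(3)[OF that(2)]] by metis
    have lo: "\<rho> i = xs ! i" "xs ! i \<in> set xs" if "i < n" for i using that xsi by (auto simp: \<rho>_def)
    have hi: "\<rho> i = \<tau> (xs ! (2 * n - i))" "xs ! (2 * n - i) \<in> set xs" "2 * n - i < n" if "n < i" "i < d" for i
      using that d len by (auto simp: \<rho>_def)
    have mid: "\<rho> n = f" by (simp add: \<rho>_def)
    have nth: "xs ! i = xs ! k \<Longrightarrow> i = k" if "i < n" "k < n" for i k
      using that xs(2) len by (simp add: nth_eq_iff_index_eq)
    consider "i < n" | "i = n" | "n < i" by linarith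
    then show "i = k"
    proof cases
      case 1
      consider "k < n" | "k = n" | "n < k" by linarith
      then show ?thesis
      proof cases
        case A: 1
        then show ?thesis using e lo[OF 1] lo[OF A] nth[OF 1 A] by simp
      next
        case 2
        then show ?thesis using e lo[OF 1] mid xs(4) by metis
      next
        case 3
        then show ?thesis using e lo[OF 1] hi[OF 3 ik(2)] xs(6) by metis
      qed
    next
      case 2
      consider "k < n" | "k = n" | "n < k" by linarith
      then show ?thesis
      proof cases
        case A: 1
        then show ?thesis using e lo[OF A] mid 2 xs(4) by metis
      next
        case A: 2
        then show ?thesis using 2 by simp
      next
        case 3
        then show ?thesis using e hi[OF 3 ik(2)] mid 2 xs(5) by metis
      qed
    next
      case 3
      consider "k < n" | "k = n" | "n < k" by linarith
      then show ?thesis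
      proof cases
        case 1
        then show ?thesis using e lo[OF 1] hi[OF 3 ik(1)] xs(6) by metis
      next
        case 2
        then show ?thesis using e hi[OF 3 ik(1)] mid xs(5) by metis
      next
        case A: 3
        then have "xs ! (2 * n - i) = xs ! (2 * n - k)" using e hi[OF 3 ik(1)] hi[OF A ik(2)] \<tau>inj by metis
        then have "2 * n - i = 2 * n - k" using nth hi(3)[OF 3 ik(1)] hi(3)[OF A ik(2)] by blast
        then show ?thesis using ik d 3 A by linarith
      qed
    qed
  qed simp
  define k where "k = mat d d (\<lambda>(i, l). g (\<rho> i) l)"
  have kc: "k \<in> carrier_mat d d" by (simp add: k_def)
  have kg: "k $$ (i, l) = g (\<rho> i) l" if "i < d" "l < d" for i l using that by (simp add: k_def)
  have "k * J * ct k = J"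
  proof (rule eq_matI)
    fix i l assume "i < dim_row J" "l < dim_col J"
    then have il: "i < d" "l < d" by auto
    have "(k * J * ct k) $$ (i, l) = vform (g (\<rho> i)) (g (\<rho> l))"
      by (rule gram_form_index[OF kc il, of "\<lambda>i. g (\<rho> i)"]) (rule kg)
    also have "\<dots> = (if \<rho> l = \<rho> (d - Suc i) then 1 else 0)"
      using D(7)[OF \<rho>d[OF il(1)] \<rho>d[OF il(2)]] \<rho>_rev[OF il(1)] by simp
    also have "\<dots> = J $$ (i, l)" using \<rho>_inj[of l "d - Suc i"] il by simp
    finally show "(k * J * ct k) $$ (i, l) = J $$ (i, l)" .
  qed (use kc in auto)
  then have iso: "isometry k" using kc by (simp add: isometry_def)
  have "elements_mat k \<subseteq> R"
    using D(1)[OF \<rho>d] by (auto simp: elements_mat_def k_def int_vectors_def)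
  moreover have "k * x * ct k = x_diag \<pi> n (map z xs)"
  proof (rule eq_matI)
    fix i l assume "i < dim_row (x_diag \<pi> n (map z xs))" "l < dim_col (x_diag \<pi> n (map z xs))"
    then have il: "i < d" "l < d" by (auto simp: x_diag_def d mat_diag_def)
    have "(k * x * ct k) $$ (i, l) = vform (vinv x (g (\<rho> i))) (g (\<rho> l))"
      by (rule form_index[OF xc kc il, of "\<lambda>i. g (\<rho> i)"]) (rule kg)
    also have "\<dots> = c (\<rho> i) * vform (g (\<tau> (\<rho> i))) (g (\<rho> l))"
      using D(4)[OF \<rho>d[OF il(1)]] by (simp add: H.B_scale_left)
    also have "\<dots> = (if i = l then c (\<rho> i) else 0)"
      using D(7)[OF D(2)[OF \<rho>d[OF il(1)]] \<rho>d[OF il(2)]] D(3)[OF \<rho>d[OF il(1)]] \<rho>_inj[OF il] by auto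
    also have "c (\<rho> i) = (if i < n then \<pi> powi (map z xs ! i) else if i = n then 1 else \<pi> powi (- (map z xs ! (2 * n - i))))"
    proof -
      consider "i < n" | "i = n" | "n < i" by linarith
      then show ?thesis
      proof cases
        case 1
        then show ?thesis using z[OF \<rho>d[OF il(1)]] len by (simp add: \<rho>_def)
      next
        case 2
        then show ?thesis using f by (simp add: \<rho>_def)
      next
        case 3
        have "2 * n - i < n" using 3 il d by linarith
        then show ?thesis using 3 z[OF \<rho>d[OF il(1)]] z\<tau>[OF xs(3)[OF xsi]] len by (simp add: \<rho>_def)
      qed
    qed
    finally show "(k * x * ct k) $$ (i, l) = x_diag \<pi> n (map z xs) $$ (i, l)"
      using il by (simp add: x_diag_def d)
  qed (use kc d in \<open>auto simp: x_diag_def mat_diag_def\<close>)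
  ultimately show ?thesis using iso xs(1) by blast
qed

end

section \<open>Diagonal forms and orbits of the full group\<close>

locale herm_odd = herm_matrices R \<pi> \<sigma> d for R :: "'a::field_char_0 set" and \<pi> \<sigma> d +
  fixes n :: nat
  assumes d: "d = 2 * n + 1" and n: "n \<ge> 1"
begin

lemma sum_odd_split: "(\<Sum>l<d. f l) = (\<Sum>l<n. f l) + f n + (\<Sum>l<n. f (2 * n - l))" for f :: "nat \<Rightarrow> 'b::comm_monoid_add"
proof -
  have "(\<Sum>l<d. f l) = (\<Sum>l<n + Suc n. f l)" by (simp add: d mult_2)
  also have "\<dots> = (\<Sum>l<n. f l) + (\<Sum>l<Suc n. f (n + l))" by (rule sum_lessThan_add)
  also have "(\<Sum>l<Suc n. f (n + l)) = f n + (\<Sum>l<n. f (n + Suc l))"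
    by (simp add: sum.lessThan_Suc_shift del: sum.lessThan_Suc)
  also have "(\<Sum>l<n. f (n + Suc l)) = (\<Sum>l<n. f (n + Suc (n - Suc l)))"
    by (rule sum.nat_diff_reindex[symmetric])
  also have "\<dots> = (\<Sum>l<n. f (2 * n - l))"
    by (rule sum.cong) (auto intro!: arg_cong[of _ _ f])
  finally show ?thesis by (simp add: add.assoc)
qed

text \<open>A diagonal matrix fixed by \<open>\<sigma>\<close> preserves \<open>J\<close> only if
  mirrored entries are inverse to each other; the middle entry is then 1 or -1, and the
  characteristic polynomial selects 1.\<close>

definition diag_entry :: "(nat \<Rightarrow> 'a) \<Rightarrow> nat \<Rightarrow> 'a" where
  "diag_entry \<delta> i = (if i < n then \<delta> i else if i = n then 1 else inverse (\<delta> (2 * n - i)))"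

definition form_mat :: "(nat \<Rightarrow> 'a) \<Rightarrow> 'a mat" where
  "form_mat \<delta> = mat_diag d (diag_entry \<delta>)"

lemma form_mat_carrier [simp]: "form_mat \<delta> \<in> carrier_mat d d"
  by (simp add: form_mat_def)

lemma diag_entry_rev:
  assumes "i < d" "\<And>i. i < n \<Longrightarrow> \<delta> i \<noteq> 0"
  shows "diag_entry \<delta> i * diag_entry \<delta> (d - Suc i) = 1"
proof -
  consider "i < n" | "i = n" | "n < i" by linarith
  then show ?thesis
  proof cases
    case 1
    then show ?thesis using assms by (auto simp: diag_entry_def d)
  next
    case 2
    then show ?thesis by (simp add: diag_entry_def d)
  next
    case 3
    have "2 * n - i < n" using 3 assms(1) d by linarith
    then show ?thesis using 3 assms by (simp add: diag_entry_def d)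
  qed
qed

lemma form_mat_J: "form_mat \<delta> * J = pair_mat d (\<lambda>i. d - Suc i) (diag_entry \<delta>)"
proof (rule eq_matI)
  fix i k assume "i < dim_row (pair_mat d (\<lambda>i. d - Suc i) (diag_entry \<delta>))" "k < dim_col (pair_mat d (\<lambda>i. d - Suc i) (diag_entry \<delta>))"
  then have ik: "i < d" "k < d" by (auto simp: pair_mat_def)
  have "(form_mat \<delta> * J) $$ (i, k) = form_mat \<delta> $$ (i, d - Suc k)" by (rule mult_antidiag_index) (use ik in auto)
  also have "\<dots> = (if i = d - Suc k then diag_entry \<delta> i else 0)" using ik by (simp add: form_mat_def)
  also have "\<dots> = pair_mat d (\<lambda>i. d - Suc i) (diag_entry \<delta>) $$ (i, k)" using ik by (auto simp: pair_mat_def)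
  finally show "(form_mat \<delta> * J) $$ (i, k) = pair_mat d (\<lambda>i. d - Suc i) (diag_entry \<delta>) $$ (i, k)" .
qed (auto simp: pair_mat_def form_mat_def mat_diag_def)

definition in_X :: "'a mat \<Rightarrow> bool" where
  "in_X x \<longleftrightarrow> hermitian x \<and> char_poly (x * J) = ([:0, 1:] ^ 2 - 1) ^ n * ([:0, 1:] - 1)"

lemma form_mat_in_X:
  assumes \<delta>: "\<And>i. i < n \<Longrightarrow> \<delta> i \<noteq> 0" "\<And>i. i < n \<Longrightarrow> \<sigma> (\<delta> i) = \<delta> i"
  shows "in_X (form_mat \<delta>)"
proof -
  have \<sigma>d: "\<sigma> (diag_entry \<delta> i) = diag_entry \<delta> i" if "i < d" for i
    using that d \<delta>(2) by (auto simp: diag_entry_def)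
  have ctX: "ct (form_mat \<delta>) = form_mat \<delta>"
    by (rule eq_matI) (auto simp: form_mat_def mat_diag_def \<sigma>d)
  have "form_mat \<delta> * J * ct (form_mat \<delta>) = J"
  proof (rule eq_matI)
    fix i k assume "i < dim_row J" "k < dim_col J"
    then have ik: "i < d" "k < d" by auto
    have "(form_mat \<delta> * J * ct (form_mat \<delta>)) $$ (i, k) = (\<Sum>l<d. form_mat \<delta> $$ (i, l) * \<sigma> (form_mat \<delta> $$ (k, d - Suc l)))"
      by (rule gram_index) (use ik in auto)
    also have "\<dots> = (\<Sum>l<d. if l = i then diag_entry \<delta> i * \<sigma> (form_mat \<delta> $$ (k, d - Suc i)) else 0)"
      by (rule sum.cong) (use ik in \<open>auto simp: form_mat_def\<close>)
    also have "\<dots> = diag_entry \<delta> i * \<sigma> (form_mat \<delta> $$ (k, d - Suc i))" using ik by simp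
    also have "\<dots> = (if k = d - Suc i then diag_entry \<delta> i * diag_entry \<delta> (d - Suc i) else 0)" using ik by (simp add: form_mat_def \<sigma>d)
    also have "\<dots> = J $$ (i, k)" using ik diag_entry_rev[of i \<delta>, OF ik(1) \<delta>(1)] by simp
    finally show "(form_mat \<delta> * J * ct (form_mat \<delta>)) $$ (i, k) = J $$ (i, k)" .
  qed (auto simp: form_mat_def mat_diag_def)
  then have "hermitian (form_mat \<delta>)" using ctX by (simp add: hermitian_def isometry_def)
  moreover have "char_poly (form_mat \<delta> * J) = ([:0, 1:] ^ 2 - 1) ^ n * ([:0, 1:] - 1)"
  proof -
    \<comment> \<open>The reversal fixes only the middle index, whose entry is 1; so the eigenvalue
      1 occurs \<open>n + 1\<close> times and -1 occurs \<open>n\<close> times.\<close>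
    define E :: "nat \<Rightarrow> 'a" where "E i = (if d - Suc i = i then diag_entry \<delta> i else if i < d - Suc i then 1 else -1)" for i
    have E: "E i = (if i \<le> n then 1 else -1)" if "i < d" for i
      using that d by (auto simp: E_def diag_entry_def)
    have "char_poly (form_mat \<delta> * J) = (\<Prod>i<d. [:- E i, 1:])"
      unfolding form_mat_J E_def by (rule char_poly_pair_mat) (auto simp: diag_entry_rev[OF _ \<delta>(1)])
    also have "\<dots> = [:-1, 1:] ^ card {i. i < d \<and> E i = 1} * [:1, 1:] ^ card {i. i < d \<and> E i \<noteq> 1}"
      by (rule prod_linear_signs) (auto simp: E)
    also have "{i. i < d \<and> E i = 1} = {..n}" using d E by (auto split: if_splits)
    also have "{i. i < d \<and> E i \<noteq> 1} = {n<..<d}" using E by (auto split: if_splits)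
    finally show ?thesis unfolding standard_char_poly_eq by (simp add: d)
  qed
  ultimately show ?thesis by (simp add: in_X_def)
qed

text \<open>Multiplication by \<open>J\<close> turns the action into conjugation:
  \<open>g * x * ct g * J\<close> is \<open>x * J\<close> conjugated by \<open>g\<close>, whose
  inverse is \<open>J * ct g * J\<close>.\<close>

lemma in_X_act:
  assumes x: "in_X x" and g: "isometry g"
  shows "in_X (g * x * ct g)"
proof -
  have gc: "g \<in> carrier_mat d d" using g by (simp add: isometry_def)
  have xc: "x \<in> carrier_mat d d" and xi: "isometry x" and xs: "ct x = x" using x by (auto simp: in_X_def hermitian_def isometry_def)
  have gi: "isometry (ct g)" using isometry_iff[of g] isometry_def[of "ct g"] g by auto
  have "isometry (g * x * ct g)" by (intro isometry_mult g xi gi)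
  moreover have "ct (g * x * ct g) = g * x * ct g"
    using gc xc xs by (simp add: ct_mult[of _ d d _ d] assoc_sq mult_sq)
  moreover have "char_poly (g * x * ct g * J) = char_poly (x * J)"
  proof -
    have "g * (x * J) * (J * ct g * J) = g * x * (J * (J * (ct g * J)))"
      using gc xc by (simp add: assoc_sq mult_sq)
    also have "\<dots> = g * x * ct g * J"
      using gc xc by (subst antidiag_cancel_left[of _ _ d]) (simp_all add: assoc_sq mult_sq)
    finally have "similar_mat (g * x * ct g * J) (x * J)"
      by (intro similar_matI[of _ _ g "J * ct g * J" d])
        (use isometry_inverse[OF g] gc xc in \<open>auto simp: mult_sq\<close>)
    then show ?thesis by (rule char_poly_similar)
  qed
  ultimately show ?thesis using x by (simp add: in_X_def hermitian_def)
qed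

lemma act_inverse:
  assumes g: "isometry g" and x: "x \<in> carrier_mat d d" and y: "g * x * ct g = y"
  shows "(J * ct g * J) * y * ct (J * ct g * J) = x"
proof -
  define h where "h = J * ct g * J"
  have gc: "g \<in> carrier_mat d d" using g by (simp add: isometry_def)
  have hc: "h \<in> carrier_mat d d" using gc by (simp add: h_def mult_sq)
  have hg: "h * g = 1\<^sub>m d" "g * h = 1\<^sub>m d" using isometry_inverse[OF g] by (simp_all add: h_def)
  have "h * y * ct h = (h * g) * x * (ct g * ct h)"
    unfolding y[symmetric] using gc hc x by (simp add: assoc_sq mult_sq)
  also have "ct g * ct h = ct (h * g)" using gc hc by (simp add: ct_mult[of _ d d _ d])
  finally have "h * y * ct h = x" using x by (simp add: hg)
  then show ?thesis by (simp only: h_def)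
qed

lemma act_act:
  assumes "g \<in> carrier_mat d d" "h \<in> carrier_mat d d" "x \<in> carrier_mat d d"
  shows "(h * g) * x * ct (h * g) = h * (g * x * ct g) * ct h"
  using assms by (simp add: ct_mult[of _ d d _ d] assoc_sq mult_sq)

text \<open>If \<open>g\<close> maps the identity to \<open>X\<^sub>\<delta>\<close>, it maps the \<open>-1\<close>-eigenspaces of the associated
  involutions isometrically onto each other; comparing their Gram determinants shows that the product
  of the \<open>\<delta>\<^sub>i\<close> is a norm.\<close>

lemma orbit_one_norm:
  assumes \<delta>: "\<And>i. i < n \<Longrightarrow> \<delta> i \<noteq> 0" "\<And>i. i < n \<Longrightarrow> \<sigma> (\<delta> i) = \<delta> i"
    and g: "isometry g" and gX: "g * ct g = form_mat \<delta>"
  shows "\<exists>a. (\<Prod>i<n. \<delta> i) = a * \<sigma> a"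
proof -
  have gc: "g \<in> carrier_mat d d" and gJ: "g * J * ct g = J" "ct g * J * g = J"
    using g isometry_iff[of g] by (auto simp: isometry_def)
  have "form_mat \<delta> * J * g = g * (ct g * J * g)" unfolding gX[symmetric] using gc by (simp add: assoc_sq mult_sq)
  then have eq: "form_mat \<delta> * J * g = g * J" by (simp add: gJ)
  have ent: "g $$ (i, d - Suc l) = diag_entry \<delta> i * g $$ (d - Suc i, l)" if il: "i < d" "l < d" for i l
  proof -
    have "g $$ (i, d - Suc l) = (g * J) $$ (i, l)" using gc il by (simp add: mult_antidiag_index[of _ d] del: index_mult_mat(1))
    also have "\<dots> = (\<Sum>m<d. (form_mat \<delta> * J) $$ (i, m) * g $$ (m, l))"
      unfolding eq[symmetric] by (rule index_mult_mat_sum[of _ d d _ d]) (use gc il in \<open>auto simp: mult_sq\<close>)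
    also have "\<dots> = (\<Sum>m<d. if m = d - Suc i then diag_entry \<delta> i * g $$ (d - Suc i, l) else 0)"
      unfolding form_mat_J by (rule sum.cong) (use il in \<open>auto simp: pair_mat_def\<close>)
    finally show ?thesis using il by simp
  qed
  \<comment> \<open>Image under \<open>g\<close> of an eigenvector for -1 of the involution that
    belongs to \<open>form_mat \<delta>\<close>; as \<open>g\<close> intertwines the involutions, it
    is negated by the reversal of its coordinates.\<close>
  define r where "r i l = g $$ (i, l) - \<delta> i * g $$ (2 * n - i, l)" for i l
  have rev: "r i (2 * n - l) = - r i l" if il: "i < n" "l < d" for i l
  proof -
    have i: "i < d" "2 * n - i < d" "d - Suc i = 2 * n - i" "d - Suc l = 2 * n - l" "d - Suc (2 * n - i) = i"
      using il d by auto
    have "g $$ (i, 2 * n - l) = \<delta> i * g $$ (2 * n - i, l)"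
      using ent[OF i(1) il(2)] il(1) by (simp add: i(3,4) diag_entry_def)
    moreover have "g $$ (2 * n - i, 2 * n - l) = inverse (\<delta> i) * g $$ (i, l)"
    proof -
      have "diag_entry \<delta> (2 * n - i) = inverse (\<delta> i)" using il(1) by (auto simp: diag_entry_def)
      then show ?thesis using ent[OF i(2) il(2)] unfolding i(4,5) by simp
    qed
    ultimately show ?thesis using \<delta>(1)[OF il(1)] by (simp add: r_def)
  qed
  have rn: "r i n = 0" if "i < n" for i
    using rev[OF that, of n] d by (simp add: eq_neg_iff_add_eq_0 flip: mult_2)
  have gram: "(\<Sum>l<d. g $$ (i, l) * \<sigma> (g $$ (k, 2 * n - l))) = (if k = 2 * n - i then 1 else 0)" if ik: "i < d" "k < d" for i k
  proof -
    have "(g * J * ct g) $$ (i, k) = (\<Sum>l<d. g $$ (i, l) * \<sigma> (g $$ (k, d - Suc l)))"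
      by (rule gram_index[OF gc gc ik])
    moreover have "d - Suc l = 2 * n - l" for l by (simp add: d)
    ultimately show ?thesis using ik by (simp add: gJ)
  qed
  \<comment> \<open>For vectors negated by the reversal, the form of \<open>J\<close> is -2 times
    the standard Hermitian product of their first \<open>n\<close> coordinates; as \<open>g\<close>
    is an isometry, the Gram matrix is also -2 times the diagonal matrix of
    \<open>\<delta>\<close>.\<close>
  have norm: "(\<Sum>l<n. r i l * \<sigma> (r k l)) = (if i = k then \<delta> i else 0)" if ik: "i < n" "k < n" for i k
  proof -
    have dk: "\<sigma> (\<delta> k) = \<delta> k" using \<delta>(2)[OF ik(2)] .
    have i: "i < d" "2 * n - i < d" "k < d" "2 * n - k < d" using ik d by auto
    have "(\<Sum>l<d. r i l * \<sigma> (r k (2 * n - l))) =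
        (\<Sum>l<d. g $$ (i, l) * \<sigma> (g $$ (k, 2 * n - l))) - \<delta> k * (\<Sum>l<d. g $$ (i, l) * \<sigma> (g $$ (2 * n - k, 2 * n - l)))
        - \<delta> i * (\<Sum>l<d. g $$ (2 * n - i, l) * \<sigma> (g $$ (k, 2 * n - l)))
        + \<delta> i * \<delta> k * (\<Sum>l<d. g $$ (2 * n - i, l) * \<sigma> (g $$ (2 * n - k, 2 * n - l)))"
      unfolding sum_distrib_left sum_subtractf[symmetric] sum.distrib[symmetric]
      by (rule sum.cong) (auto simp: r_def dk algebra_simps)
    also have "\<dots> = (if i = k then - 2 * \<delta> i else 0)"
      unfolding gram[OF i(1,3)] gram[OF i(1,4)] gram[OF i(2,3)] gram[OF i(2,4)] using ik by auto
    finally have tot: "(\<Sum>l<d. r i l * \<sigma> (r k (2 * n - l))) = (if i = k then - 2 * \<delta> i else 0)" .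
    have "(\<Sum>l<d. r i l * \<sigma> (r k (2 * n - l))) = - (\<Sum>l<d. r i l * \<sigma> (r k l))"
      unfolding sum_negf[symmetric] by (rule sum.cong) (auto simp: rev[OF ik(2)])
    also have "(\<Sum>l<d. r i l * \<sigma> (r k l)) = (\<Sum>l<n. r i l * \<sigma> (r k l)) + r i n * \<sigma> (r k n) + (\<Sum>l<n. r i (2 * n - l) * \<sigma> (r k (2 * n - l)))"
      by (rule sum_odd_split)
    also have "(\<Sum>l<n. r i (2 * n - l) * \<sigma> (r k (2 * n - l))) = (\<Sum>l<n. r i l * \<sigma> (r k l))"
      using d by (intro sum.cong) (auto simp: rev[OF ik(1)] rev[OF ik(2)])
    finally have "2 * (\<Sum>l<n. r i l * \<sigma> (r k l)) = 2 * (if i = k then \<delta> i else 0)"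
      using tot rn[OF ik(1)] by (auto simp: equation_minus_iff[of _ "_ + _"] minus_equation_iff)
    then show ?thesis by (simp only: mult_cancel_left) simp
  qed
  \<comment> \<open>The square matrix of first halves; its determinant has the required
    norm.\<close>
  define A where "A = mat n n (\<lambda>(i, l). r i l)"
  have A: "A \<in> carrier_mat n n" by (simp add: A_def)
  have "A * ct A = mat_diag n \<delta>"
  proof (rule eq_matI)
    fix i k assume "i < dim_row (mat_diag n \<delta>)" "k < dim_col (mat_diag n \<delta>)"
    then have ik: "i < n" "k < n" by (auto simp: mat_diag_def)
    have "(A * ct A) $$ (i, k) = (\<Sum>l<n. A $$ (i, l) * ct A $$ (l, k))"
      by (rule index_mult_mat_sum) (use A ik in auto)
    also have "\<dots> = (\<Sum>l<n. r i l * \<sigma> (r k l))" using ik by (intro sum.cong) (auto simp: A_def)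
    finally show "(A * ct A) $$ (i, k) = mat_diag n \<delta> $$ (i, k)" using norm[OF ik] ik by simp
  qed (auto simp: A_def mat_diag_def)
  then have "det A * \<sigma> (det A) = det (mat_diag n \<delta>)"
    using det_mult[OF A conj_transpose_carrier[OF A], of \<sigma>] det_ct[OF A] by simp
  also have "det (mat_diag n \<delta>) = (\<Prod>i<n. \<delta> i)"
  proof -
    have "det (mat_diag n \<delta>) = prod_list (diag_mat (mat_diag n \<delta>))"
      by (rule det_upper_triangular[OF _ mat_diag_carrier]) (auto simp: upper_triangular_def mat_diag_def)
    also have "diag_mat (mat_diag n \<delta>) = map \<delta> [0..<n]"
      by (auto simp: diag_mat_def mat_diag_def intro!: map_cong)
    also have "prod_list (map \<delta> [0..<n]) = (\<Prod>i\<in>set [0..<n]. \<delta> i)"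
      by (rule prod.distinct_set_conv_list[symmetric]) simp
    finally show ?thesis by (simp add: lessThan_atLeast0)
  qed
  finally show ?thesis by metis
qed

text \<open>\<open>\<sigma>\<close> fixes \<open>\<pi>\<close> and preserves units, so a norm has
  twice the valuation of its argument.\<close>

lemma norm_even_valuation:
  assumes "\<pi> powi m = a * \<sigma> a"
  shows "even m"
proof -
  have "a \<noteq> 0" using assms by (metis \<pi>_nonzero mult_zero_left power_int_not_zero)
  then obtain k u where u: "unit u" "a = \<pi> powi k * u" using ex_valuation[of a] unfolding unit_def by blast
  have "unit (\<sigma> u)" using u(1) \<sigma>_mem[of "inverse u"] \<sigma>_mem[of u] by (auto simp: unit_def)
  then have uu: "unit (u * \<sigma> u)" by (rule unit_mult[OF u(1)])
  have "\<pi> powi m * 1 = \<pi> powi (k + k) * (u * \<sigma> u)" 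
    unfolding assms u(2) power_int_add[OF disjI1[OF \<pi>_nonzero]] by (simp add: mult_ac)
  then have "m = k + k" by (rule unit_powi_eq[OF unit_1 uu])
  then show ?thesis by simp
qed

text \<open>The rows of \<open>A\<close> are vectors that are orthogonal for the form with diagonal
  \<open>\<delta>\<close> and have norms \<open>\<delta>'\<close>. Determinants make such an
  \<open>A\<close> invertible as soon as the entries of \<open>\<delta>'\<close> are
  nonzero.\<close>

definition form_equiv :: "(nat \<Rightarrow> 'a) \<Rightarrow> (nat \<Rightarrow> 'a) \<Rightarrow> bool" where
  "form_equiv \<delta> \<delta>' \<longleftrightarrow> (\<exists>A. \<forall>i<n. \<forall>k<n. (\<Sum>l<n. A i l * \<delta> l * \<sigma> (A k l)) = (if i = k then \<delta>' i else 0))"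

lemma form_equiv_trans:
  assumes "form_equiv \<delta> \<delta>'" "form_equiv \<delta>' \<delta>''"
  shows "form_equiv \<delta> \<delta>''"
proof -
  obtain A where A: "\<And>i k. i < n \<Longrightarrow> k < n \<Longrightarrow> (\<Sum>l<n. A i l * \<delta> l * \<sigma> (A k l)) = (if i = k then \<delta>' i else 0)"
    using assms(1) unfolding form_equiv_def by blast
  obtain A' where A': "\<And>i k. i < n \<Longrightarrow> k < n \<Longrightarrow> (\<Sum>l<n. A' i l * \<delta>' l * \<sigma> (A' k l)) = (if i = k then \<delta>'' i else 0)"
    using assms(2) unfolding form_equiv_def by blast
  define C where "C i l = (\<Sum>m<n. A' i m * A m l)" for i l
  have "(\<Sum>l<n. C i l * \<delta> l * \<sigma> (C k l)) = (if i = k then \<delta>'' i else 0)" if ik: "i < n" "k < n" for i k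
  proof -
    let ?f = "\<lambda>l m' m. A' i m * \<sigma> (A' k m') * (A m l * \<delta> l * \<sigma> (A m' l))"
    have "(\<Sum>l<n. C i l * \<delta> l * \<sigma> (C k l)) = (\<Sum>l<n. \<Sum>m'<n. \<Sum>m<n. ?f l m' m)"
      unfolding C_def \<sigma>_sum sum_distrib_left sum_distrib_right
      by (intro sum.cong refl) (simp add: mult_ac)
    also have "\<dots> = (\<Sum>m'<n. \<Sum>l<n. \<Sum>m<n. ?f l m' m)"
      by (rule sum.swap)
    also have "\<dots> = (\<Sum>m'<n. \<Sum>m<n. \<Sum>l<n. ?f l m' m)"
      by (intro sum.cong refl sum.swap)
    also have "\<dots> = (\<Sum>m'<n. \<Sum>m<n. A' i m * \<sigma> (A' k m') * (if m = m' then \<delta>' m else 0))"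
      unfolding sum_distrib_left[symmetric] by (intro sum.cong refl) (simp add: A)
    also have "\<dots> = (\<Sum>m<n. A' i m * \<delta>' m * \<sigma> (A' k m))"
    proof (intro sum.cong refl)
      fix m' assume m: "m' \<in> {..<n}"
      have "(\<Sum>m<n. A' i m * \<sigma> (A' k m') * (if m = m' then \<delta>' m else 0)) = (\<Sum>m<n. if m = m' then A' i m' * \<delta>' m' * \<sigma> (A' k m') else 0)"
        by (intro sum.cong) (auto simp: mult_ac)
      then show "(\<Sum>m<n. A' i m * \<sigma> (A' k m') * (if m = m' then \<delta>' m else 0)) = A' i m' * \<delta>' m' * \<sigma> (A' k m')"
        using m by simp
    qed
    finally show ?thesis using A'[OF ik] by simp
  qed
  then show ?thesis unfolding form_equiv_def by (intro exI[of _ C]) simp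
qed

lemma form_equiv_cong: "(\<And>i. i < n \<Longrightarrow> \<delta> i = \<epsilon> i) \<Longrightarrow> form_equiv \<delta> \<epsilon>"
  unfolding form_equiv_def
  by (rule exI[of _ "\<lambda>i l. if l = i then 1 else 0"]) (auto simp: if_distrib[of \<sigma>] if_distrib[of "\<lambda>x. x * _"] if_distrib[of "\<lambda>x. _ * x"] cong: if_cong)

lemma form_equiv_scale:
  assumes "j < n"
  shows "form_equiv \<delta> (\<delta>(j := a * \<sigma> a * \<delta> j))"
  unfolding form_equiv_def
proof (rule exI[of _ "\<lambda>i l. if l = i then (if i = j then a else 1) else 0"], intro allI impI)
  fix i k assume ik: "i < n" "k < n"
  have "(\<Sum>l<n. (if l = i then (if i = j then a else 1) else 0) * \<delta> l * \<sigma> (if l = k then (if k = j then a else 1) else 0)) =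
      (\<Sum>l<n. if l = i then (if i = k then (if i = j then a * \<sigma> a else 1) * \<delta> i else 0) else 0)"
    by (intro sum.cong) (auto simp: mult_ac)
  then show "(\<Sum>l<n. (if l = i then (if i = j then a else 1) else 0) * \<delta> l * \<sigma> (if l = k then (if k = j then a else 1) else 0)) =
      (if i = k then (\<delta>(j := a * \<sigma> a * \<delta> j)) i else 0)"
    using ik by auto
qed

text \<open>The vector with coordinates \<open>\<alpha>\<close>, \<open>\<beta>\<close> has norm 1
  and becomes row \<open>j\<close>; the vector orthogonal to it, with coordinates
  \<open>- \<sigma> \<beta> * \<delta> j\<close> and \<open>\<sigma> \<alpha> * \<delta> 0\<close>,
  has norm \<open>\<delta> 0 * \<delta> j\<close> and becomes row 0.\<close>

lemma form_equiv_merge: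
  assumes j: "j < n" "j \<noteq> 0" and fixed: "\<sigma> (\<delta> 0) = \<delta> 0" "\<sigma> (\<delta> j) = \<delta> j"
    and one: "\<delta> 0 * (\<alpha> * \<sigma> \<alpha>) + \<delta> j * (\<beta> * \<sigma> \<beta>) = 1"
  shows "form_equiv \<delta> (\<delta>(0 := \<delta> 0 * \<delta> j, j := 1))"
proof -
  \<comment> \<open>Row \<open>i\<close> has its entries in the columns \<open>s i\<close> and
    \<open>t i\<close>: these are 0 and \<open>j\<close> for the two changed rows, and twice the
    column \<open>i\<close>, with second entry 0, for the others.\<close>
  define s where "s i = (if i = j then 0 else i)" for i :: nat
  define t where "t i = (if i = 0 then j else i)" for i :: nat
  define a where "a i = (if i = 0 then - \<sigma> \<beta> * \<delta> j else if i = j then \<alpha> else 1)" for i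
  define b where "b i = (if i = 0 then \<sigma> \<alpha> * \<delta> 0 else if i = j then \<beta> else 0)" for i
  define A where "A i l = (if l = s i then a i else 0) + (if l = t i then b i else 0)" for i l
  have "(\<Sum>l<n. A i l * \<delta> l * \<sigma> (A k l)) = (if i = k then (\<delta>(0 := \<delta> 0 * \<delta> j, j := 1)) i else 0)" if ik: "i < n" "k < n" for i k
  proof -
    have st: "s i < n" "t i < n" using ik j by (auto simp: s_def t_def)
    have "(\<Sum>l<n. A i l * \<delta> l * \<sigma> (A k l)) = (\<Sum>l<n. A i l * (\<delta> l * \<sigma> (A k l)))" by (simp add: mult.assoc)
    also have "\<dots> = a i * (\<delta> (s i) * \<sigma> (A k (s i))) + b i * (\<delta> (t i) * \<sigma> (A k (t i)))"
      unfolding A_def[of i] by (rule sum_two_terms[OF st])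
    finally have e: "(\<Sum>l<n. A i l * \<delta> l * \<sigma> (A k l)) = a i * (\<delta> (s i) * \<sigma> (A k (s i))) + b i * (\<delta> (t i) * \<sigma> (A k (t i)))" .
    have rows: "A 0 0 = - \<sigma> \<beta> * \<delta> j" "A 0 j = \<sigma> \<alpha> * \<delta> 0" "A j 0 = \<alpha>" "A j j = \<beta>"
      "\<And>l. l \<noteq> 0 \<Longrightarrow> l \<noteq> j \<Longrightarrow> A 0 l = 0" "\<And>l. l \<noteq> 0 \<Longrightarrow> l \<noteq> j \<Longrightarrow> A j l = 0"
      "\<And>i l. i \<noteq> 0 \<Longrightarrow> i \<noteq> j \<Longrightarrow> A i l = (if l = i then 1 else 0)"
      using j by (auto simp: A_def a_def b_def s_def t_def)
    consider "i = 0" | "i = j" | "i \<noteq> 0" "i \<noteq> j" by blast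
    then show ?thesis
    proof cases
      case 1
      then have e0: "(\<Sum>l<n. A i l * \<delta> l * \<sigma> (A k l)) = - \<sigma> \<beta> * \<delta> j * (\<delta> 0 * \<sigma> (A k 0)) + \<sigma> \<alpha> * \<delta> 0 * (\<delta> j * \<sigma> (A k j))"
        unfolding e using j by (simp add: a_def b_def s_def t_def)
      consider "k = 0" | "k = j" | "k \<noteq> 0" "k \<noteq> j" by blast
      then show ?thesis
      proof cases
        case A: 1
        have "(\<Sum>l<n. A i l * \<delta> l * \<sigma> (A k l)) = \<delta> 0 * \<delta> j * (\<delta> 0 * (\<alpha> * \<sigma> \<alpha>) + \<delta> j * (\<beta> * \<sigma> \<beta>))"
          unfolding e0 using A by (simp add: rows fixed algebra_simps)
        then show ?thesis using one A 1 j by simp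
      next
        case 2
        then show ?thesis unfolding e0 using 1 j by (simp add: rows algebra_simps)
      next
        case 3
        then show ?thesis unfolding e0 using 1 j by (simp add: rows)
      qed
    next
      case 2
      then have e0: "(\<Sum>l<n. A i l * \<delta> l * \<sigma> (A k l)) = \<alpha> * (\<delta> 0 * \<sigma> (A k 0)) + \<beta> * (\<delta> j * \<sigma> (A k j))"
        unfolding e using j by (simp add: a_def b_def s_def t_def)
      consider "k = 0" | "k = j" | "k \<noteq> 0" "k \<noteq> j" by blast
      then show ?thesis
      proof cases
        case A: 1
        then show ?thesis unfolding e0 using 2 j by (simp add: rows fixed algebra_simps)
      next
        case A: 2
        have "(\<Sum>l<n. A i l * \<delta> l * \<sigma> (A k l)) = \<delta> 0 * (\<alpha> * \<sigma> \<alpha>) + \<delta> j * (\<beta> * \<sigma> \<beta>)"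
          unfolding e0 using A by (simp add: rows algebra_simps)
        then show ?thesis using one A 2 j by simp
      next
        case 3
        then show ?thesis unfolding e0 using 2 j by (simp add: rows)
      qed
    next
      case 3
      then have "(\<Sum>l<n. A i l * \<delta> l * \<sigma> (A k l)) = \<delta> i * \<sigma> (A k i)"
        unfolding e by (simp add: a_def b_def s_def t_def)
      moreover have "A k i = (if i = k then 1 else 0)"
        using 3 rows(5)[of i] rows(6)[of i] rows(7)[of k i] by (cases "k = 0"; cases "k = j") auto
      ultimately show ?thesis using 3 by simp
    qed
  qed
  then show ?thesis unfolding form_equiv_def by (intro exI[of _ A]) simp
qed

text \<open>Since \<open>-1\<close> is a norm, \<open>\<langle>1, 1\<rangle>\<close> is a hyperbolic plane and represents everything.\<close>

lemma binary_form_represents_one: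
  "\<exists>\<alpha> \<beta>. \<pi> powi a * (\<alpha> * \<sigma> \<alpha>) + \<pi> powi b * (\<beta> * \<sigma> \<beta>) = 1"
proof -
  \<comment> \<open>An even power of \<open>\<pi>\<close> is a norm, so one coordinate
    suffices.\<close>
  have even_case: "\<pi> powi a * (\<pi> powi (- (a div 2)) * \<sigma> (\<pi> powi (- (a div 2)))) = 1" if "even a" for a
  proof -
    have "\<pi> powi a * (\<pi> powi (- (a div 2)) * \<sigma> (\<pi> powi (- (a div 2)))) = \<pi> powi (a + (- (a div 2) + - (a div 2)))"
      by (simp only: \<sigma>_powi \<sigma>_\<pi> power_int_add[OF disjI1[OF \<pi>_nonzero]])
    also have "a + (- (a div 2) + - (a div 2)) = 0" using that by presburger
    finally show ?thesis by simp
  qed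
  consider "even a" | "even b" | "odd a" "odd b" by blast
  then show ?thesis
  proof cases
    case 1
    then show ?thesis using even_case[OF 1] by (intro exI[of _ "\<pi> powi (- (a div 2))"] exI[of _ 0]) simp
  next
    case 2
    then show ?thesis using even_case[OF 2] by (intro exI[of _ 0] exI[of _ "\<pi> powi (- (b div 2))"]) simp
  next
    case 3
    obtain \<iota> where \<iota>: "\<iota> * \<sigma> \<iota> = -1" using ex_norm_unit[of "-1"] unit_uminus[OF unit_1] by auto
    \<comment> \<open>After scaling by even powers both coefficients are \<open>\<pi>\<close>, and
      \<open>1 / \<pi>\<close> has to be a sum of two norms: it is the difference of the squares of
      \<open>(y + 1) / 2\<close> and \<open>(y - 1) / 2\<close>, and \<open>\<iota>\<close> of norm
      -1 turns the difference into a sum.\<close>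
    define y where "y = inverse \<pi>"
    define \<alpha> where "\<alpha> = \<pi> powi (- (a div 2)) * ((y + 1) / 2)"
    define \<beta> where "\<beta> = \<pi> powi (- (b div 2)) * (\<iota> * ((y - 1) / 2))"
    have odd_case: "\<pi> powi a * (\<pi> powi (- (a div 2)) * \<pi> powi (- (a div 2))) = \<pi>" if "odd a" for a
    proof -
      have "\<pi> powi a * (\<pi> powi (- (a div 2)) * \<pi> powi (- (a div 2))) = \<pi> powi (a + (- (a div 2) + - (a div 2)))"
        by (simp only: power_int_add[OF disjI1[OF \<pi>_nonzero]])
      also have "a + (- (a div 2) + - (a div 2)) = 1" using that by presburger
      finally show ?thesis by simp
    qed
    have \<sigma>y: "\<sigma> y = y" by (simp add: y_def)
    have "\<pi> powi a * (\<alpha> * \<sigma> \<alpha>) = \<pi> powi a * (\<pi> powi (- (a div 2)) * \<pi> powi (- (a div 2))) * (((y + 1) / 2) * ((y + 1) / 2))"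
      by (simp add: \<alpha>_def \<sigma>y mult_ac)
    also have "\<dots> = \<pi> * (((y + 1) / 2) * ((y + 1) / 2))" by (simp only: odd_case[OF 3(1)])
    finally have 1: "\<pi> powi a * (\<alpha> * \<sigma> \<alpha>) = \<pi> * (((y + 1) / 2) * ((y + 1) / 2))" .
    have "\<pi> powi b * (\<beta> * \<sigma> \<beta>) = \<pi> powi b * (\<pi> powi (- (b div 2)) * \<pi> powi (- (b div 2))) * (\<iota> * \<sigma> \<iota>) * (((y - 1) / 2) * ((y - 1) / 2))"
      by (simp add: \<beta>_def \<sigma>y mult_ac)
    also have "\<dots> = - (\<pi> * (((y - 1) / 2) * ((y - 1) / 2)))" by (simp only: odd_case[OF 3(2)] \<iota>) simp
    finally have 2: "\<pi> powi b * (\<beta> * \<sigma> \<beta>) = - (\<pi> * (((y - 1) / 2) * ((y - 1) / 2)))" .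
    have "\<pi> powi a * (\<alpha> * \<sigma> \<alpha>) + \<pi> powi b * (\<beta> * \<sigma> \<beta>) = \<pi> * y"
      unfolding 1 2 by (simp add: field_simps)
    then show ?thesis by (intro exI[of _ \<alpha>] exI[of _ \<beta>]) (simp add: y_def)
  qed
qed

text \<open>One application of \<open>form_equiv_merge\<close> moves the exponent of entry
  \<open>m\<close> to entry 0 and leaves a 1 behind.\<close>

lemma form_equiv_collect:
  "m \<ge> 1 \<Longrightarrow> m \<le> n \<Longrightarrow> form_equiv (\<lambda>i. \<pi> powi e i)
    (\<lambda>i. if i = 0 then \<pi> powi (\<Sum>l<m. e l) else if i < m then 1 else \<pi> powi e i)"
proof (induction m rule: dec_induct)
  case base
  show ?case by (rule form_equiv_cong) simp
next
  case (step m)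
  define \<delta> where "\<delta> = (\<lambda>i. if i = 0 then \<pi> powi (\<Sum>l<m. e l) else if i < m then 1 else \<pi> powi e i)"
  have \<delta>0: "\<delta> 0 = \<pi> powi (\<Sum>l<m. e l)" "\<delta> m = \<pi> powi e m" using step by (simp_all add: \<delta>_def)
  obtain \<alpha> \<beta> where "\<delta> 0 * (\<alpha> * \<sigma> \<alpha>) + \<delta> m * (\<beta> * \<sigma> \<beta>) = 1"
    using binary_form_represents_one[of "\<Sum>l<m. e l" "e m"] unfolding \<delta>0 by blast
  then have "form_equiv \<delta> (\<delta>(0 := \<delta> 0 * \<delta> m, m := 1))"
    using step by (intro form_equiv_merge) (simp_all add: \<delta>0)
  moreover have "form_equiv (\<lambda>i. \<pi> powi e i) \<delta>" using step unfolding \<delta>_def by simp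
  ultimately have "form_equiv (\<lambda>i. \<pi> powi e i) (\<delta>(0 := \<delta> 0 * \<delta> m, m := 1))" by (rule form_equiv_trans[rotated])
  moreover have "\<delta>(0 := \<delta> 0 * \<delta> m, m := 1) = (\<lambda>i. if i = 0 then \<pi> powi (\<Sum>l<Suc m. e l) else if i < Suc m then 1 else \<pi> powi e i)"
    using step by (auto simp: fun_eq_iff \<delta>_def power_int_add)
  ultimately show ?case by simp
qed

text \<open>Scaling by \<open>\<pi> powi (- (S div 2))\<close> changes the collected exponent
  \<open>S\<close> by an even number.\<close>

lemma form_equiv_parity:
  "form_equiv (\<lambda>i. \<pi> powi e i) (\<lambda>i. if i = 0 then \<pi> powi ((\<Sum>l<n. e l) mod 2) else 1)"
proof -
  define S where "S = (\<Sum>l<n. e l)"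
  define \<delta> where "\<delta> = (\<lambda>i. if i = 0 then \<pi> powi S else if i < n then 1 else \<pi> powi e i)"
  have "form_equiv (\<lambda>i. \<pi> powi e i) \<delta>" unfolding \<delta>_def S_def by (rule form_equiv_collect[OF n order_refl])
  moreover have "form_equiv \<delta> (\<delta>(0 := \<pi> powi (- (S div 2)) * \<sigma> (\<pi> powi (- (S div 2))) * \<delta> 0))"
    using n by (intro form_equiv_scale) simp
  moreover have "form_equiv (\<delta>(0 := \<pi> powi (- (S div 2)) * \<sigma> (\<pi> powi (- (S div 2))) * \<delta> 0)) (\<lambda>i. if i = 0 then \<pi> powi (S mod 2) else 1)"
  proof (rule form_equiv_cong)
    fix i assume i: "i < n"
    have "\<pi> powi (- (S div 2)) * \<sigma> (\<pi> powi (- (S div 2))) * \<pi> powi S = \<pi> powi ((- (S div 2) + - (S div 2)) + S)"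
      by (simp only: \<sigma>_powi \<sigma>_\<pi> power_int_add[OF disjI1[OF \<pi>_nonzero]])
    also have "(- (S div 2) + - (S div 2)) + S = S mod 2" by presburger
    finally show "(\<delta>(0 := \<pi> powi (- (S div 2)) * \<sigma> (\<pi> powi (- (S div 2))) * \<delta> 0)) i = (if i = 0 then \<pi> powi (S mod 2) else 1)"
      using i by (simp add: \<delta>_def)
  qed
  ultimately show ?thesis unfolding S_def using form_equiv_trans by blast
qed

text \<open>The isometry is block diagonal with blocks \<open>A\<close>, 1 and the block that
  \<open>J\<close> makes dual to \<open>A\<close>. Since \<open>A\<close> carries
  \<open>\<delta>\<close> to \<open>\<delta>'\<close>, the inverse of its conjugate transpose has
  the entries \<open>A i l * \<delta> l / \<delta>' i\<close>, which gives the last block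
  explicitly.\<close>

lemma form_equiv_imp_orbit:
  assumes eqv: "form_equiv \<delta> \<delta>'" and \<delta>: "\<And>i. i < n \<Longrightarrow> \<delta> i \<noteq> 0" "\<And>i. i < n \<Longrightarrow> \<sigma> (\<delta> i) = \<delta> i"
    and \<delta>': "\<And>i. i < n \<Longrightarrow> \<delta>' i \<noteq> 0" "\<And>i. i < n \<Longrightarrow> \<sigma> (\<delta>' i) = \<delta>' i"
  shows "\<exists>g. isometry g \<and> g * form_mat \<delta> * ct g = form_mat \<delta>'"
proof -
  obtain A where A: "\<And>i k. i < n \<Longrightarrow> k < n \<Longrightarrow> (\<Sum>l<n. A i l * \<delta> l * \<sigma> (A k l)) = (if i = k then \<delta>' i else 0)"
    using eqv unfolding form_equiv_def by blast
  define h where "h i l = (if i < n \<and> l < n then A i l else if i = n \<and> l = n then 1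
    else if n < i \<and> n < l then A (2 * n - i) (2 * n - l) * \<delta> (2 * n - l) / \<delta>' (2 * n - i) else 0)" for i l
  have hlo: "h i l = A i l" if "i < n" "l < n" for i l using that by (simp add: h_def)
  have hlo0: "h i l = 0" if "i < n" "n \<le> l" for i l using that by (simp add: h_def)
  have hmid: "h n n = 1" "\<And>l. l < n \<Longrightarrow> h n l = 0" "\<And>l. l < n \<Longrightarrow> h n (2 * n - l) = 0" by (auto simp: h_def)
  have hhi: "h i (2 * n - l) = A (2 * n - i) l * \<delta> l / \<delta>' (2 * n - i)" if "n < i" "l < n" for i l
    using that by (simp add: h_def)
  have hhi0: "h i l = 0" if "n < i" "l \<le> n" for i l using that by (simp add: h_def)
  define g where "g = mat d d (\<lambda>(i, l). h i l)"
  have gc: "g \<in> carrier_mat d d" by (simp add: g_def)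
  have gram: "(\<Sum>l<d. h i l * \<sigma> (h k (2 * n - l))) = (if k = 2 * n - i then 1 else 0)" if ik: "i < d" "k < d" for i k
  proof -
    have split: "(\<Sum>l<d. h i l * \<sigma> (h k (2 * n - l))) = (\<Sum>l<n. h i l * \<sigma> (h k (2 * n - l))) + h i n * \<sigma> (h k n) + (\<Sum>l<n. h i (2 * n - l) * \<sigma> (h k l))"
    proof -
      have "(\<Sum>l<n. h i (2 * n - l) * \<sigma> (h k (2 * n - (2 * n - l)))) = (\<Sum>l<n. h i (2 * n - l) * \<sigma> (h k l))"
        by (rule sum.cong) auto
      then show ?thesis unfolding sum_odd_split[of "\<lambda>l. h i l * \<sigma> (h k (2 * n - l))"] by simp
    qed
    consider "i < n" | "i = n" | "n < i" by linarith
    then show ?thesis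
    proof cases
      case 1
      have s: "(\<Sum>l<d. h i l * \<sigma> (h k (2 * n - l))) = (\<Sum>l<n. A i l * \<sigma> (h k (2 * n - l)))"
        unfolding split using 1 by (simp add: hlo hlo0 cong: sum.cong_simp)
      show ?thesis
      proof (cases "n < k")
        case True
        define k' where "k' = 2 * n - k"
        have k': "k' < n" "k = 2 * n - k'" using True ik d by (auto simp: k'_def)
        have "(\<Sum>l<n. A i l * \<sigma> (h k (2 * n - l))) = (\<Sum>l<n. A i l * \<delta> l * \<sigma> (A k' l)) / \<delta>' k'"
          unfolding sum_divide_distrib
        proof (rule sum.cong[OF refl])
          fix l assume "l \<in> {..<n}"
          then have l: "l < n" by simp
          have "h k (2 * n - l) = A k' l * \<delta> l / \<delta>' k'" using True l by (simp add: h_def k'_def)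
          then show "A i l * \<sigma> (h k (2 * n - l)) = A i l * \<delta> l * \<sigma> (A k' l) / \<delta>' k'"
            using \<delta>(2)[OF l] \<delta>'(2)[OF k'(1)] by simp
        qed
        also have "\<dots> = (if i = k' then 1 else 0)" using A[OF 1 k'(1)] \<delta>'(1)[OF k'(1)] by auto
        also have "(i = k') = (k = 2 * n - i)" using 1 k' by auto
        finally show ?thesis using s by simp
      next
        case False
        then have "(\<Sum>l<n. A i l * \<sigma> (h k (2 * n - l))) = 0" by (intro sum.neutral) (auto simp: h_def)
        then show ?thesis using s False 1 by auto
      qed
    next
      case 2
      have "(\<Sum>l<d. h i l * \<sigma> (h k (2 * n - l))) = \<sigma> (h k n)"
        unfolding split using 2 by (simp add: hmid cong: sum.cong_simp)
      then show ?thesis using 2 by (auto simp: h_def)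
    next
      case 3
      define i' where "i' = 2 * n - i"
      have i': "i' < n" "i = 2 * n - i'" using 3 ik d by (auto simp: i'_def)
      have s: "(\<Sum>l<d. h i l * \<sigma> (h k (2 * n - l))) = (\<Sum>l<n. A i' l * \<delta> l / \<delta>' i' * \<sigma> (h k l))"
        unfolding split using 3 by (simp add: hhi hhi0 i'_def cong: sum.cong_simp)
      show ?thesis
      proof (cases "k < n")
        case True
        have "(\<Sum>l<n. A i' l * \<delta> l / \<delta>' i' * \<sigma> (h k l)) = (\<Sum>l<n. A i' l * \<delta> l * \<sigma> (A k l)) / \<delta>' i'"
          unfolding sum_divide_distrib by (rule sum.cong) (use True in \<open>auto simp: h_def\<close>)
        also have "\<dots> = (if i' = k then 1 else 0)" using A[OF i'(1) True] \<delta>'(1)[OF i'(1)] by auto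
        finally show ?thesis using s by (auto simp: i'_def)
      next
        case False
        then have "(\<Sum>l<n. A i' l * \<delta> l / \<delta>' i' * \<sigma> (h k l)) = 0" by (intro sum.neutral) (auto simp: h_def)
        moreover have "k \<noteq> 2 * n - i" using False i'(1) by (simp add: i'_def)
        ultimately show ?thesis using s by simp
      qed
    qed
  qed
  have dl: "d - Suc l = 2 * n - l" for l by (simp add: d)
  have "g * J * ct g = J"
  proof (rule eq_matI)
    fix i k assume "i < dim_row J" "k < dim_col J"
    then have ik: "i < d" "k < d" by auto
    have "(g * J * ct g) $$ (i, k) = (\<Sum>l<d. g $$ (i, l) * \<sigma> (g $$ (k, d - Suc l)))"
      by (rule gram_index[OF gc gc ik])
    also have "\<dots> = (\<Sum>l<d. h i l * \<sigma> (h k (2 * n - l)))" by (rule sum.cong) (use ik in \<open>auto simp: g_def dl[symmetric]\<close>)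
    finally show "(g * J * ct g) $$ (i, k) = J $$ (i, k)" using gram[OF ik] ik by (simp add: dl)
  qed (use gc in auto)
  then have "isometry g" using gc by (simp add: isometry_def)
  moreover have form: "(\<Sum>l<d. h i l * diag_entry \<delta> l * \<sigma> (h k l)) = (if i = k then diag_entry \<delta>' i else 0)" if ik: "i < d" "k < d" for i k
  proof -
    have split: "(\<Sum>l<d. h i l * diag_entry \<delta> l * \<sigma> (h k l)) = (\<Sum>l<n. h i l * \<delta> l * \<sigma> (h k l)) + h i n * \<sigma> (h k n) + (\<Sum>l<n. h i (2 * n - l) * inverse (\<delta> l) * \<sigma> (h k (2 * n - l)))"
    proof -
      have "(\<Sum>l<n. h i l * diag_entry \<delta> l * \<sigma> (h k l)) = (\<Sum>l<n. h i l * \<delta> l * \<sigma> (h k l))"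
        "(\<Sum>l<n. h i (2 * n - l) * diag_entry \<delta> (2 * n - l) * \<sigma> (h k (2 * n - l))) = (\<Sum>l<n. h i (2 * n - l) * inverse (\<delta> l) * \<sigma> (h k (2 * n - l)))"
        by (auto simp: diag_entry_def intro!: sum.cong)
      then show ?thesis unfolding sum_odd_split[of "\<lambda>l. h i l * diag_entry \<delta> l * \<sigma> (h k l)"] by (simp add: diag_entry_def)
    qed
    consider "i < n" | "i = n" | "n < i" by linarith
    then show ?thesis
    proof cases
      case 1
      have s: "(\<Sum>l<d. h i l * diag_entry \<delta> l * \<sigma> (h k l)) = (\<Sum>l<n. A i l * \<delta> l * \<sigma> (h k l))"
        unfolding split using 1 by (simp add: hlo hlo0 cong: sum.cong_simp)
      show ?thesis
      proof (cases "k < n")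
        case True
        have "(\<Sum>l<n. A i l * \<delta> l * \<sigma> (h k l)) = (\<Sum>l<n. A i l * \<delta> l * \<sigma> (A k l))"
          by (rule sum.cong) (use True in \<open>auto simp: h_def\<close>)
        then show ?thesis using s A[OF 1 True] 1 by (simp add: diag_entry_def)
      next
        case False
        then have "(\<Sum>l<n. A i l * \<delta> l * \<sigma> (h k l)) = 0" by (intro sum.neutral) (auto simp: h_def)
        then show ?thesis using s False 1 by auto
      qed
    next
      case 2
      have "(\<Sum>l<d. h i l * diag_entry \<delta> l * \<sigma> (h k l)) = \<sigma> (h k n)"
        unfolding split using 2 by (simp add: hmid cong: sum.cong_simp)
      moreover have "h k n = (if k = n then 1 else 0)" by (simp add: h_def)
      moreover have "diag_entry \<delta>' n = 1" by (simp add: diag_entry_def)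
      ultimately show ?thesis using 2 by (cases "k = n") simp_all
    next
      case 3
      define i' where "i' = 2 * n - i"
      have i': "i' < n" "i = 2 * n - i'" using 3 ik d by (auto simp: i'_def)
      have s: "(\<Sum>l<d. h i l * diag_entry \<delta> l * \<sigma> (h k l)) = (\<Sum>l<n. A i' l * \<delta> l / \<delta>' i' * inverse (\<delta> l) * \<sigma> (h k (2 * n - l)))"
        unfolding split using 3 by (simp add: hhi hhi0 i'_def cong: sum.cong_simp)
      show ?thesis
      proof (cases "n < k")
        case True
        define k' where "k' = 2 * n - k"
        have k': "k' < n" "k = 2 * n - k'" using True ik d by (auto simp: k'_def)
        have "(\<Sum>l<n. A i' l * \<delta> l / \<delta>' i' * inverse (\<delta> l) * \<sigma> (h k (2 * n - l))) = (\<Sum>l<n. A i' l * \<delta> l * \<sigma> (A k' l)) / (\<delta>' i' * \<delta>' k')"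
          unfolding sum_divide_distrib
        proof (rule sum.cong[OF refl])
          fix l assume "l \<in> {..<n}"
          then have l: "l < n" by simp
          have "h k (2 * n - l) = A k' l * \<delta> l / \<delta>' k'" using True l by (simp add: h_def k'_def)
          then have "\<sigma> (h k (2 * n - l)) = \<sigma> (A k' l) * \<delta> l / \<delta>' k'"
            using \<delta>(2)[OF l] \<delta>'(2)[OF k'(1)] by simp
          then show "A i' l * \<delta> l / \<delta>' i' * inverse (\<delta> l) * \<sigma> (h k (2 * n - l)) = A i' l * \<delta> l * \<sigma> (A k' l) / (\<delta>' i' * \<delta>' k')"
            using \<delta>(1)[OF l] by simp
        qed
        also have "\<dots> = (if i' = k' then inverse (\<delta>' i') else 0)"
          using A[OF i'(1) k'(1)] \<delta>'(1)[OF k'(1)] by (auto simp: field_simps)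
        also have "(i' = k') = (i = k)" using i' k' by auto
        finally have "(\<Sum>l<d. h i l * diag_entry \<delta> l * \<sigma> (h k l)) = (if i = k then inverse (\<delta>' i') else 0)" unfolding s .
        moreover have "diag_entry \<delta>' i = inverse (\<delta>' i')" using 3 by (simp add: diag_entry_def i'_def)
        ultimately show ?thesis by (cases "i = k") simp_all
      next
        case False
        then have "(\<Sum>l<n. A i' l * \<delta> l / \<delta>' i' * inverse (\<delta> l) * \<sigma> (h k (2 * n - l))) = 0" by (intro sum.neutral) (auto simp: h_def)
        then show ?thesis using s False 3 by auto
      qed
    qed
  qed
  have "g * form_mat \<delta> * ct g = form_mat \<delta>'"
  proof (rule eq_matI)
    fix i k assume "i < dim_row (form_mat \<delta>')" "k < dim_col (form_mat \<delta>')"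
    then have ik: "i < d" "k < d" by (auto simp: form_mat_def mat_diag_def)
    have gX: "(g * form_mat \<delta>) $$ (i, l) = h i l * diag_entry \<delta> l" if "l < d" for l
      unfolding form_mat_def mat_diag_mult_right[OF gc] using ik that by (simp add: g_def)
    have "(g * form_mat \<delta> * ct g) $$ (i, k) = (\<Sum>l<d. (g * form_mat \<delta>) $$ (i, l) * ct g $$ (l, k))"
      by (rule index_mult_mat_sum[of _ d d _ d]) (use gc ik in \<open>auto simp: mult_sq\<close>)
    also have "\<dots> = (\<Sum>l<d. h i l * diag_entry \<delta> l * \<sigma> (h k l))"
    proof (rule sum.cong[OF refl])
      fix l assume "l \<in> {..<d}"
      then have l: "l < d" by simp
      have "ct g $$ (l, k) = \<sigma> (h k l)" using gc ik l by (simp add: g_def)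
      then show "(g * form_mat \<delta>) $$ (i, l) * ct g $$ (l, k) = h i l * diag_entry \<delta> l * \<sigma> (h k l)" by (simp only: gX[OF l])
    qed
    finally show "(g * form_mat \<delta> * ct g) $$ (i, k) = form_mat \<delta>' $$ (i, k)" using form[OF ik] ik by (simp add: form_mat_def)
  qed (use gc in \<open>auto simp: form_mat_def mat_diag_def\<close>)
  ultimately show ?thesis by blast
qed

end

section \<open>Elementary divisors and the classification\<close>

context herm_odd
begin

definition expo :: "int list \<Rightarrow> nat \<Rightarrow> int" where
  "expo lam i = (if i < n then lam ! i else if i = n then 0 else - (lam ! (2 * n - i)))"

lemma form_mat_cong: "(\<And>i. i < n \<Longrightarrow> \<delta> i = \<epsilon> i) \<Longrightarrow> form_mat \<delta> = form_mat \<epsilon>"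
  unfolding form_mat_def by (rule eq_matI) (auto simp: mat_diag_def diag_entry_def d)

lemma x_diag_eq_form_mat: "x_diag \<pi> n lam = form_mat (\<lambda>i. \<pi> powi (lam ! i))"
  unfolding x_diag_def form_mat_def d[symmetric] by (rule arg_cong[of _ _ "mat_diag _"]) (auto simp: diag_entry_def power_int_minus)

lemma x_diag_carrier [simp]: "x_diag \<pi> n lam \<in> carrier_mat d d"
  by (simp add: x_diag_eq_form_mat)

lemma x_diag_index: "i < d \<Longrightarrow> k < d \<Longrightarrow> x_diag \<pi> n lam $$ (i, k) = (if i = k then \<pi> powi expo lam i else 0)"
  by (simp add: x_diag_eq_form_mat form_mat_def diag_entry_def expo_def power_int_minus)

lemma one_eq_form_mat: "1\<^sub>m d = form_mat (\<lambda>_. 1)"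
  unfolding form_mat_def by (rule eq_matI) (auto simp: mat_diag_def diag_entry_def)

lemma x_one_eq_form_mat: "x_one \<pi> n = form_mat (\<lambda>i. if i = 0 then \<pi> else 1)"
proof -
  have "(if i = 0 then \<pi> else if i = 2 * n then inverse \<pi> else 1) = diag_entry (\<lambda>i. if i = 0 then \<pi> else 1) i" if "i < d" for i
    using that n d by (auto simp: diag_entry_def)
  then show ?thesis unfolding x_one_def form_mat_def d[symmetric]
    by (intro eq_matI) (auto simp: mat_diag_def simp del: if_split split: if_split_asm)
qed

lemma expo_antimono:
  assumes lam: "lam \<in> dominant n" and ik: "i \<le> k" "k < d"
  shows "expo lam k \<le> expo lam i"
proof -
  have len: "length lam = n" and srt: "sorted_wrt (\<ge>) lam" and pos: "\<And>i. i < n \<Longrightarrow> 0 \<le> lam ! i"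
    using lam by (auto simp: dominant_def)
  have mono: "lam ! b \<le> lam ! a" if "a \<le> b" "b < n" for a b
    using sorted_wrt_nth_less[OF srt, of a b] that len by (cases "a = b") auto
  have hi: "2 * n - i < n" if "n < i" "i < d" for i using that d by linarith
  consider "k < n" | "i < n" "n \<le> k" | "n \<le> i" by linarith
  then show ?thesis
  proof cases
    case 1
    then show ?thesis using ik mono by (simp add: expo_def)
  next
    case 2
    then have "expo lam k \<le> 0" using pos[OF hi] ik by (auto simp: expo_def)
    moreover have "0 \<le> expo lam i" using 2 pos by (simp add: expo_def)
    ultimately show ?thesis by simp
  next
    case 3
    show ?thesis
    proof (cases "i = n")
      case True
      then show ?thesis using ik pos[OF hi] by (auto simp: expo_def)
    next
      case False
      then have "lam ! (2 * n - i) \<le> lam ! (2 * n - k)" using 3 ik hi[of i] by (intro mono) auto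
      then show ?thesis using False 3 ik by (simp add: expo_def)
    qed
  qed
qed

lemma expo_inject:
  assumes "lam \<in> dominant n" "mu \<in> dominant n" "\<And>i. i < d \<Longrightarrow> expo lam i = expo mu i"
  shows "lam = mu"
proof (rule nth_equalityI)
  show "length lam = length mu" using assms by (simp add: dominant_def)
  fix i assume "i < length lam"
  then have "i < n" "i < d" using assms(1) d by (auto simp: dominant_def)
  then show "lam ! i = mu ! i" using assms(3)[of i] by (simp add: expo_def)
qed

lemma elements_mem: "elements_mat g \<subseteq> R \<Longrightarrow> g \<in> carrier_mat d d \<Longrightarrow> i < d \<Longrightarrow> k < d \<Longrightarrow> g $$ (i, k) \<in> R"
  using elements_matI[of g d d i k] by blast

lemma elements_subset_iff:
  "g \<in> carrier_mat d d \<Longrightarrow> elements_mat g \<subseteq> R \<longleftrightarrow> (\<forall>i<d. \<forall>k<d. g $$ (i, k) \<in> R)"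
  using elements_mem[of g] by (auto dest!: elements_matD)

text \<open>Every permutation meets the block of rows \<open>\<ge> i\<close> and columns \<open>\<le> i\<close>.\<close>

lemma det_dvd:
  assumes L: "L \<in> carrier_mat d d" and LR: "\<And>a b. a < d \<Longrightarrow> b < d \<Longrightarrow> L $$ (a, b) \<in> R"
    and i: "i < d" and dvd: "\<And>a b. i \<le> a \<Longrightarrow> a < d \<Longrightarrow> b \<le> i \<Longrightarrow> \<exists>y\<in>R. L $$ (a, b) = \<pi> * y"
  shows "\<exists>y\<in>R. det L = \<pi> * y"
proof -
  have sum_dvd: "\<exists>y\<in>R. sum f A = \<pi> * y" if fA: "\<And>a. a \<in> A \<Longrightarrow> \<exists>y\<in>R. f a = \<pi> * y" for f :: "(nat \<Rightarrow> nat) \<Rightarrow> 'a" and A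
  proof -
    obtain y where y: "\<And>a. a \<in> A \<Longrightarrow> y a \<in> R" "\<And>a. a \<in> A \<Longrightarrow> f a = \<pi> * y a" using fA by metis
    have "sum f A = \<pi> * sum y A" by (simp add: y(2) sum_distrib_left cong: sum.cong)
    moreover have "sum y A \<in> R" by (rule sum_mem) (rule y)
    ultimately show ?thesis by blast
  qed
  show ?thesis unfolding det_def'[OF L]
  proof (rule sum_dvd)
    fix p assume "p \<in> {p. p permutes {0..<d}}"
    then have p: "p permutes {0..<d}" by simp
    have pd: "p a < d" if "a < d" for a using permutes_in_image[OF p, of a] that by simp
    \<comment> \<open>A permutation cannot map the \<open>d - i\<close> indices from
      \<open>i\<close> on into the \<open>d - i - 1\<close> indices above \<open>i\<close>.\<close>
    have "\<exists>a. i \<le> a \<and> a < d \<and> p a \<le> i"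
    proof (rule ccontr)
      assume "\<not> ?thesis"
      then have "p ` {i..<d} \<subseteq> {Suc i..<d}" using pd by (auto simp: not_le Suc_le_eq)
      then have "card (p ` {i..<d}) \<le> card {Suc i..<d}" by (intro card_mono) auto
      moreover have "card (p ` {i..<d}) = card {i..<d}"
        by (rule card_image) (rule inj_on_subset[OF permutes_inj[OF p]], simp)
      ultimately show False using i by simp
    qed
    then obtain a where a: "i \<le> a" "a < d" "p a \<le> i" by blast
    obtain y where y: "y \<in> R" "L $$ (a, p a) = \<pi> * y" using dvd[OF a] by blast
    have "(\<Prod>b = 0..<d. L $$ (b, p b)) = L $$ (a, p a) * (\<Prod>b\<in>{0..<d} - {a}. L $$ (b, p b))"
      using a by (intro prod.remove) auto
    then have "signof p * (\<Prod>b = 0..<d. L $$ (b, p b)) = \<pi> * (signof p * (y * (\<Prod>b\<in>{0..<d} - {a}. L $$ (b, p b))))"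
      by (simp add: y(2) mult_ac)
    moreover have "signof p * (y * (\<Prod>b\<in>{0..<d} - {a}. L $$ (b, p b))) \<in> R"
      by (intro mult_mem prod_mem y LR pd) (auto simp: sign_def)
    ultimately show "\<exists>y\<in>R. signof p * (\<Prod>b = 0..<d. L $$ (b, p b)) = \<pi> * y" by blast
  qed
qed

text \<open>The integral inverse \<open>L\<close> of \<open>ct k\<close> satisfies
  \<open>k * x_diag \<pi> n lam = x_diag \<pi> n mu * L\<close>, so its entry at
  \<open>(a, b)\<close> is that of \<open>k\<close> times \<open>\<pi>\<close> to the power
  \<open>expo lam b - expo mu a\<close>. If the inequality failed at \<open>i\<close>, monotonicity
  would make this power positive for all \<open>a \<ge> i\<close> and \<open>b \<le> i\<close>, and
  \<open>det_dvd\<close> would make the unit \<open>det L\<close> divisible by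
  \<open>\<pi>\<close>.\<close>

lemma expo_le:
  assumes k: "isometry k" "elements_mat k \<subseteq> R" and lm: "lam \<in> dominant n" "mu \<in> dominant n"
    and eq: "k * x_diag \<pi> n lam * ct k = x_diag \<pi> n mu" and i: "i < d"
  shows "expo lam i \<le> expo mu i"
proof (rule ccontr)
  assume neg: "\<not> expo lam i \<le> expo mu i"
  have kc: "k \<in> carrier_mat d d" and kJ: "ct k * J * k = J" using k(1) isometry_iff[of k] by (auto simp: isometry_def)
  define L where "L = J * k * J"
  have L: "L \<in> carrier_mat d d" using kc by (simp add: L_def mult_sq)
  have ctL: "ct k * L = 1\<^sub>m d"
  proof -
    have "ct k * L = ct k * J * k * J" using kc by (simp add: L_def assoc_sq mult_sq)
    then show ?thesis by (simp add: kJ antidiag_antidiag)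
  qed
  have "k * x_diag \<pi> n lam * (ct k * L) = x_diag \<pi> n mu * L"
    unfolding eq[symmetric] using kc L by (simp add: assoc_sq mult_sq)
  then have rel: "k * x_diag \<pi> n lam = x_diag \<pi> n mu * L"
    using kc right_mult_one_mat[of "k * x_diag \<pi> n lam" d d] by (simp add: ctL mult_sq)
  have Lent: "L $$ (a, b) = k $$ (d - Suc a, d - Suc b)" if "a < d" "b < d" for a b
  proof -
    have "L $$ (a, b) = (J * k) $$ (a, d - Suc b)" unfolding L_def
      by (rule mult_antidiag_index[of _ d]) (use kc that in \<open>auto simp: mult_sq\<close>)
    also have "\<dots> = k $$ (d - Suc a, d - Suc b)"
      by (rule antidiag_mult_index[of _ _ d]) (use kc that in auto)
    finally show ?thesis .
  qed
  have LR: "L $$ (a, b) \<in> R" if "a < d" "b < d" for a b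
    using Lent[OF that] elements_mem[OF k(2) kc] that by simp
  have ent: "k $$ (a, b) * \<pi> powi expo lam b = \<pi> powi expo mu a * L $$ (a, b)" if ab: "a < d" "b < d" for a b
  proof -
    have "(k * x_diag \<pi> n lam) $$ (a, b) = (\<Sum>l<d. k $$ (a, l) * x_diag \<pi> n lam $$ (l, b))"
      by (rule index_mult_mat_sum[OF kc x_diag_carrier ab])
    also have "\<dots> = (\<Sum>l<d. if l = b then k $$ (a, b) * \<pi> powi expo lam b else 0)"
      by (rule sum.cong) (use ab in \<open>auto simp: x_diag_index\<close>)
    finally have 1: "(k * x_diag \<pi> n lam) $$ (a, b) = k $$ (a, b) * \<pi> powi expo lam b" using ab by simp
    have "(x_diag \<pi> n mu * L) $$ (a, b) = (\<Sum>l<d. x_diag \<pi> n mu $$ (a, l) * L $$ (l, b))"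
      by (rule index_mult_mat_sum[OF x_diag_carrier L ab])
    also have "\<dots> = (\<Sum>l<d. if l = a then \<pi> powi expo mu a * L $$ (a, b) else 0)"
      by (rule sum.cong) (use ab in \<open>auto simp: x_diag_index\<close>)
    finally have 2: "(x_diag \<pi> n mu * L) $$ (a, b) = \<pi> powi expo mu a * L $$ (a, b)" using ab by simp
    show ?thesis using 1 2 rel by simp
  qed
  have "\<exists>y\<in>R. det L = \<pi> * y"
  proof (rule det_dvd[OF L LR i])
    fix a b assume ab: "i \<le> a" "a < d" "b \<le> i"
    then have b: "b < d" using i by simp
    have "expo mu a < expo lam b"
      using neg expo_antimono[OF lm(2) ab(1,2)] expo_antimono[OF lm(1) ab(3) i] by linarith
    \<comment> \<open>The exponent that remains after one factor \<open>\<pi>\<close> is taken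
      out.\<close>
    define s where "s = nat (expo lam b - expo mu a - 1)"
    have s: "expo lam b = expo mu a + (1 + int s)" using \<open>expo mu a < expo lam b\<close> by (simp add: s_def)
    have "\<pi> powi expo mu a * L $$ (a, b) = \<pi> powi expo mu a * (\<pi> * (\<pi> ^ s * k $$ (a, b)))"
      unfolding ent[OF ab(2) b, symmetric] s power_int_add[OF disjI1[OF \<pi>_nonzero]] by (simp add: mult_ac)
    then have "L $$ (a, b) = \<pi> * (\<pi> ^ s * k $$ (a, b))" by simp
    moreover have "\<pi> ^ s * k $$ (a, b) \<in> R"
      by (intro mult_mem power_mem \<pi>_mem elements_mem[OF k(2) kc] ab(2) b)
    ultimately show "\<exists>y\<in>R. L $$ (a, b) = \<pi> * y" by blast
  qed
  then obtain y where y: "y \<in> R" "det L = \<pi> * y" by blast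
  have "det (ct k) * det L = 1" using det_mult[OF conj_transpose_carrier[OF kc] L, of \<sigma>] ctL by simp
  then have "\<pi> * (y * \<sigma> (det k)) = 1" using det_ct[OF kc] y(2) by (simp add: mult_ac)
  moreover have "det k \<in> R" using elements_mem[OF k(2) kc] by (intro det_mem[OF kc])
  ultimately show False using \<pi>_not_unit mult_mem[OF y(1) \<sigma>_mem] by blast
qed

text \<open>The inverse of \<open>k\<close> has the conjugates of the entries of \<open>k\<close> in
  other places, and \<open>\<sigma>\<close> preserves integrality.\<close>

lemma K_inverse:
  assumes "isometry k" "elements_mat k \<subseteq> R"
  shows "isometry (J * ct k * J)" "elements_mat (J * ct k * J) \<subseteq> R"
proof -
  have kc: "k \<in> carrier_mat d d" using assms(1) by (simp add: isometry_def)
  show "isometry (J * ct k * J)" by (rule isometry_inverse(3)[OF assms(1)])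
  have "(J * ct k * J) $$ (i, l) = \<sigma> (k $$ (d - Suc l, d - Suc i))" if il: "i < d" "l < d" for i l
  proof -
    have "(J * ct k * J) $$ (i, l) = (J * ct k) $$ (i, d - Suc l)"
      by (rule mult_antidiag_index[of _ d]) (use kc il in \<open>auto simp: mult_sq\<close>)
    also have "\<dots> = ct k $$ (d - Suc i, d - Suc l)"
      by (rule antidiag_mult_index[of _ _ d]) (use kc il in auto)
    finally show ?thesis using kc il by simp
  qed
  then show "elements_mat (J * ct k * J) \<subseteq> R"
    using kc by (subst elements_subset_iff) (auto simp: mult_sq intro!: \<sigma>_mem elements_mem[OF assms(2)])
qed

lemma K_mult:
  assumes "isometry k" "elements_mat k \<subseteq> R" "isometry h" "elements_mat h \<subseteq> R"
  shows "isometry (k * h)" "elements_mat (k * h) \<subseteq> R"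
proof -
  have c: "k \<in> carrier_mat d d" "h \<in> carrier_mat d d" using assms(1,3) by (auto simp: isometry_def)
  show "isometry (k * h)" by (rule isometry_mult[OF assms(1,3)])
  have "(k * h) $$ (i, l) \<in> R" if il: "i < d" "l < d" for i l
    unfolding index_mult_mat_sum[OF c il]
    by (intro sum_mem mult_mem elements_mem[OF assms(2) c(1)] elements_mem[OF assms(4) c(2)]) (use il in auto)
  then show "elements_mat (k * h) \<subseteq> R" using c by (subst elements_subset_iff) (auto simp: mult_sq simp del: index_mult_mat(1))
qed

text \<open>The inverse of \<open>k\<close> gives the opposite inequalities.\<close>

lemma K_equiv_imp_eq:
  assumes k: "isometry k" "elements_mat k \<subseteq> R" and lm: "lam \<in> dominant n" "mu \<in> dominant n"
    and eq: "k * x_diag \<pi> n lam * ct k = x_diag \<pi> n mu"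
  shows "lam = mu"
proof (rule expo_inject[OF lm])
  fix i assume i: "i < d"
  show "expo lam i = expo mu i"
    using expo_le[OF k lm eq i]
      expo_le[OF K_inverse[OF k] lm(2,1) act_inverse[OF k(1) x_diag_carrier eq] i] by simp
qed

section \<open>The two groups, their orbits and the classification\<close>

lemma unitary_group_eq: "unitary_group \<sigma> n = {g. isometry g}"
proof -
  have "g \<in> unitary_group \<sigma> n \<longleftrightarrow> isometry g" for g
    using isometry_invertible[of g] unfolding isometry_iff[of g] unitary_group_def d[symmetric] by auto
  then show ?thesis by blast
qed

lemma integral_unitary_group_eq: "integral_unitary_group \<sigma> R n = {g. isometry g \<and> elements_mat g \<subseteq> R}"
  by (auto simp: integral_unitary_group_def unitary_group_eq)

lemma hermitian_space_eq: "hermitian_space \<sigma> n = {x. in_X x}"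
  unfolding hermitian_space_def unitary_group_eq in_X_def hermitian_def d[symmetric] by auto

definition Gorb :: "'a mat \<Rightarrow> 'a mat set" where "Gorb = herm_orbit \<sigma> (unitary_group \<sigma> n)"
definition Korb :: "'a mat \<Rightarrow> 'a mat set" where "Korb = herm_orbit \<sigma> (integral_unitary_group \<sigma> R n)"

lemma Gorb_iff: "y \<in> Gorb x \<longleftrightarrow> (\<exists>g. isometry g \<and> y = g * x * ct g)"
  by (auto simp: Gorb_def herm_orbit_def unitary_group_eq)

lemma Korb_iff: "y \<in> Korb x \<longleftrightarrow> (\<exists>g. isometry g \<and> elements_mat g \<subseteq> R \<and> y = g * x * ct g)"
  by (auto simp: Korb_def herm_orbit_def integral_unitary_group_eq)

lemma Gorb_refl: "x \<in> carrier_mat d d \<Longrightarrow> x \<in> Gorb x"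
  unfolding Gorb_iff by (rule exI[of _ "1\<^sub>m d"]) (auto simp: isometry_def)

lemma Gorb_eq:
  assumes x: "x \<in> carrier_mat d d" and y: "y \<in> Gorb x"
  shows "Gorb y = Gorb x"
proof -
  obtain g where g: "isometry g" "y = g * x * ct g" using y by (auto simp: Gorb_iff)
  have gc: "g \<in> carrier_mat d d" using g(1) by (simp add: isometry_def)
  have yc: "y \<in> carrier_mat d d" using g gc x by (simp add: mult_sq)
  have sub: "Gorb v \<subseteq> Gorb w" if w: "w \<in> carrier_mat d d" and v: "isometry h" "v = h * w * ct h" for v w h
  proof
    fix u assume "u \<in> Gorb v"
    then obtain h' where h': "isometry h'" "u = h' * v * ct h'" by (auto simp: Gorb_iff)
    then have "u = (h' * h) * w * ct (h' * h)"
      using act_act[of h h' w] v w by (simp add: isometry_def)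
    then show "u \<in> Gorb w" using isometry_mult[OF h'(1) v(1)] by (auto simp: Gorb_iff)
  qed
  show ?thesis
  proof
    show "Gorb y \<subseteq> Gorb x" by (rule sub[OF x g])
    show "Gorb x \<subseteq> Gorb y"
      by (rule sub[OF yc isometry_inverse(3)[OF g(1)]]) (rule act_inverse[OF g(1) x g(2)[symmetric], symmetric])
  qed
qed

lemma Korb_subset_Gorb: "Korb x \<subseteq> Gorb x"
  by (auto simp: Korb_iff Gorb_iff)

lemma in_X_carrier: "in_X x \<Longrightarrow> x \<in> carrier_mat d d"
  by (simp add: in_X_def hermitian_def isometry_def)

lemma ex_Korb:
  assumes "in_X x"
  shows "\<exists>lam\<in>dominant n. x \<in> Korb (x_diag \<pi> n lam)"
proof -
  obtain k lam where k: "isometry k" "elements_mat k \<subseteq> R" "lam \<in> dominant n" "k * x * ct k = x_diag \<pi> n lam"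
    using K_reduction[OF _ d] assms unfolding in_X_def by blast
  have "x = (J * ct k * J) * x_diag \<pi> n lam * ct (J * ct k * J)"
    by (rule act_inverse[OF k(1) in_X_carrier[OF assms] k(4), symmetric])
  then show ?thesis using K_inverse[OF k(1,2)] k(3) by (auto simp: Korb_iff)
qed

text \<open>Equivalent diagonal forms give the same orbit, and the exponents can be replaced by the
  parity of their sum in the first place.\<close>

lemma x_diag_Gorb:
  assumes "lam \<in> dominant n"
  shows "Gorb (x_diag \<pi> n lam) = Gorb (if even (sum_list lam) then 1\<^sub>m d else x_one \<pi> n)"
proof -
  define S where "S = (\<Sum>l<n. lam ! l)"
  have S: "S = sum_list lam" using assms by (simp add: S_def dominant_def sum_list_sum_nth lessThan_atLeast0)
  define \<delta> where "\<delta> = (\<lambda>i::nat. if i = 0 then \<pi> powi (S mod 2) else 1)"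
  have "\<exists>g. isometry g \<and> g * form_mat (\<lambda>i. \<pi> powi (lam ! i)) * ct g = form_mat \<delta>"
    unfolding \<delta>_def S_def by (rule form_equiv_imp_orbit[OF form_equiv_parity]) auto
  then have "form_mat \<delta> \<in> Gorb (x_diag \<pi> n lam)" by (auto simp: Gorb_iff x_diag_eq_form_mat)
  then have "Gorb (form_mat \<delta>) = Gorb (x_diag \<pi> n lam)" by (rule Gorb_eq[OF x_diag_carrier])
  moreover have "form_mat \<delta> = (if even (sum_list lam) then 1\<^sub>m d else x_one \<pi> n)"
  proof (cases "even S")
    case True
    then have "form_mat \<delta> = form_mat (\<lambda>_. 1)" by (intro form_mat_cong) (auto simp: \<delta>_def even_iff_mod_2_eq_zero)
    then show ?thesis using True S by (simp add: one_eq_form_mat)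
  next
    case False
    then have "form_mat \<delta> = form_mat (\<lambda>i. if i = 0 then \<pi> else 1)" by (intro form_mat_cong) (auto simp: \<delta>_def odd_iff_mod_2_eq_one)
    then show ?thesis using False S by (simp add: x_one_eq_form_mat)
  qed
  ultimately show ?thesis by simp
qed

text \<open>Otherwise \<open>\<pi>\<close>, the product of the upper diagonal entries, would be a
  norm of odd valuation.\<close>

lemma x_one_notin_Gorb_one: "x_one \<pi> n \<notin> Gorb (1\<^sub>m d)"
proof
  assume "x_one \<pi> n \<in> Gorb (1\<^sub>m d)"
  then obtain g where g: "isometry g" "x_one \<pi> n = g * 1\<^sub>m d * ct g" by (auto simp: Gorb_iff)
  have "g * ct g = form_mat (\<lambda>i. if i = 0 then \<pi> else 1)"
    using g right_mult_one_mat[of g d d] by (simp add: x_one_eq_form_mat isometry_def)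
  then have "\<exists>a. (\<Prod>i<n. if i = 0 then \<pi> else 1) = a * \<sigma> a"
    by (rule orbit_one_norm[rotated 3]) (auto simp: g(1))
  then obtain a where a: "(\<Prod>i<n. if i = 0 then \<pi> else 1) = a * \<sigma> a" by blast
  have "(\<Prod>i<n. if i = 0 then \<pi> else 1) = \<pi>" using n by (simp add: prod.delta)
  then have "\<pi> powi 1 = a * \<sigma> a" using a by simp
  then have "even (1 :: int)" by (rule norm_even_valuation)
  then show False by simp
qed

lemma orbit_classification:
  "Gorb ` {x. in_X x} = {Gorb (1\<^sub>m d), Gorb (x_one \<pi> n)}
   \<and> Gorb (1\<^sub>m d) \<noteq> Gorb (x_one \<pi> n)
   \<and> Gorb (1\<^sub>m d) \<union> Gorb (x_one \<pi> n) = {x. in_X x}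
   \<and> Gorb (1\<^sub>m d) = (\<Union>lam \<in> {lam \<in> dominant n. even (sum_list lam)}. Korb (x_diag \<pi> n lam))
   \<and> disjoint_family_on (\<lambda>lam. Korb (x_diag \<pi> n lam)) {lam \<in> dominant n. even (sum_list lam)}
   \<and> Gorb (x_one \<pi> n) = (\<Union>lam \<in> {lam \<in> dominant n. odd (sum_list lam)}. Korb (x_diag \<pi> n lam))
   \<and> disjoint_family_on (\<lambda>lam. Korb (x_diag \<pi> n lam)) {lam \<in> dominant n. odd (sum_list lam)}"
proof -
  have X1: "in_X (1\<^sub>m d)" unfolding one_eq_form_mat by (rule form_mat_in_X) auto
  have X2: "in_X (x_one \<pi> n)" unfolding x_one_eq_form_mat by (rule form_mat_in_X) auto
  note c1 = in_X_carrier[OF X1] and c2 = in_X_carrier[OF X2]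
  have GX: "in_X y" if "in_X x" "y \<in> Gorb x" for x y using that in_X_act by (auto simp: Gorb_iff)
  have ne: "Gorb (1\<^sub>m d) \<noteq> Gorb (x_one \<pi> n)" using x_one_notin_Gorb_one Gorb_refl[OF c2] by metis
  have disj: "Gorb (1\<^sub>m d) \<inter> Gorb (x_one \<pi> n) = {}" using Gorb_eq[OF c1] Gorb_eq[OF c2] ne by blast
  have un: "Gorb (1\<^sub>m d) \<union> Gorb (x_one \<pi> n) = {x. in_X x}"
  proof
    show "Gorb (1\<^sub>m d) \<union> Gorb (x_one \<pi> n) \<subseteq> {x. in_X x}" using GX X1 X2 by blast
    show "{x. in_X x} \<subseteq> Gorb (1\<^sub>m d) \<union> Gorb (x_one \<pi> n)"
    proof
      fix x assume "x \<in> {x. in_X x}"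
      then obtain lam where lam: "lam \<in> dominant n" "x \<in> Korb (x_diag \<pi> n lam)" using ex_Korb by blast
      then have "x \<in> Gorb (x_diag \<pi> n lam)" using Korb_subset_Gorb by blast
      then show "x \<in> Gorb (1\<^sub>m d) \<union> Gorb (x_one \<pi> n)" unfolding x_diag_Gorb[OF lam(1)] by (auto split: if_splits)
    qed
  qed
  have img: "Gorb ` {x. in_X x} = {Gorb (1\<^sub>m d), Gorb (x_one \<pi> n)}"
  proof
    show "Gorb ` {x. in_X x} \<subseteq> {Gorb (1\<^sub>m d), Gorb (x_one \<pi> n)}"
      unfolding un[symmetric] using Gorb_eq[OF c1] Gorb_eq[OF c2] by blast
    show "{Gorb (1\<^sub>m d), Gorb (x_one \<pi> n)} \<subseteq> Gorb ` {x. in_X x}" using X1 X2 by blast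
  qed
  have even: "Gorb (1\<^sub>m d) = (\<Union>lam \<in> {lam \<in> dominant n. even (sum_list lam)}. Korb (x_diag \<pi> n lam))" (is "_ = ?E")
  proof
    show "?E \<subseteq> Gorb (1\<^sub>m d)" using Korb_subset_Gorb x_diag_Gorb by fastforce
    show "Gorb (1\<^sub>m d) \<subseteq> ?E"
    proof
      fix x assume x: "x \<in> Gorb (1\<^sub>m d)"
      then obtain lam where lam: "lam \<in> dominant n" "x \<in> Korb (x_diag \<pi> n lam)" using ex_Korb GX[OF X1] by blast
      have "x \<in> Gorb (x_diag \<pi> n lam)" using lam Korb_subset_Gorb by blast
      then have "even (sum_list lam)" using x disj x_diag_Gorb[OF lam(1)] by (auto split: if_splits)
      then show "x \<in> ?E" using lam by blast
    qed
  qed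
  have odd: "Gorb (x_one \<pi> n) = (\<Union>lam \<in> {lam \<in> dominant n. odd (sum_list lam)}. Korb (x_diag \<pi> n lam))" (is "_ = ?O")
  proof
    show "?O \<subseteq> Gorb (x_one \<pi> n)" using Korb_subset_Gorb x_diag_Gorb by fastforce
    show "Gorb (x_one \<pi> n) \<subseteq> ?O"
    proof
      fix x assume x: "x \<in> Gorb (x_one \<pi> n)"
      then obtain lam where lam: "lam \<in> dominant n" "x \<in> Korb (x_diag \<pi> n lam)" using ex_Korb GX[OF X2] by blast
      have "x \<in> Gorb (x_diag \<pi> n lam)" using lam Korb_subset_Gorb by blast
      then have "odd (sum_list lam)" using x disj x_diag_Gorb[OF lam(1)] by (auto split: if_splits)
      then show "x \<in> ?O" using lam by blast
    qed
  qed
  \<comment> \<open>A common point of two integral orbits yields an element of the integral group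
    that carries one diagonal matrix to the other.\<close>
  have eq: "lam = mu" if lm: "lam \<in> dominant n" "mu \<in> dominant n"
    and z: "z \<in> Korb (x_diag \<pi> n lam)" "z \<in> Korb (x_diag \<pi> n mu)" for lam mu z
  proof -
    obtain g h where g: "isometry g" "elements_mat g \<subseteq> R" "z = g * x_diag \<pi> n lam * ct g"
      and h: "isometry h" "elements_mat h \<subseteq> R" "z = h * x_diag \<pi> n mu * ct h" using z unfolding Korb_iff by blast
    define h' where "h' = J * ct h * J"
    have h': "isometry h'" "elements_mat h' \<subseteq> R" unfolding h'_def by (rule K_inverse[OF h(1,2)])+
    have "h' * z * ct h' = x_diag \<pi> n mu" unfolding h'_def by (rule act_inverse[OF h(1) x_diag_carrier h(3)[symmetric]])
    then have "(h' * g) * x_diag \<pi> n lam * ct (h' * g) = x_diag \<pi> n mu"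
      using act_act[of g h' "x_diag \<pi> n lam"] g(1,3) h'(1) by (simp add: isometry_def)
    then show ?thesis by (rule K_equiv_imp_eq[OF K_mult[OF h' g(1,2)] lm])
  qed
  have "disjoint_family_on (\<lambda>lam. Korb (x_diag \<pi> n lam)) A" if "A \<subseteq> dominant n" for A
    unfolding disjoint_family_on_def using eq that by blast
  then show ?thesis using img ne un even odd by auto
qed

end

theorem theorem1p11:
  fixes p n :: nat
    and Q k :: "'a::field_char_0 set"
    and N :: "'a \<Rightarrow> real"
    and \<sigma> :: "'a \<Rightarrow> 'a"
    and \<pi> :: 'a
    and G K X\<^sub>n :: "'a mat set"
  assumes "prime p" and "odd p"
    and "padic_numbers p Q N"
    and "finite_extension Q k"
    and "quadratic_extension k UNIV"
    and "unramified Q N k UNIV"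
    and "automorphism_over k \<sigma>" and "\<sigma> \<noteq> id"
    and "prime_element Q N k \<pi>"
    and "n \<ge> 1"
  defines "G \<equiv> unitary_group \<sigma> n"
    and "K \<equiv> integral_unitary_group \<sigma> (ring_of_integers Q N UNIV) n"
    and "X\<^sub>n \<equiv> hermitian_space \<sigma> n"
  shows
    "herm_orbit \<sigma> G ` X\<^sub>n = {herm_orbit \<sigma> G (1\<^sub>m (2 * n + 1)), herm_orbit \<sigma> G (x_one \<pi> n)}
     \<and> herm_orbit \<sigma> G (1\<^sub>m (2 * n + 1)) \<noteq> herm_orbit \<sigma> G (x_one \<pi> n)
     \<and> herm_orbit \<sigma> G (1\<^sub>m (2 * n + 1)) \<union> herm_orbit \<sigma> G (x_one \<pi> n) = X\<^sub>n
     \<and> herm_orbit \<sigma> G (1\<^sub>m (2 * n + 1)) =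
         (\<Union>lam \<in> {lam \<in> dominant n. even (sum_list lam)}. herm_orbit \<sigma> K (x_diag \<pi> n lam))
     \<and> disjoint_family_on (\<lambda>lam. herm_orbit \<sigma> K (x_diag \<pi> n lam))
         {lam \<in> dominant n. even (sum_list lam)}
     \<and> herm_orbit \<sigma> G (x_one \<pi> n) =
         (\<Union>lam \<in> {lam \<in> dominant n. odd (sum_list lam)}. herm_orbit \<sigma> K (x_diag \<pi> n lam))
     \<and> disjoint_family_on (\<lambda>lam. herm_orbit \<sigma> K (x_diag \<pi> n lam))
         {lam \<in> dominant n. odd (sum_list lam)}"
proof -
  interpret padic_quadratic p Q N k \<sigma> \<pi>
    using assms(1-9) by unfold_locales
  interpret H: herm_odd \<O> \<pi> \<sigma> "2 * n + 1" n
    using \<open>n \<ge> 1\<close> by unfold_locales simp_all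
  show ?thesis
    using H.orbit_classification
    unfolding H.Gorb_def H.Korb_def H.hermitian_space_eq[symmetric] G_def K_def X\<^sub>n_def .
qed

end
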